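(* Let $\mathfrak g$ be a finite-dimensional strongly unimodular Lie algebra and $X_1,\dots,X_n\in\mathfrak g$. In non-abelian $BF$ theory on $\mathbb C$ in Lorenz gauge, for pairwise distinct $z,w_1,w_2\in\mathbb C$, the $3$-point correlation function of the composite field $\bar\gamma\cdots\bar\gamma$ ($n$ factors) with $a$ and $\gamma$, valued in $\mathfrak g\otimes\mathfrak g^*\simeq\mathrm{End}(\mathfrak g)$, is $$\big\langle \langle (\bar\gamma\otimes\cdots \otimes\bar\gamma)(z),X_1\otimes\cdots \otimes X_n \rangle\; a(w_1)\otimes \gamma(w_2) \big\rangle =\frac{g^n}{n!} \left(\sum_{\sigma\in S_n}\mathrm{ad}(X_{\sigma(1)})\,\mathrm{ad}(X_{\sigma(2)})\cdots \mathrm{ad}(X_{\sigma(n)})\right) \frac{1}{w_1-w_2} \log^n\left|\frac{z-w_2}{z-w_1}\right| .$$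
   Context: Strongly unimodular means $\mathrm{tr}_{\mathfrak g}(\mathrm{ad}_{X_1}\cdots \mathrm{ad}_{X_k})=(-1)^k\,\mathrm{tr}_{\mathfrak g}(\mathrm{ad}_{X_k}\cdots \mathrm{ad}_{X_1})$ for all $k\ge 1$, $X_i\in\mathfrak g$. $\langle\cdot,\cdot\rangle$ is the canonical pairing between $\mathfrak g$ and $\mathfrak g^*$. Write $\partial=\partial/\partial z$, $\bar\partial=\partial/\partial\bar z$, and let $d^2u$ be the standard area form on $\mathbb C$. Fundamental fields on $\mathbb C$: $a,\bar a,c$ are $\mathfrak g$-valued, $\gamma,\bar\gamma,b$ are $\mathfrak g^*$-valued; $a,\bar a,\gamma,\bar\gamma$ are even, $b,c$ are odd. Free correlators $\langle\cdots\rangle_0$ are given by Wick's lemma (with Koszul signs) from the propagators, valued in $\mathfrak g\otimes\mathfrak g^*$: $\langle c(w)\otimes b(z)\rangle_0=(2\log|w-z|+C)\,\mathbb 1$ ($C$ a constant), $\langle a(w)\otimes\gamma(z)\rangle_0=\frac{\mathbb 1}{w-z}$, $\langle \bar a(w)\otimes\bar\gamma(z)\rangle_0=\frac{\mathbb 1}{\bar w-\bar z}$, all other propagators being zero; derivatives of fields act by differentiating propagators. With the interaction $V=\langle\gamma-\bar\gamma,[a,\bar a]\rangle+\langle\partial b,[\bar a,c]\rangle+\langle\bar\partial b,[a,c]\rangle$, correlators of the theory at pairwise distinct points are $$\langle\Phi_1(z_1)\cdots\Phi_n(z_n)\rangle=\sum_{N\ge0}\frac1{N!}\Big(\frac{g}{2\pi}\Big)^N\int_{\mathbb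 C^N}d^2u_1\cdots d^2u_N\,\langle\Phi_1(z_1)\cdots\Phi_n(z_n)V(u_1)\cdots V(u_N)\rangle_0 ,$$ with no Wick contractions inside a single $V(u_i)$. Correlators of the composite field $(\bar\gamma\otimes\cdots\otimes\bar\gamma)(z)$ are obtained from correlators with $\bar\gamma(z_1)\otimes\cdots\otimes\bar\gamma(z_n)$ by letting $z_1,\dots,z_n\to z$ (the fields $\bar\gamma$ have mutually regular operator products, so no singular terms need to be subtracted). *)

theory Defs
  imports "HOL-Analysis.Analysis"
begin

section \<open>Strongly unimodular Lie algebras\<close>

locale lie_algebra = finite_dimensional_vector_space scale \<B>
  for scale :: "'k::field \<Rightarrow> 'g::ab_group_add \<Rightarrow> 'g" (infixr \<open>*s\<close> 75)
    and \<B> :: "'g set" +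
  fixes bracket :: "'g \<Rightarrow> 'g \<Rightarrow> 'g"
  assumes bracket_add_left: "bracket (x + y) z = bracket x z + bracket y z"
    and bracket_add_right: "bracket x (y + z) = bracket x y + bracket x z"
    and bracket_scale_left: "bracket (r *s x) y = r *s bracket x y"
    and bracket_scale_right: "bracket x (r *s y) = r *s bracket x y"
    and bracket_self: "bracket x x = 0"
    and jacobi: "bracket x (bracket y z) + bracket y (bracket z x) + bracket z (bracket x y) = 0"
begin

text \<open>The element of the dual basis belonging to \<open>b \<in> \<B>\<close>.\<close>
definition dual_basis :: "'g \<Rightarrow> 'g \<Rightarrow> 'k" where
  "dual_basis b = (\<lambda>x. representation \<B> x b)"

definition trace :: "('g \<Rightarrow> 'g) \<Rightarrow> 'k" where
  "trace f = (\<Sum>b\<in>\<B>. dual_basis b (f b))"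

definition ad :: "'g \<Rightarrow> 'g \<Rightarrow> 'g" where
  "ad x = (\<lambda>y. bracket x y)"

text \<open>\<open>ad_word [x\<^sub>1, \<dots>, x\<^sub>k] = ad x\<^sub>1 \<circ> \<dots> \<circ> ad x\<^sub>k\<close>\<close>
definition ad_word :: "'g list \<Rightarrow> 'g \<Rightarrow> 'g" where
  "ad_word xs = foldr (\<lambda>x f. ad x \<circ> f) xs id"

definition strongly_unimodular :: bool where
  "strongly_unimodular \<longleftrightarrow>
     (\<forall>xs. xs \<noteq> [] \<longrightarrow> trace (ad_word xs) = (-1) ^ length xs * trace (ad_word (rev xs)))"

end


section \<open>Free correlators\<close>

text \<open>
  Fields are treated through their components: for a covector \<open>\<xi>\<close> on the Lie algebra,
  \<open>Fa \<xi>\<close> stands for \<open>\<langle>\<xi>, a\<rangle>\<close>, and for a vector \<open>x\<close>, \<open>Fgamma x\<close> stands for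
  \<open>\<langle>\<gamma>, x\<rangle>\<close>; likewise for the other four fields.
\<close>
datatype ('k, 'g) field_comp =
    Fa "'g \<Rightarrow> 'k" | Fabar "'g \<Rightarrow> 'k" | Fc "'g \<Rightarrow> 'k"
  | Fgamma 'g | Fgammabar 'g | Fb 'g

fun odd_field :: "('k, 'g) field_comp \<Rightarrow> bool" where
  "odd_field (Fc \<xi>) = True"
| "odd_field (Fb x) = True"
| "odd_field _ = False"

text \<open>
  Propagators. The ground field is embedded into the complex numbers by \<open>\<iota>\<close>; \<open>\<kappa>\<close> is the
  additive constant of the ghost propagator. The equations with the two fields in the
  opposite order are those required by graded commutativity.
\<close>
fun propagator ::
  "('k \<Rightarrow> complex) \<Rightarrow> complex \<Rightarrow> ('k, 'g) field_comp \<Rightarrow> ('k, 'g) field_comp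
     \<Rightarrow> complex \<Rightarrow> complex \<Rightarrow> complex" where
  "propagator \<iota> \<kappa> (Fc \<xi>) (Fb x) w z = \<iota> (\<xi> x) * (2 * complex_of_real (ln (cmod (w - z))) + \<kappa>)"
| "propagator \<iota> \<kappa> (Fb x) (Fc \<xi>) z w = - (\<iota> (\<xi> x) * (2 * complex_of_real (ln (cmod (w - z))) + \<kappa>))"
| "propagator \<iota> \<kappa> (Fa \<xi>) (Fgamma x) w z = \<iota> (\<xi> x) * (1 / (w - z))"
| "propagator \<iota> \<kappa> (Fgamma x) (Fa \<xi>) z w = \<iota> (\<xi> x) * (1 / (w - z))"
| "propagator \<iota> \<kappa> (Fabar \<xi>) (Fgammabar x) w z = \<iota> (\<xi> x) * (1 / (cnj w - cnj z))"
| "propagator \<iota> \<kappa> (Fgammabar x) (Fabar \<xi>) z w = \<iota> (\<xi> x) * (1 / (cnj w - cnj z))"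
| "propagator \<iota> \<kappa> _ _ _ _ = 0"

definition wirtinger :: "(complex \<Rightarrow> complex) \<Rightarrow> complex \<Rightarrow> complex" where
  "wirtinger f z = (frechet_derivative f (at z) 1 - \<i> * frechet_derivative f (at z) \<i>) / 2"

definition wirtinger_bar :: "(complex \<Rightarrow> complex) \<Rightarrow> complex \<Rightarrow> complex" where
  "wirtinger_bar f z = (frechet_derivative f (at z) 1 + \<i> * frechet_derivative f (at z) \<i>) / 2"

text \<open>\<open>(\<phi>, p, q)\<close> stands for the derivative of the field component \<open>\<phi>\<close> taken \<open>p\<close> times in the
  holomorphic and \<open>q\<close> times in the antiholomorphic direction.\<close>
type_synonym ('k, 'g) jet = "('k, 'g) field_comp \<times> nat \<times> nat"

definition odd_jet :: "('k, 'g) jet \<Rightarrow> bool" where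
  "odd_jet \<phi> = odd_field (fst \<phi>)"

definition jet_propagator ::
  "('k \<Rightarrow> complex) \<Rightarrow> complex \<Rightarrow> ('k, 'g) jet \<Rightarrow> ('k, 'g) jet \<Rightarrow> complex \<Rightarrow> complex \<Rightarrow> complex" where
  "jet_propagator \<iota> \<kappa> = (\<lambda>(\<phi>, p, q) (\<psi>, p', q') w z.
     (wirtinger ^^ p) ((wirtinger_bar ^^ q)
       (\<lambda>w'. (wirtinger ^^ p') ((wirtinger_bar ^^ q') (\<lambda>z'. propagator \<iota> \<kappa> \<phi> \<psi> w' z')) z)) w)"

text \<open>
  A factor \<open>(k, z, \<phi>)\<close> of a free correlator is a field at the point \<open>z\<close> which belongs to the
  \<open>k\<close>-th local observable; factors of one and the same local observable are not contracted.
\<close>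
fun contraction ::
  "('k \<Rightarrow> complex) \<Rightarrow> complex \<Rightarrow> nat \<times> complex \<times> ('k, 'g) jet \<Rightarrow> nat \<times> complex \<times> ('k, 'g) jet
     \<Rightarrow> complex" where
  "contraction \<iota> \<kappa> (k, w, \<phi>) (l, z, \<psi>) = (if k = l then 0 else jet_propagator \<iota> \<kappa> \<phi> \<psi> w z)"

text \<open>The Koszul sign of moving the \<open>j\<close>-th factor in front of all the previous ones.\<close>
definition koszul_sign :: "(nat \<times> complex \<times> ('k, 'g) jet) list \<Rightarrow> nat \<Rightarrow> complex" where
  "koszul_sign xs j =
     (if odd_jet (snd (snd (xs ! j)))
      then (-1) ^ card {i. i < j \<and> odd_jet (snd (snd (xs ! i)))} else 1)"

text \<open>
  Wick's lemma: the sum over all complete pairings, organised by the partner of the first factor.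
\<close>
fun wick ::
  "('k \<Rightarrow> complex) \<Rightarrow> complex \<Rightarrow> (nat \<times> complex \<times> ('k, 'g) jet) list \<Rightarrow> complex" where
  "wick \<iota> \<kappa> [] = 1"
| "wick \<iota> \<kappa> (x # xs) =
     (\<Sum>j<length xs. koszul_sign xs j * contraction \<iota> \<kappa> x (xs ! j)
        * wick \<iota> \<kappa> (take j xs @ drop (Suc j) xs))"

text \<open>The free correlator of a list of normally ordered monomials, each placed at a point.\<close>
definition free_correlator ::
  "('k \<Rightarrow> complex) \<Rightarrow> complex \<Rightarrow> (complex \<times> ('k, 'g) jet list) list \<Rightarrow> complex" where
  "free_correlator \<iota> \<kappa> ms =
     wick \<iota> \<kappa> (concat (map (\<lambda>k. map (\<lambda>\<phi>. (k, fst (ms ! k), \<phi>)) (snd (ms ! k))) [0..<length ms]))"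


section \<open>Correlators of non-abelian BF theory in Lorenz gauge\<close>

locale bf_theory = lie_algebra scale \<B> bracket
  for scale :: "'k::field \<Rightarrow> 'g::ab_group_add \<Rightarrow> 'g" (infixr \<open>*s\<close> 75)
    and \<B> :: "'g set"
    and bracket :: "'g \<Rightarrow> 'g \<Rightarrow> 'g" +
  fixes \<iota> :: "'k \<Rightarrow> complex"
  assumes embed_one: "\<iota> 1 = 1"
    and embed_add: "\<iota> (r + s) = \<iota> r + \<iota> s"
    and embed_mult: "\<iota> (r * s) = \<iota> r * \<iota> s"
begin

text \<open>
  The interaction, as the linear combination of monomials obtained by expanding the fields with
  values in the Lie algebra in the basis \<open>\<B>\<close>, e.g.
  \<open>\<langle>\<gamma>, [a, abar]\<rangle> = (\<Sum>S\<in>\<B>. \<Sum>T\<in>\<B>. \<langle>\<gamma>, [S, T]\<rangle> \<langle>S\<^sup>*, a\<rangle> \<langle>T\<^sup>*, abar\<rangle>)\<close>.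
  It is given by its effect on a function \<open>F\<close> of monomials, extended linearly.
\<close>
definition interaction :: "(('k, 'g) jet list \<Rightarrow> complex) \<Rightarrow> complex" where
  "interaction F = (\<Sum>S\<in>\<B>. \<Sum>T\<in>\<B>.
      F [(Fgamma (bracket S T), 0, 0), (Fa (dual_basis S), 0, 0), (Fabar (dual_basis T), 0, 0)]
    - F [(Fgammabar (bracket S T), 0, 0), (Fa (dual_basis S), 0, 0), (Fabar (dual_basis T), 0, 0)]
    + F [(Fb (bracket S T), 1, 0), (Fabar (dual_basis S), 0, 0), (Fc (dual_basis T), 0, 0)]
    + F [(Fb (bracket S T), 0, 1), (Fa (dual_basis S), 0, 0), (Fc (dual_basis T), 0, 0)])"

text \<open>The free correlator of \<open>ms\<close> followed by interactions at the points in the second list.\<close>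
primrec free_correlator_V ::
  "complex \<Rightarrow> (complex \<times> ('k, 'g) jet list) list \<Rightarrow> complex list \<Rightarrow> complex" where
  "free_correlator_V \<kappa> ms [] = free_correlator \<iota> \<kappa> ms"
| "free_correlator_V \<kappa> ms (u # us) = interaction (\<lambda>m. free_correlator_V \<kappa> (ms @ [(u, m)]) us)"

definition integrand ::
  "complex \<Rightarrow> (complex \<times> ('k, 'g) jet) list \<Rightarrow> nat \<Rightarrow> (nat \<Rightarrow> complex) \<Rightarrow> complex" where
  "integrand \<kappa> \<Phi>s N u =
     free_correlator_V \<kappa> (map (\<lambda>(z, \<phi>). (z, [\<phi>])) \<Phi>s) (map u [0..<N])"

definition perturbation_term ::
  "complex \<Rightarrow> complex \<Rightarrow> (complex \<times> ('k, 'g) jet) list \<Rightarrow> nat \<Rightarrow> complex" where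
  "perturbation_term \<kappa> g \<Phi>s N =
     1 / fact N * (g / (2 * complex_of_real pi)) ^ N
       * (\<integral>u. integrand \<kappa> \<Phi>s N u \<partial>(\<Pi>\<^sub>M i\<in>{..<N}. lborel))"

text \<open>
  The correlator of a list of fields placed at (pairwise distinct) points is well defined and has
  the value \<open>v\<close>.
\<close>
definition has_correlator ::
  "complex \<Rightarrow> complex \<Rightarrow> (complex \<times> ('k, 'g) jet) list \<Rightarrow> complex \<Rightarrow> bool" where
  "has_correlator \<kappa> g \<Phi>s v \<longleftrightarrow>
     (\<forall>N. integrable (\<Pi>\<^sub>M i\<in>{..<N}. lborel) (integrand \<kappa> \<Phi>s N)) \<and>
     perturbation_term \<kappa> g \<Phi>s sums v"

text \<open>
  The filter of \<open>n\<close>-tuples of pairwise distinct points which all tend to \<open>z\<close>.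
\<close>
definition collapse :: "nat \<Rightarrow> complex \<Rightarrow> complex list filter" where
  "collapse n z = (INF \<delta>\<in>{0<..}. principal
     {zs. length zs = n \<and> distinct zs \<and> (\<forall>\<zeta>\<in>set zs. dist \<zeta> z < \<delta>)})"

text \<open>
  The correlator of the composite field \<open>\<langle>(gammabar \<otimes> \<dots> \<otimes> gammabar)(z), X\<^sub>1 \<otimes> \<dots> \<otimes> X\<^sub>n\<rangle>\<close> with the
  fields \<open>\<Phi>s\<close> at other points is well defined and has the value \<open>v\<close>.
\<close>
definition has_gammabar_composite_correlator ::
  "complex \<Rightarrow> complex \<Rightarrow> complex \<Rightarrow> 'g list \<Rightarrow> (complex \<times> ('k, 'g) jet) list \<Rightarrow> complex \<Rightarrow> bool" where
  "has_gammabar_composite_correlator \<kappa> g z Xs \<Phi>s v \<longleftrightarrow>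
     (\<exists>G. (\<forall>\<^sub>F zs in collapse (length Xs) z.
             has_correlator \<kappa> g (map2 (\<lambda>\<zeta> X. (\<zeta>, (Fgammabar X, 0, 0))) zs Xs @ \<Phi>s) (G zs)) \<and>
          (G \<longlongrightarrow> v) (collapse (length Xs) z))"

end

end

theory Submission
  imports Defs "HOL-Combinatorics.Multiset_Permutations" "HOL-Complex_Analysis.Cauchy_Integral_Formula"
begin

text \<open>
  Counting \<open>a\<close> against \<open>\<gamma>\<close> shows that only the vertices \<open>\<langle>\<gamma>, [a, \<bar>a]\<rangle>\<close> and
  \<open>\<langle>\<partial>b, [\<bar>a, c]\<rangle>\<close> contribute, and counting \<open>\<bar>a\<close> against \<open>\<bar>\<gamma>\<close> that there are exactly \<open>n\<close> of them.
  Away from the diagonals \<open>c\<close> and \<open>\<partial>b\<close> contract like \<open>a\<close> and \<open>\<gamma>\<close>, so closed loops of the two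
  kinds cancel by the Koszul sign of the ghost loop. What remains is one chain from \<open>a(w\<^sub>1)\<close> through all vertices to
  \<open>\<gamma>(w\<^sub>2)\<close>, with the vertices in any order and the fields \<open>\<bar>\<gamma>\<close> attached to them in any order.

  The chain integrals converge absolutely, uniformly in the positions of the fields \<open>\<bar>\<gamma>\<close>: sums of
  \<open>|u - q|\<^sup>-\<^sup>s\<close> with \<open>0 < s < 1\<close> are reproduced by one more integration. Moving a pole by \<open>\<epsilon>\<close> costs
  \<open>\<epsilon>\<^bsup>1/4\<^esup>\<close> at the price of a slightly larger \<open>s\<close>, so all poles may be moved to \<open>z\<close>. There the angular
  integral around \<open>z\<close> is a Cauchy integral, and each radial integral raises the power of the logarithm by one.
\<close>

section \<open>Graded Wick expansions\<close>

text \<open>The loops cancel inside the integrand, point by point, so no loop integral ever has to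
  converge. In a loop of N vertices the ghost version differs from the field version by N bracket
  antisymmetries and N - 1 Koszul signs, hence by one minus sign. The evaluation by chains holds
  only off the diagonals. These are null sets, but there the differentiated ghost propagator has an
  unspecified default value, so the integrand needs its own measurability proof. The exponents are
  forced by bookkeeping. Multiplying by a pole raises the exponent by 1 and integrating against
  \<open>1 / |p - u|\<close> lowers it by 1. The poles at \<open>w2\<close> and at the last field
  gammabar together would give s = 1, which is excluded; their distance d buys s = 1/4 at the price
  of \<open>d powr (- 3/4)\<close>. Moving a pole produces 5/4 + 1/4 = 1 + 1/2, hence s = 1/2 for
  differences. Each vertex contributes - ad and each collapsed integration - 2 pi / k, so the signs
  and the powers of 2 pi disappear against \<open>g / (2 pi)\<close>.\<close>

locale graded_contraction =
  fixes odd_el :: "'e \<Rightarrow> bool" and C :: "'e \<Rightarrow> 'e \<Rightarrow> complex"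
  assumes C_sym: "C x y = (if odd_el x \<and> odd_el y then - C y x else C y x)"
    and C_parity: "C x y \<noteq> 0 \<Longrightarrow> odd_el x = odd_el y"
begin

definition nodd :: "'e list \<Rightarrow> nat" where
  "nodd xs = length (filter odd_el xs)"

lemma nodd_simps [simp]:
  "nodd [] = 0" "nodd (x # xs) = (if odd_el x then Suc (nodd xs) else nodd xs)"
  "nodd (xs @ ys) = nodd xs + nodd ys"
  by (simp_all add: nodd_def)

text \<open>The Koszul sign of carrying \<open>x\<close> across \<open>xs\<close>.\<close>

definition sg :: "'e \<Rightarrow> 'e list \<Rightarrow> complex" where
  "sg x xs = (if odd_el x then (-1) ^ nodd xs else 1)"

lemma sg_Nil [simp]: "sg x [] = 1"
  by (simp add: sg_def)

lemma sg_append: "sg x (xs @ ys) = sg x xs * sg x ys"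
  by (simp add: sg_def power_add)

lemma sg_Cons: "sg x (y # ys) = (if odd_el x \<and> odd_el y then - sg x ys else sg x ys)"
  by (simp add: sg_def)

lemma sg_even: "even (nodd xs) \<Longrightarrow> sg x xs = 1"
  by (simp add: sg_def)

text \<open>The graded annihilation operator of \<open>x\<close>. The continuation \<open>F\<close>
  is arbitrary, so that the same operator expands plain Wick sums and sums with vertices still to be
  appended.\<close>

definition contract :: "'e \<Rightarrow> ('e list \<Rightarrow> complex) \<Rightarrow> 'e list \<Rightarrow> complex" where
  "contract x F xs =
     (\<Sum>j<length xs. sg (xs ! j) (take j xs) * C x (xs ! j) * F (take j xs @ drop (Suc j) xs))"

lemma contract_Nil [simp]: "contract x F [] = 0"
  by (simp add: contract_def)

lemma sg_C_parity: "sg y xs * C x y = sg x xs * C x y"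
  using C_parity[of x y] by (cases "C x y = 0") (auto simp: sg_def)

text \<open>Graded Leibniz rule. The sign in the definition belongs to the partner; a nonzero
  contraction forces equal parities, so the sign can be charged to \<open>x\<close>, and passing
  \<open>y\<close> costs the constant factor \<open>sg x [y]\<close>.\<close>

lemma contract_Cons:
  "contract x F (y # ys) = C x y * F ys + sg x [y] * contract x (\<lambda>r. F (y # r)) ys"
proof -
  have e: "sg (ys ! j) (y # take j ys) * C x (ys ! j) * G = sg x [y] * (sg (ys ! j) (take j ys) * C x (ys ! j) * G)"
    for j G
    by (metis append_Cons append_Nil mult.assoc mult.left_commute sg_C_parity sg_append)
  show ?thesis
    unfolding contract_def
    by (simp add: sum.lessThan_Suc_shift sum_distrib_left e del: sum.lessThan_Suc)
qed

lemma contract_append: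
  "contract x F (xs @ ys) =
     contract x (\<lambda>r. F (r @ ys)) xs + sg x xs * contract x (\<lambda>r. F (xs @ r)) ys"
proof (induction xs arbitrary: F)
  case (Cons a xs)
  then show ?case
    using sg_append[of x "[a]" xs] by (simp add: contract_Cons algebra_simps)
qed simp

lemma contract_cong:
  assumes "\<And>r. Suc (length r) = length xs \<Longrightarrow> set r \<subseteq> set xs \<Longrightarrow> F r = G r"
  shows "contract x F xs = contract x G xs"
  unfolding contract_def
proof (intro sum.cong refl arg_cong2[where f = "(*)"] assms)
  fix j assume "j \<in> {..<length xs}"
  then show "Suc (length (take j xs @ drop (Suc j) xs)) = length xs"
    by auto
  show "set (take j xs @ drop (Suc j) xs) \<subseteq> set xs"
    by (auto dest: in_set_takeD in_set_dropD)
qed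

lemma contract_zero:
  assumes "\<And>y. y \<in> set xs \<Longrightarrow> C x y = 0"
  shows "contract x F xs = 0"
  unfolding contract_def by (intro sum.neutral) (auto simp: assms)

lemma contract_mult: "contract x (\<lambda>r. c * F r) xs = c * contract x F xs"
  by (simp add: contract_def sum_distrib_left mult_ac)

lemma contract_sum: "contract x (\<lambda>r. \<Sum>j\<in>J. F j r) xs = (\<Sum>j\<in>J. contract x (F j) xs)"
  unfolding contract_def sum_distrib_left by (rule sum.swap)

lemma contract_add: "contract x (\<lambda>r. F r + G r) xs = contract x F xs + contract x G xs"
  by (simp add: contract_def sum.distrib algebra_simps)

text \<open>Graded derivations of this kind supercommute: after two uses of the Leibniz rule, the
  terms in which \<open>a\<close> or \<open>b\<close> hits \<open>y\<close> match because nonzero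
  contractions have equal parities.\<close>

lemma contract_contract:
  "contract a (contract b F) ys =
     (if odd_el a \<and> odd_el b then -1 else 1) * contract b (contract a F) ys"
proof (induction ys arbitrary: F)
  case (Cons y t)
  have 1: "contract a (contract b F) (y # t) = C a y * contract b F t + sg a [y] * C b y * contract a F t
    + sg a [y] * sg b [y] * contract a (contract b (\<lambda>r. F (y # r))) t" for a b
    unfolding contract_Cons contract_add contract_mult by (simp add: algebra_simps)
  have 2: "C a y = 0 \<or> odd_el a = odd_el y" "C b y = 0 \<or> odd_el b = odd_el y"
    using C_parity by blast+
  show ?case
    unfolding 1[of a b] 1[of b a] Cons.IH[of "\<lambda>r. F (y # r)"]
    using 2 by (auto simp: sg_Cons algebra_simps)
qed simp

fun gwick :: "'e list \<Rightarrow> complex" where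
  "gwick [] = 1"
| "gwick (x # xs) = (\<Sum>j<length xs. sg (xs ! j) (take j xs) * C x (xs ! j) * gwick (take j xs @ drop (Suc j) xs))"

lemma gwick_Cons: "gwick (x # xs) = contract x gwick xs"
  by (simp add: contract_def)

declare gwick.simps(2) [simp del]

text \<open>The recursion singles out the first entry, which hides the graded symmetry. If
  \<open>a\<close> and \<open>b\<close> stand in front, \<open>C_sym\<close> handles their mutual
  contraction and \<open>contract_contract\<close> all others; otherwise contracting the first entry
  shortens the list.\<close>

lemma gwick_swap:
  "gwick (xs @ [a, b] @ ys) = (if odd_el a \<and> odd_el b then -1 else 1) * gwick (xs @ [b, a] @ ys)"
proof (induction "length (xs @ ys)" arbitrary: xs ys rule: less_induct)
  case less
  let ?e = "(if odd_el a \<and> odd_el b then -1 else 1) :: complex"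
  show ?case
  proof (cases xs)
    case Nil
    have "contract a (\<lambda>r. gwick (b # r)) ys = contract a (contract b gwick) ys" for a b
      by (rule contract_cong) (simp add: gwick_Cons)
    then have 1: "gwick (a # b # ys) = C a b * gwick ys + (if odd_el a \<and> odd_el b then -1 else 1) * contract a (contract b gwick) ys" for a b
      by (simp add: gwick_Cons contract_Cons sg_Cons)
    show ?thesis
      using Nil C_sym[of a b] contract_contract[of a b gwick ys]
      by (auto simp: 1[of a b] 1[of b a])
  next
    case (Cons x xs')
    have l: "contract x (\<lambda>r. gwick (r @ [a, b] @ ys)) xs' = ?e * contract x (\<lambda>r. gwick (r @ [b, a] @ ys)) xs'"
      unfolding contract_mult[symmetric]
      by (intro contract_cong less) (auto simp: Cons)
    have r: "contract x (\<lambda>r. gwick (xs' @ [a, b] @ r)) ys = ?e * contract x (\<lambda>r. gwick (xs' @ [b, a] @ r)) ys"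
      unfolding contract_mult[symmetric]
      by (intro contract_cong less) (auto simp: Cons)
    have e: "gwick (x # xs' @ [a, b] @ ys) = contract x (\<lambda>r. gwick (r @ [a, b] @ ys)) xs' +
      sg x xs' * (C x a * gwick (xs' @ [b] @ ys) + sg x [a] * C x b * gwick (xs' @ [a] @ ys)
         + sg x [a] * sg x [b] * contract x (\<lambda>r. gwick (xs' @ [a, b] @ r)) ys)" for a b
      by (simp add: gwick_Cons contract_append contract_Cons algebra_simps)
    \<comment> \<open>Wherever \<open>x\<close> contracts with \<open>a\<close>, it has the parity
      of \<open>a\<close>, so \<open>sg x [b]\<close> is the sign of the swap; likewise with
      \<open>a\<close> and \<open>b\<close> exchanged.\<close>
    have p: "C x a = 0 \<or> odd_el x = odd_el a" "C x b = 0 \<or> odd_el x = odd_el b"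
      using C_parity by blast+
    have "C x a * gwick (xs' @ [b] @ ys) + sg x [a] * C x b * gwick (xs' @ [a] @ ys) =
      ?e * (C x b * gwick (xs' @ [a] @ ys) + sg x [b] * C x a * gwick (xs' @ [b] @ ys))"
      using p by (auto simp: sg_Cons algebra_simps)
    then show ?thesis
      using e[of a b] e[of b a] l r by (simp add: Cons algebra_simps)
  qed
qed

lemma gwick_move:
  "gwick (xs @ [y] @ m @ zs) = sg y m * gwick (xs @ m @ [y] @ zs)"
proof (induction m arbitrary: xs)
  case (Cons a m)
  then show ?case
    using gwick_swap[of xs y a "m @ zs"] Cons[of "xs @ [a]"] by (simp add: sg_Cons)
qed simp

lemma gwick_move_even:
  assumes "even (nodd m)"
  shows "gwick (xs @ ys @ m @ zs) = gwick (xs @ m @ ys @ zs)"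
proof (induction ys arbitrary: xs)
  case (Cons y ys)
  show ?case
    using Cons[of "xs @ [y]"] gwick_move[of xs y m "ys @ zs"] assms by (simp add: sg_even)
qed simp

end

section \<open>Wick expansions with even interaction vertices\<close>

locale wick_vertices = graded_contraction odd_el C
  for odd_el :: "'e \<Rightarrow> bool" and C :: "'e \<Rightarrow> 'e \<Rightarrow> complex" +
  fixes J :: "'j set" and mon :: "'v \<Rightarrow> 'j \<Rightarrow> 'e list"
  assumes mon_even: "j \<in> J \<Longrightarrow> even (nodd (mon v j))"
begin

primrec vwick :: "'e list \<Rightarrow> 'v list \<Rightarrow> complex" where
  "vwick xs [] = gwick xs"
| "vwick xs (v # vs) = (\<Sum>j\<in>J. vwick (xs @ mon v j) vs)"

text \<open>Vertices are appended on the right, so an identity of Wick sums that survives every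
  extension to the right survives the sums over vertices.\<close>

lemma vwick_eqI:
  assumes "\<And>zs. gwick (xs @ zs) = c * gwick (ys @ zs)"
  shows "vwick xs vs = c * vwick ys vs"
  using assms
proof (induction vs arbitrary: xs ys)
  case Nil
  then show ?case using Nil[of "[]"] by simp
next
  case (Cons v vs)
  have "vwick (xs @ mon v j) vs = c * vwick (ys @ mon v j) vs" for j
    by (rule Cons.IH) (simp add: Cons.prems)
  then show ?case
    by (simp add: sum_distrib_left)
qed

lemma vwick_move_even:
  "even (nodd m) \<Longrightarrow> vwick (xs @ ys @ m @ zs) vs = vwick (xs @ m @ ys @ zs) vs"
  using vwick_eqI[of "xs @ ys @ m @ zs" 1 "xs @ m @ ys @ zs" vs] gwick_move_even[of m xs ys] by simp

lemma vwick_move: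
  "vwick (xs @ [y] @ m @ zs) vs = sg y m * vwick (xs @ m @ [y] @ zs) vs"
  by (rule vwick_eqI) (use gwick_move[of xs y m] in simp)

text \<open>The Schwinger-Dyson equation for the field \<open>x\<close>.\<close>
lemma vwick_Cons:
  "vwick (x # xs) vs = contract x (\<lambda>r. vwick r vs) xs
     + sg x xs * (\<Sum>i<length vs. \<Sum>j\<in>J.
         contract x (\<lambda>r. vwick (xs @ r) (take i vs @ drop (Suc i) vs)) (mon (vs ! i) j))"
proof (induction vs arbitrary: xs)
  case Nil
  then show ?case by (simp add: gwick_Cons)
next
  case (Cons v vs)
  let ?T = "\<lambda>xs vs i j. contract x (\<lambda>r. vwick (xs @ r) (take i vs @ drop (Suc i) vs)) (mon (vs ! i) j)"
  \<comment> \<open>The induction hypothesis leaves the monomial of \<open>v\<close> to the left of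
    the remainder \<open>r\<close> of the contracted vertex, the claim wants it on the right; being
    even, it moves without a sign.\<close>
  have mv: "?T (xs @ mon v j') vs i j = contract x (\<lambda>r. vwick ((xs @ r) @ mon v j') (take i vs @ drop (Suc i) vs)) (mon (vs ! i) j)"
    if "j' \<in> J" for i j j'
    by (rule contract_cong)
      (use vwick_move_even[OF mon_even[OF that, of v], of xs _ "[]"] in simp)
  have "vwick (x # xs) (v # vs) = (\<Sum>j'\<in>J. contract x (\<lambda>r. vwick r vs) (xs @ mon v j')
      + sg x (xs @ mon v j') * (\<Sum>i<length vs. \<Sum>j\<in>J. ?T (xs @ mon v j') vs i j))"
    by (simp add: Cons.IH)
  also have "\<dots> = (\<Sum>j'\<in>J. contract x (\<lambda>r. vwick (r @ mon v j') vs) xs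
      + sg x xs * contract x (\<lambda>r. vwick (xs @ r) vs) (mon v j')
      + sg x xs * (\<Sum>i<length vs. \<Sum>j\<in>J.
          contract x (\<lambda>r. vwick ((xs @ r) @ mon v j') (take i vs @ drop (Suc i) vs)) (mon (vs ! i) j)))"
    by (intro sum.cong refl) (simp add: contract_append sg_append sg_even mon_even mv del: append_assoc)
  also have "\<dots> = contract x (\<lambda>r. vwick r (v # vs)) xs
      + sg x xs * (\<Sum>j\<in>J. ?T xs (v # vs) 0 j)
      + sg x xs * (\<Sum>j'\<in>J. \<Sum>i<length vs. \<Sum>j\<in>J.
          contract x (\<lambda>r. vwick ((xs @ r) @ mon v j') (take i vs @ drop (Suc i) vs)) (mon (vs ! i) j))"
    by (simp add: sum.distrib contract_sum sum_distrib_left)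
  also have "(\<Sum>j'\<in>J. \<Sum>i<length vs. \<Sum>j\<in>J.
          contract x (\<lambda>r. vwick ((xs @ r) @ mon v j') (take i vs @ drop (Suc i) vs)) (mon (vs ! i) j))
     = (\<Sum>i<length vs. \<Sum>j\<in>J. \<Sum>j'\<in>J.
          contract x (\<lambda>r. vwick ((xs @ r) @ mon v j') (take i vs @ drop (Suc i) vs)) (mon (vs ! i) j))"
    by (subst sum.swap) (intro sum.cong refl sum.swap)
  also have "\<dots> = (\<Sum>i<length vs. \<Sum>j\<in>J. ?T xs (v # vs) (Suc i) j)"
    by (simp add: contract_sum)
  finally show ?case
    by (simp add: sum.lessThan_Suc_shift distrib_left del: sum.lessThan_Suc)
qed

end

section \<open>Lie algebra preliminaries\<close>

context lie_algebra
begin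

lemma bracket_zero [simp]: "bracket 0 y = 0" "bracket x 0 = 0"
  using bracket_add_left[of 0 0 y] bracket_add_right[of x 0 0] by simp_all

lemma bracket_antisym: "bracket y x = - bracket x y"
proof -
  have "0 = bracket (x + y) (x + y)"
    by (simp add: bracket_self)
  also have "\<dots> = bracket x y + bracket y x"
    unfolding bracket_add_left bracket_add_right by (simp add: bracket_self)
  finally have "bracket x y + bracket y x = 0"
    by (rule sym)
  then show ?thesis
    by (rule minus_unique[symmetric])
qed

lemma bracket_sum_left: "bracket (\<Sum>i\<in>I. f i) y = (\<Sum>i\<in>I. bracket (f i) y)"
  by (induction I rule: infinite_finite_induct) (simp_all add: bracket_add_left)

lemma bracket_sum_right: "bracket x (\<Sum>i\<in>I. f i) = (\<Sum>i\<in>I. bracket x (f i))"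
  by (induction I rule: infinite_finite_induct) (simp_all add: bracket_add_right)

lemma dual_basis_expansion: "(\<Sum>b\<in>\<B>. dual_basis b x *s b) = x"
  unfolding dual_basis_def
  by (rule sum_representation_eq) (auto simp: independent_Basis span_Basis finite_Basis)

lemma linear_dual_basis: "Vector_Spaces.linear scale (*) (dual_basis b)"
  unfolding dual_basis_def
  by unfold_locales (simp_all add: representation_add representation_scale independent_Basis span_Basis)

lemma bracket_expansion:
  "bracket x y = (\<Sum>S\<in>\<B>. \<Sum>T\<in>\<B>. (dual_basis S x * dual_basis T y) *s bracket S T)"
proof -
  have "bracket x y = bracket (\<Sum>S\<in>\<B>. dual_basis S x *s S) (\<Sum>T\<in>\<B>. dual_basis T y *s T)"
    by (simp add: dual_basis_expansion)
  also have "\<dots> = (\<Sum>S\<in>\<B>. \<Sum>T\<in>\<B>. dual_basis S x *s (dual_basis T y *s bracket S T))"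
    unfolding bracket_sum_left bracket_sum_right bracket_scale_left bracket_scale_right
      scale_sum_right by (subst sum.swap) (simp add: mult.commute)
  finally show ?thesis
    by simp
qed

text \<open>Resums the two basis sums of a vertex once both of its dual basis covectors have been
  evaluated.\<close>

lemma linear_bracket_expansion:
  assumes "Vector_Spaces.linear scale (*) \<eta>"
  shows "\<eta> (bracket x y) = (\<Sum>S\<in>\<B>. \<Sum>T\<in>\<B>. dual_basis S x * dual_basis T y * \<eta> (bracket S T))"
proof -
  interpret \<eta>: Vector_Spaces.linear scale "(*)" \<eta> by fact
  show ?thesis
    by (subst bracket_expansion) (simp add: \<eta>.sum \<eta>.scale)
qed

end

section \<open>Contractions at distinct points\<close>

text \<open>
  As \<open>1 / 0 = 0\<close>, fields at one and the same point have no contraction, so that the labels of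
  the local observables can be dropped.
\<close>
fun pcontr :: "('k \<Rightarrow> complex) \<Rightarrow> complex \<times> ('k, 'g) jet \<Rightarrow> complex \<times> ('k, 'g) jet \<Rightarrow> complex" where
  "pcontr \<iota> (w, Fa \<xi>, _) (z, Fgamma x, _) = \<iota> (\<xi> x) / (w - z)"
| "pcontr \<iota> (z, Fgamma x, _) (w, Fa \<xi>, _) = \<iota> (\<xi> x) / (w - z)"
| "pcontr \<iota> (w, Fabar \<xi>, _) (z, Fgammabar x, _) = \<iota> (\<xi> x) / (cnj w - cnj z)"
| "pcontr \<iota> (z, Fgammabar x, _) (w, Fabar \<xi>, _) = \<iota> (\<xi> x) / (cnj w - cnj z)"
| "pcontr \<iota> (w, Fc \<xi>, _) (z, Fb x, p, _) =
     - (\<iota> (\<xi> x) / (if p = 0 then cnj w - cnj z else w - z))"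
| "pcontr \<iota> (z, Fb x, p, _) (w, Fc \<xi>, _) =
     \<iota> (\<xi> x) / (if p = 0 then cnj w - cnj z else w - z)"
| "pcontr \<iota> _ _ = 0"

text \<open>A conserved charge: every nonzero propagator joins opposite values, so a nonzero Wick
  sum has total charge 0. The vertices with gammabar or with the antiholomorphic derivative of b
  have charge 1, the other two charge 0.\<close>

fun holo_charge :: "('k, 'g) field_comp \<Rightarrow> int" where
  "holo_charge (Fa _) = 1"
| "holo_charge (Fgamma _) = -1"
| "holo_charge _ = 0"

fun antiholo_charge :: "('k, 'g) field_comp \<Rightarrow> int" where
  "antiholo_charge (Fabar _) = 1"
| "antiholo_charge (Fgammabar _) = -1"
| "antiholo_charge _ = 0"

fun bar_field :: "('k, 'g) field_comp \<Rightarrow> bool" where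
  "bar_field (Fabar _) = True"
| "bar_field (Fgammabar _) = True"
| "bar_field _ = False"

lemma (in graded_contraction) gwick_charge:
  fixes q :: "'e \<Rightarrow> int"
  assumes C0: "\<And>x y. C x y \<noteq> 0 \<Longrightarrow> q x + q y = 0"
  shows "gwick xs \<noteq> 0 \<Longrightarrow> (\<Sum>x\<leftarrow>xs. q x) = 0"
proof (induction "length xs" arbitrary: xs rule: less_induct)
  case less
  show ?case
  proof (cases xs)
    case (Cons x ys)
    with less.prems obtain j where j: "j < length ys" "C x (ys ! j) \<noteq> 0"
      "gwick (take j ys @ drop (Suc j) ys) \<noteq> 0"
      by (auto simp: gwick.simps(2) elim!: sum.not_neutral_contains_not_neutral)
    have "(\<Sum>x\<leftarrow>take j ys @ drop (Suc j) ys. q x) = 0"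
      by (rule less.hyps) (use j Cons in auto)
    moreover have "(\<Sum>x\<leftarrow>ys. q x) = (\<Sum>x\<leftarrow>take j ys @ ys ! j # drop (Suc j) ys. q x)"
      using j by (simp only: id_take_nth_drop[symmetric])
    ultimately show ?thesis
      using C0[OF j(2)] Cons by simp
  qed simp
qed

section \<open>Reduction to two vertices and cancellation of the loops\<close>

context bf_theory
begin

lemma embed_zero [simp]: "\<iota> 0 = 0"
  using embed_add[of 0 0] by simp

lemma embed_minus: "\<iota> (- x) = - \<iota> x"
  using embed_add[of x "- x"] by (simp add: eq_neg_iff_add_eq_0 add.commute)

lemma embed_sum: "\<iota> (\<Sum>i\<in>I. f i) = (\<Sum>i\<in>I. \<iota> (f i))"
  by (induction I rule: infinite_finite_induct) (simp_all add: embed_add)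

text \<open>The two monomials of holomorphic charge 0; the Boolean tells the \<open>a\<close>-gamma
  vertex from the ghost vertex. Both have antiholomorphic charge 1.\<close>

fun vertex :: "complex \<Rightarrow> 'g \<times> 'g \<times> bool \<Rightarrow> (complex \<times> ('k, 'g) jet) list" where
  "vertex u (S, T, True) = [(u, Fgamma (bracket S T), 0, 0), (u, Fa (dual_basis S), 0, 0),
     (u, Fabar (dual_basis T), 0, 0)]"
| "vertex u (S, T, False) = [(u, Fb (bracket S T), 1, 0), (u, Fabar (dual_basis S), 0, 0),
     (u, Fc (dual_basis T), 0, 0)]"

lemma odd_jet_simps [simp]:
  "odd_jet (Fa \<xi>, p) = False" "odd_jet (Fabar \<xi>, p) = False" "odd_jet (Fc \<xi>, p) = True"
  "odd_jet (Fgamma x, p) = False" "odd_jet (Fgammabar x, p) = False" "odd_jet (Fb x, p) = True"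
  by (simp_all add: odd_jet_def)

lemma bar_field_even: "bar_field (fst \<phi>) \<Longrightarrow> \<not> odd_jet \<phi>"
  by (cases "fst \<phi>") (auto simp: odd_jet_def)

sublocale graded_contraction "\<lambda>e. odd_jet (snd e)"
  "pcontr \<iota> :: complex \<times> ('k, 'g) jet \<Rightarrow> complex \<times> ('k, 'g) jet \<Rightarrow> complex"
proof
  fix x y :: "complex \<times> ('k, 'g) jet"
  show "pcontr \<iota> x y = (if odd_jet (snd x) \<and> odd_jet (snd y) then - pcontr \<iota> y x else pcontr \<iota> y x)"
    by (induction \<iota> x y rule: pcontr.induct) auto
  show "odd_jet (snd x) = odd_jet (snd y)" if "pcontr \<iota> x y \<noteq> 0"
    using that by (induction \<iota> x y rule: pcontr.induct) auto
qed

sublocale wick_vertices "\<lambda>e. odd_jet (snd e)" "pcontr \<iota>" "\<B> \<times> \<B> \<times> UNIV" vertex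
proof
  fix j :: "'g \<times> 'g \<times> bool" and u
  show "even (nodd (vertex u j))"
    by (induction u j rule: vertex.induct) simp_all
qed

lemma sum_vertex: "(\<Sum>j\<in>\<B> \<times> \<B> \<times> UNIV. f j) = (\<Sum>S\<in>\<B>. \<Sum>T\<in>\<B>. f (S, T, True) + f (S, T, False))"
  by (simp add: sum.cartesian_product' UNIV_bool add.commute)

lemma pcontr_holo_charge: "pcontr \<iota> x y \<noteq> 0 \<Longrightarrow> holo_charge (fst (snd x)) + holo_charge (fst (snd y)) = 0"
  by (induction \<iota> x y rule: pcontr.induct) auto

lemma pcontr_antiholo_charge:
  "pcontr \<iota> x y \<noteq> 0 \<Longrightarrow> antiholo_charge (fst (snd x)) + antiholo_charge (fst (snd y)) = 0"
  by (induction \<iota> x y rule: pcontr.induct) auto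

text \<open>Halfway between \<open>free_correlator_V\<close> and \<open>vwick\<close>: all four
  monomials are kept, but the labels of the observables are gone.\<close>

primrec fwick :: "(complex \<times> ('k, 'g) jet) list \<Rightarrow> complex list \<Rightarrow> complex" where
  "fwick xs [] = gwick xs"
| "fwick xs (u # us) = interaction (\<lambda>m. fwick (xs @ map (Pair u) m) us)"

lemma fwick_charge:
  "(\<Sum>x\<leftarrow>xs. holo_charge (fst (snd x))) \<ge> 1 \<Longrightarrow> fwick xs us = 0"
proof (induction us arbitrary: xs)
  case Nil
  then show ?case
    using gwick_charge[of "\<lambda>x. holo_charge (fst (snd x))" xs] pcontr_holo_charge by force
next
  case (Cons u us)
  then show ?case
    by (simp add: interaction_def)
qed

text \<open>No vertex lowers the holomorphic charge. From a charge that is at least 0, either of the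
  dropped monomials leads to a charge of at least 1, and from there nothing can return to 0.\<close>

lemma fwick_eq_vwick:
  "(\<Sum>x\<leftarrow>xs. holo_charge (fst (snd x))) \<ge> 0 \<Longrightarrow> fwick xs us = vwick xs us"
proof (induction us arbitrary: xs)
  case (Cons u us)
  then show ?case
    by (simp add: interaction_def sum_vertex fwick_charge)
qed simp

lemma vwick_antiholo_charge:
  "(\<Sum>x\<leftarrow>xs. antiholo_charge (fst (snd x))) + int (length us) \<noteq> 0 \<Longrightarrow> vwick xs us = 0"
proof (induction us arbitrary: xs)
  case Nil
  then show ?case
    using gwick_charge[of "\<lambda>x. antiholo_charge (fst (snd x))" xs] pcontr_antiholo_charge by force
next
  case (Cons u us)
  then show ?case
    by (auto simp: sum_vertex intro!: sum.neutral)
qed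

lemma sg_bar: "\<forall>e\<in>set xs. bar_field (fst (snd e)) \<Longrightarrow> sg x xs = 1"
proof (induction xs)
  case (Cons e xs)
  then show ?case
    by (simp add: sg_Cons bar_field_even)
qed simp

lemma pcontr_bar:
  "bar_field (fst (snd e)) \<Longrightarrow> \<not> bar_field (fst (snd x)) \<Longrightarrow> pcontr \<iota> x e = 0"
  by (induction \<iota> x e rule: pcontr.induct) auto

text \<open>The field \<open>a\<close> either meets gamma at \<open>q\<close>, which ends the chain,
  or the gamma of a vertex. In the second case that vertex hands over its own \<open>a\<close> and
  leaves an abar behind, so the shape of the list recurs with one vertex fewer.\<close>

lemma vwick_a:
  assumes "\<forall>e\<in>set xs. bar_field (fst (snd e))"
  shows "vwick (xs @ [(q, Fgamma y, 0, 0), (p, Fa \<eta>, 0, 0)]) us =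
    \<iota> (\<eta> y) / (p - q) * vwick xs us +
    (\<Sum>i<length us. \<Sum>S\<in>\<B>. \<Sum>T\<in>\<B>. \<iota> (\<eta> (bracket S T)) / (p - us ! i) *
       vwick ((xs @ [(us ! i, Fabar (dual_basis T), 0, 0)]) @ [(q, Fgamma y, 0, 0), (us ! i, Fa (dual_basis S), 0, 0)])
         (take i us @ drop (Suc i) us))"
proof -
  let ?a = "(p, Fa \<eta>, 0, 0) :: complex \<times> ('k, 'g) jet"
  have mv: "vwick ((xs @ [(q, Fgamma y, 0, 0)]) @ [(us ! i, Fa (dual_basis S), 0, 0), (us ! i, Fabar (dual_basis T), 0, 0)]) us'
    = vwick ((xs @ [(us ! i, Fabar (dual_basis T), 0, 0)]) @ [(q, Fgamma y, 0, 0), (us ! i, Fa (dual_basis S), 0, 0)]) us'" for i S T us'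
    using vwick_move_even[of "[(us ! i, Fabar (dual_basis T), 0, 0)]" xs
        "[(q, Fgamma y, 0, 0), (us ! i, Fa (dual_basis S), 0, 0)]" "[]" us']
    by simp
  have "vwick (xs @ [(q, Fgamma y, 0, 0), ?a]) us = vwick (?a # (xs @ [(q, Fgamma y, 0, 0)])) us"
    using vwick_move_even[of "[?a]" "[]" "xs @ [(q, Fgamma y, 0, 0)]" "[]" us] by simp
  also have "\<dots> = \<iota> (\<eta> y) / (p - q) * vwick xs us +
    (\<Sum>i<length us. \<Sum>S\<in>\<B>. \<Sum>T\<in>\<B>. \<iota> (\<eta> (bracket S T)) / (p - us ! i) *
       vwick ((xs @ [(q, Fgamma y, 0, 0)]) @ [(us ! i, Fa (dual_basis S), 0, 0), (us ! i, Fabar (dual_basis T), 0, 0)])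
         (take i us @ drop (Suc i) us))"
    unfolding vwick_Cons sum_vertex
    by (simp add: contract_append contract_Cons contract_zero[of xs] pcontr_bar assms
        sg_def)
  finally show ?thesis
    unfolding mv .
qed

text \<open>The same recursion for ghosts. The minus sign before the vertex terms is the cost of
  carrying c past the b at \<open>q\<close>, which the direct contraction with that b does not
  pay.\<close>

lemma vwick_c:
  assumes "\<forall>e\<in>set xs. bar_field (fst (snd e))"
  shows "vwick (xs @ [(q, Fb y, 1, 0), (p, Fc \<eta>, 0, 0)]) us =
    \<iota> (\<eta> y) / (p - q) * vwick xs us -
    (\<Sum>i<length us. \<Sum>S\<in>\<B>. \<Sum>T\<in>\<B>. \<iota> (\<eta> (bracket S T)) / (p - us ! i) *
       vwick ((xs @ [(us ! i, Fabar (dual_basis S), 0, 0)]) @ [(q, Fb y, 1, 0), (us ! i, Fc (dual_basis T), 0, 0)])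
         (take i us @ drop (Suc i) us))"
proof -
  let ?c = "(p, Fc \<eta>, 0, 0) :: complex \<times> ('k, 'g) jet"
  have mv: "vwick ((xs @ [(q, Fb y, 1, 0)]) @ [(us ! i, Fabar (dual_basis S), 0, 0), (us ! i, Fc (dual_basis T), 0, 0)]) us'
    = vwick ((xs @ [(us ! i, Fabar (dual_basis S), 0, 0)]) @ [(q, Fb y, 1, 0), (us ! i, Fc (dual_basis T), 0, 0)]) us'" for i S T us'
    using vwick_move_even[of "[(us ! i, Fabar (dual_basis S), 0, 0)]" xs
        "[(q, Fb y, 1, 0)]" "[(us ! i, Fc (dual_basis T), 0, 0)]" us']
    by simp
  have sgs: "sg x xs = 1" for x
    using assms by (rule sg_bar)
  have "vwick (?c # (xs @ [(q, Fb y, 1, 0)])) us = - vwick (xs @ [(q, Fb y, 1, 0), ?c]) us"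
    using vwick_move[of "[]" "?c" "xs @ [(q, Fb y, 1, 0)]" "[]" us]
    by (simp add: sg_append sg_Cons sgs)
  moreover have "vwick (?c # (xs @ [(q, Fb y, 1, 0)])) us = - (\<iota> (\<eta> y) / (p - q) * vwick xs us) +
    (\<Sum>i<length us. \<Sum>S\<in>\<B>. \<Sum>T\<in>\<B>. \<iota> (\<eta> (bracket S T)) / (p - us ! i) *
       vwick ((xs @ [(q, Fb y, 1, 0)]) @ [(us ! i, Fabar (dual_basis S), 0, 0), (us ! i, Fc (dual_basis T), 0, 0)])
         (take i us @ drop (Suc i) us))"
    unfolding vwick_Cons sum_vertex
    by (simp add: contract_append contract_Cons contract_zero[of xs] pcontr_bar assms
        sg_append sg_Cons sgs sum_negf)
  moreover have "P = X - Y" if "c = - P" "c = - X + Y" for c P X Y :: complex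
    using that by algebra
  ultimately show ?thesis
    unfolding mv by blast
qed

text \<open>Chains of \<open>a\<close> and \<open>gamma\<close> cancel against chains of ghosts; closing them up cancels the loops.\<close>
lemma vwick_chain_cancel:
  assumes "\<forall>e\<in>set xs. bar_field (fst (snd e))" and "Vector_Spaces.linear scale (*) \<eta>"
  shows "vwick (xs @ [(q, Fgamma (- y), 0, 0), (p, Fa \<eta>, 0, 0)]) us =
       - vwick (xs @ [(q, Fb y, 1, 0), (p, Fc \<eta>, 0, 0)]) us"
  using assms
proof (induction "length us" arbitrary: us xs \<eta> p)
  case (0 us)
  interpret \<eta>: Vector_Spaces.linear scale "(*)" \<eta> by fact
  show ?case
    using 0 by (simp only: vwick_a vwick_c) (simp add: \<eta>.neg embed_minus)
next
  case (Suc n us)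
  interpret \<eta>: Vector_Spaces.linear scale "(*)" \<eta> by fact
  have IH: "vwick ((xs @ [(us ! i, Fabar (dual_basis T), 0, 0)]) @ [(q, Fgamma (- y), 0, 0), (us ! i, Fa (dual_basis S), 0, 0)])
         (take i us @ drop (Suc i) us) =
     - vwick ((xs @ [(us ! i, Fabar (dual_basis T), 0, 0)]) @ [(q, Fb y, 1, 0), (us ! i, Fc (dual_basis S), 0, 0)])
         (take i us @ drop (Suc i) us)" if "i < length us" for i S T
    by (rule Suc.hyps) (use Suc that in \<open>auto simp: linear_dual_basis\<close>)
  \<comment> \<open>The abar sits in the second slot of the bracket at an \<open>a\<close> vertex
    and in the first slot at a ghost vertex. Exchanging the slots produces the sign that matches the
    minus sign of \<open>vwick_c\<close>.\<close>
  have anti: "\<iota> (\<eta> (bracket S T)) = - \<iota> (\<eta> (bracket T S))" for S T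
    by (subst bracket_antisym) (simp add: \<eta>.neg embed_minus)
  let ?g = "\<lambda>i S T. vwick ((xs @ [(us ! i, Fabar (dual_basis S), 0, 0)]) @ [(q, Fb y, 1, 0), (us ! i, Fc (dual_basis T), 0, 0)])
         (take i us @ drop (Suc i) us)"
  have "(\<Sum>i<length us. \<Sum>S\<in>\<B>. \<Sum>T\<in>\<B>. \<iota> (\<eta> (bracket S T)) / (p - us ! i) *
       vwick ((xs @ [(us ! i, Fabar (dual_basis T), 0, 0)]) @ [(q, Fgamma (- y), 0, 0), (us ! i, Fa (dual_basis S), 0, 0)])
         (take i us @ drop (Suc i) us)) =
     (\<Sum>i<length us. \<Sum>S\<in>\<B>. \<Sum>T\<in>\<B>. \<iota> (\<eta> (bracket T S)) / (p - us ! i) * ?g i T S)"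
    by (intro sum.cong refl) (subst IH, simp, subst anti, simp)
  also have "\<dots> = (\<Sum>i<length us. \<Sum>S\<in>\<B>. \<Sum>T\<in>\<B>. \<iota> (\<eta> (bracket S T)) / (p - us ! i) * ?g i S T)"
    by (intro sum.cong refl sum.swap)
  finally show ?case
    using Suc.prems by (simp only: vwick_a vwick_c) (simp add: \<eta>.neg embed_minus)
qed

text \<open>Without an outer \<open>a\<close> or gamma every vertex lies on a loop. Cutting the loop
  at its vertex \<open>u\<close> gives a chain from \<open>u\<close> to \<open>u\<close>, to which
  the cancellation of chains applies, since it allows equal end points.\<close>

lemma vwick_bar_eq_0:
  assumes "\<forall>e\<in>set xs. bar_field (fst (snd e))" and "us \<noteq> []"
  shows "vwick xs us = 0"
proof -
  obtain u vs where us: "us = u # vs"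
    using assms(2) by (cases us) auto
  let ?P = "\<lambda>S T. vwick ((xs @ [(u, Fabar (dual_basis T), 0, 0)]) @ [(u, Fgamma (bracket S T), 0, 0), (u, Fa (dual_basis S), 0, 0)]) vs"
  let ?Q = "\<lambda>S T. vwick ((xs @ [(u, Fabar (dual_basis S), 0, 0)]) @ [(u, Fb (bracket S T), 1, 0), (u, Fc (dual_basis T), 0, 0)]) vs"
  have 1: "vwick (xs @ [(u, Fgamma (bracket S T), 0, 0), (u, Fa (dual_basis S), 0, 0), (u, Fabar (dual_basis T), 0, 0)]) vs = ?P S T" for S T
    using vwick_move_even[of "[(u, Fabar (dual_basis T), 0, 0)]" xs
        "[(u, Fgamma (bracket S T), 0, 0), (u, Fa (dual_basis S), 0, 0)]" "[]" vs]
    by simp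
  have 2: "vwick (xs @ [(u, Fb (bracket S T), 1, 0), (u, Fabar (dual_basis S), 0, 0), (u, Fc (dual_basis T), 0, 0)]) vs = ?Q S T" for S T
    using vwick_move_even[of "[(u, Fabar (dual_basis S), 0, 0)]" xs
        "[(u, Fb (bracket S T), 1, 0)]" "[(u, Fc (dual_basis T), 0, 0)]" vs]
    by simp
  \<comment> \<open>Here the argument \<open>- y\<close> of the cancellation lemma is used:
    \<open>bracket S T\<close> is \<open>- bracket T S\<close>.\<close>
  have 3: "?P S T = - ?Q T S" for S T
    using vwick_chain_cancel[of "xs @ [(u, Fabar (dual_basis T), 0, 0)]" "dual_basis S" u "bracket T S" u vs] assms
    by (simp add: linear_dual_basis bracket_antisym[of S T])
  have "vwick xs us = (\<Sum>S\<in>\<B>. \<Sum>T\<in>\<B>. ?P S T) + (\<Sum>S\<in>\<B>. \<Sum>T\<in>\<B>. ?Q S T)"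
    by (simp only: us vwick.simps sum_vertex vertex.simps 1 2 sum.distrib)
  also have "(\<Sum>S\<in>\<B>. \<Sum>T\<in>\<B>. ?P S T) = - (\<Sum>S\<in>\<B>. \<Sum>T\<in>\<B>. ?Q T S)"
    by (simp only: 3 sum_negf)
  also have "(\<Sum>S\<in>\<B>. \<Sum>T\<in>\<B>. ?Q T S) = (\<Sum>S\<in>\<B>. \<Sum>T\<in>\<B>. ?Q S T)"
    by (rule sum.swap)
  finally show ?thesis
    by simp
qed

end

section \<open>Expansion of the integrand into single chains\<close>

lemma permutations_of_set_sum:
  assumes "finite A" "A \<noteq> {}"
  shows "(\<Sum>xs\<in>permutations_of_set A. f xs) = (\<Sum>x\<in>A. \<Sum>xs\<in>permutations_of_set (A - {x}). f (x # xs))"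
proof -
  have "(\<Sum>xs\<in>permutations_of_set A. f xs) = (\<Sum>x\<in>A. \<Sum>xs\<in>(#) x ` permutations_of_set (A - {x}). f xs)"
    unfolding permutations_of_set_nonempty[OF assms(2)]
    by (rule sum.UNION_disjoint) (use assms in auto)
  also have "\<dots> = (\<Sum>x\<in>A. \<Sum>xs\<in>permutations_of_set (A - {x}). f (x # xs))"
    by (rule sum.cong[OF refl]) (simp add: sum.reindex)
  finally show ?thesis .
qed

lemma sum_swap_last:
  "(\<Sum>T\<in>B. \<Sum>l\<in>L. \<Sum>j\<in>P l. \<Sum>k\<in>Q l. g T l j k) = (\<Sum>l\<in>L. \<Sum>j\<in>P l. \<Sum>k\<in>Q l. \<Sum>T\<in>B. g T l j k)"
proof -
  have "(\<Sum>T\<in>B. \<Sum>l\<in>L. \<Sum>j\<in>P l. \<Sum>k\<in>Q l. g T l j k) = (\<Sum>l\<in>L. \<Sum>T\<in>B. \<Sum>j\<in>P l. \<Sum>k\<in>Q l. g T l j k)"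
    by (rule sum.swap)
  also have "\<dots> = (\<Sum>l\<in>L. \<Sum>j\<in>P l. \<Sum>T\<in>B. \<Sum>k\<in>Q l. g T l j k)"
    by (rule sum.cong[OF refl]) (rule sum.swap)
  also have "\<dots> = (\<Sum>l\<in>L. \<Sum>j\<in>P l. \<Sum>k\<in>Q l. \<Sum>T\<in>B. g T l j k)"
    by (intro sum.cong[OF refl]) (rule sum.swap)
  finally show ?thesis .
qed

lemma set_remove_nth:
  assumes "distinct xs" "i < length xs"
  shows "set (take i xs @ drop (Suc i) xs) = set xs - {xs ! i}"
    and "distinct (take i xs @ drop (Suc i) xs)"
proof -
  have *: "distinct (take i xs @ xs ! i # drop (Suc i) xs)"
    "set xs = set (take i xs @ xs ! i # drop (Suc i) xs)"
    using assms by (simp_all only: id_take_nth_drop[symmetric])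
  then show "distinct (take i xs @ drop (Suc i) xs)"
    by auto
  show "set (take i xs @ drop (Suc i) xs) = set xs - {xs ! i}"
    using * by auto
qed

lemma sum_nth_distinct:
  assumes "distinct xs"
  shows "(\<Sum>i<length xs. f (xs ! i)) = (\<Sum>x\<in>set xs. f x)"
  using sum.reindex_bij_betw[OF bij_betw_nth[OF assms refl refl], of f] by simp

text \<open>An entry \<open>(u, \<zeta>)\<close> is a vertex at \<open>u\<close> whose abar is
  contracted with the gammabar at \<open>\<zeta>\<close>. The chain runs from \<open>a\<close> at
  \<open>p\<close> to gamma at \<open>w\<close>.\<close>

fun chain_kernel :: "complex \<Rightarrow> complex \<Rightarrow> (complex \<times> complex) list \<Rightarrow> complex" where
  "chain_kernel w p [] = 1 / (p - w)"
| "chain_kernel w p ((u, \<zeta>) # r) = 1 / ((p - u) * (cnj u - cnj \<zeta>)) * chain_kernel w u r"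

lemma (in lie_algebra) ad_word_Cons [simp]: "ad_word (x # xs) y = bracket x (ad_word xs y)"
  by (simp add: ad_word_def ad_def)

lemma (in lie_algebra) ad_word_Nil [simp]: "ad_word [] y = y"
  by (simp add: ad_word_def)

context bf_theory
begin

abbreviation gammabars :: "(nat \<Rightarrow> complex) \<Rightarrow> (nat \<Rightarrow> 'g) \<Rightarrow> nat list \<Rightarrow> (complex \<times> ('k, 'g) jet) list" where
  "gammabars \<zeta> X ls \<equiv> map (\<lambda>l. (\<zeta> l, Fgammabar (X l), 0, 0)) ls"

text \<open>The vertices that remain contain no gammabar, so abar finds its partner among the outer
  fields only.\<close>

lemma vwick_gammabars_step:
  "vwick ((gammabars \<zeta> X ls @ [(v, Fabar \<theta>, 0, 0)]) @ [(w, Fgamma Y, 0, 0), (p, Fa \<eta>, 0, 0)]) us =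
    (\<Sum>j<length ls. \<iota> (\<theta> (X (ls ! j))) / (cnj v - cnj (\<zeta> (ls ! j))) *
       vwick (gammabars \<zeta> X (take j ls @ drop (Suc j) ls) @ [(w, Fgamma Y, 0, 0), (p, Fa \<eta>, 0, 0)]) us)"
proof -
  let ?b = "(v, Fabar \<theta>, 0, 0) :: complex \<times> ('k, 'g) jet"
  let ?r = "[(w, Fgamma Y, 0, 0), (p, Fa \<eta>, 0, 0)] :: (complex \<times> ('k, 'g) jet) list"
  have "vwick ((gammabars \<zeta> X ls @ [?b]) @ ?r) us = vwick (?b # (gammabars \<zeta> X ls @ ?r)) us"
    using vwick_move_even[of "[?b]" "[]" "gammabars \<zeta> X ls" ?r us] by simp
  also have "\<dots> = contract ?b (\<lambda>r. vwick (r @ ?r) us) (gammabars \<zeta> X ls)"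
    unfolding vwick_Cons sum_vertex
    by (simp add: contract_append contract_Cons)
  also have "\<dots> = (\<Sum>j<length ls. \<iota> (\<theta> (X (ls ! j))) / (cnj v - cnj (\<zeta> (ls ! j))) *
       vwick (gammabars \<zeta> X (take j ls @ drop (Suc j) ls) @ ?r) us)"
    unfolding contract_def by (simp add: sg_def take_map drop_map)
  finally show ?thesis .
qed

text \<open>Induction along the chain, starting at \<open>a\<close>: the choice of the next vertex
  and of its gammabar builds the two permutations one entry at a time. The vertex nearest to
  \<open>a\<close> supplies the outermost factor ad.\<close>

lemma vwick_chain_aux:
  assumes "distinct js" "distinct ls" "length ls = n" "length js = n" "Vector_Spaces.linear scale (*) \<eta>"
  shows "vwick (gammabars \<zeta> X ls @ [(w, Fgamma Y, 0, 0), (p, Fa \<eta>, 0, 0)]) (map u js) =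
    (\<Sum>js'\<in>permutations_of_set (set js). \<Sum>ls'\<in>permutations_of_set (set ls).
       chain_kernel w p (zip (map u js') (map \<zeta> ls')) * (-1) ^ n * \<iota> (\<eta> (ad_word (map X ls') Y)))"
  using assms
proof (induction n arbitrary: js ls p \<eta>)
  case 0
  then show ?case
    by (simp add: gwick_Cons contract_Cons)
next
  case (Suc n)
  interpret \<eta>: Vector_Spaces.linear scale "(*)" \<eta> by (rule Suc.prems)
  let ?rem = "\<lambda>i xs. take i xs @ drop (Suc i) xs"
  let ?k = "\<lambda>i l js' ls'. chain_kernel w (u i) (zip (map u js') (map \<zeta> ls'))"
  let ?W = "\<lambda>ls'. ad_word (map X ls') Y"
  let ?c = "\<lambda>i l. 1 / ((p - u i) * (cnj (u i) - cnj (\<zeta> l)))"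
  have ne: "js \<noteq> []" "ls \<noteq> []"
    using Suc.prems by auto
  have bars: "\<forall>e\<in>set (gammabars \<zeta> X ls). bar_field (fst (snd e))"
    by auto
  \<comment> \<open>The rest of the chain enters the first slot of the bracket and \<open>X\<close>
    the second, which makes one minus sign per vertex.\<close>
  have anti: "(\<Sum>S\<in>\<B>. \<Sum>T\<in>\<B>. \<iota> (\<eta> (bracket S T)) * \<iota> (dual_basis T x) * \<iota> (dual_basis S y)) = - \<iota> (\<eta> (bracket x y))" for x y
  proof -
    have "(\<Sum>S\<in>\<B>. \<Sum>T\<in>\<B>. \<iota> (\<eta> (bracket S T)) * \<iota> (dual_basis T x) * \<iota> (dual_basis S y)) = \<iota> (\<eta> (bracket y x))"
      unfolding linear_bracket_expansion[OF Suc.prems(5), of y x] embed_sum embed_mult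
      by (intro sum.cong refl) simp
    then show ?thesis
      by (simp add: bracket_antisym[of x y] \<eta>.neg embed_minus)
  qed
  \<comment> \<open>If \<open>a\<close> meets the outer gamma while vertices are left over, these
    form loops; this term vanishes by \<open>vwick_bar_eq_0\<close>.\<close>
  have "vwick (gammabars \<zeta> X ls @ [(w, Fgamma Y, 0, 0), (p, Fa \<eta>, 0, 0)]) (map u js) =
    (\<Sum>i<length js. \<Sum>S\<in>\<B>. \<Sum>T\<in>\<B>. \<iota> (\<eta> (bracket S T)) / (p - u (js ! i)) *
       vwick ((gammabars \<zeta> X ls @ [(u (js ! i), Fabar (dual_basis T), 0, 0)]) @ [(w, Fgamma Y, 0, 0), (u (js ! i), Fa (dual_basis S), 0, 0)])
         (map u (?rem i js)))"
    using ne by (subst vwick_a[OF bars]) (simp add: vwick_bar_eq_0[OF bars] take_map drop_map)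
  also have "\<dots> = (\<Sum>i<length js. \<Sum>S\<in>\<B>. \<Sum>T\<in>\<B>. \<iota> (\<eta> (bracket S T)) / (p - u (js ! i)) *
      (\<Sum>j<length ls. \<iota> (dual_basis T (X (ls ! j))) / (cnj (u (js ! i)) - cnj (\<zeta> (ls ! j))) *
        (\<Sum>js'\<in>permutations_of_set (set js - {js ! i}). \<Sum>ls'\<in>permutations_of_set (set ls - {ls ! j}).
          ?k (js ! i) (ls ! j) js' ls' * (-1) ^ n * \<iota> (dual_basis S (?W ls')))))"
  proof (intro sum.cong refl arg_cong2[where f = "(*)"])
    fix i S T
    assume i: "i \<in> {..<length js}"
    have "vwick (gammabars \<zeta> X (?rem j ls) @ [(w, Fgamma Y, 0, 0), (u (js ! i), Fa (dual_basis S), 0, 0)]) (map u (?rem i js)) =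
       (\<Sum>js'\<in>permutations_of_set (set js - {js ! i}). \<Sum>ls'\<in>permutations_of_set (set ls - {ls ! j}).
          ?k (js ! i) (ls ! j) js' ls' * (-1) ^ n * \<iota> (dual_basis S (?W ls')))"
      if "j < length ls" for j
      using Suc.IH[of "?rem i js" "?rem j ls" "dual_basis S" "u (js ! i)"] Suc.prems i that
      by (simp add: set_remove_nth linear_dual_basis del: set_append distinct_append map_append)
    then show "vwick ((gammabars \<zeta> X ls @ [(u (js ! i), Fabar (dual_basis T), 0, 0)]) @ [(w, Fgamma Y, 0, 0), (u (js ! i), Fa (dual_basis S), 0, 0)])
         (map u (?rem i js)) =
      (\<Sum>j<length ls. \<iota> (dual_basis T (X (ls ! j))) / (cnj (u (js ! i)) - cnj (\<zeta> (ls ! j))) *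
        (\<Sum>js'\<in>permutations_of_set (set js - {js ! i}). \<Sum>ls'\<in>permutations_of_set (set ls - {ls ! j}).
          ?k (js ! i) (ls ! j) js' ls' * (-1) ^ n * \<iota> (dual_basis S (?W ls'))))"
      by (subst vwick_gammabars_step) (use Suc.prems in \<open>auto intro!: sum.cong\<close>)
  qed
  also have "\<dots> = (\<Sum>i\<in>set js. \<Sum>S\<in>\<B>. \<Sum>T\<in>\<B>. \<iota> (\<eta> (bracket S T)) / (p - u i) *
      (\<Sum>l\<in>set ls. \<iota> (dual_basis T (X l)) / (cnj (u i) - cnj (\<zeta> l)) *
        (\<Sum>js'\<in>permutations_of_set (set js - {i}). \<Sum>ls'\<in>permutations_of_set (set ls - {l}).
          ?k i l js' ls' * (-1) ^ n * \<iota> (dual_basis S (?W ls')))))"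
    unfolding sum_nth_distinct[OF Suc.prems(1), symmetric] sum_nth_distinct[OF Suc.prems(2), symmetric] ..
  also have "\<dots> = (\<Sum>i\<in>set js. \<Sum>S\<in>\<B>. \<Sum>T\<in>\<B>. \<Sum>l\<in>set ls.
        \<Sum>js'\<in>permutations_of_set (set js - {i}). \<Sum>ls'\<in>permutations_of_set (set ls - {l}).
          ?c i l * ?k i l js' ls' * (-1) ^ n * (\<iota> (\<eta> (bracket S T)) * \<iota> (dual_basis T (X l)) * \<iota> (dual_basis S (?W ls'))))"
    unfolding sum_distrib_left by (intro sum.cong refl) simp
  also have "\<dots> = (\<Sum>i\<in>set js. \<Sum>l\<in>set ls.
        \<Sum>js'\<in>permutations_of_set (set js - {i}). \<Sum>ls'\<in>permutations_of_set (set ls - {l}). \<Sum>S\<in>\<B>. \<Sum>T\<in>\<B>.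
          ?c i l * ?k i l js' ls' * (-1) ^ n * (\<iota> (\<eta> (bracket S T)) * \<iota> (dual_basis T (X l)) * \<iota> (dual_basis S (?W ls'))))"
    by (rule sum.cong[OF refl])
      (rule trans[OF sum.cong[OF refl sum_swap_last] sum_swap_last])
  also have "\<dots> = (\<Sum>i\<in>set js. \<Sum>l\<in>set ls.
        \<Sum>js'\<in>permutations_of_set (set js - {i}). \<Sum>ls'\<in>permutations_of_set (set ls - {l}).
          ?c i l * ?k i l js' ls' * (-1) ^ Suc n * \<iota> (\<eta> (bracket (X l) (?W ls'))))"
    unfolding sum_distrib_left[symmetric] anti by simp
  also have "\<dots> = (\<Sum>i\<in>set js. \<Sum>js'\<in>permutations_of_set (set js - {i}). \<Sum>l\<in>set ls.
        \<Sum>ls'\<in>permutations_of_set (set ls - {l}).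
          chain_kernel w p (zip (map u (i # js')) (map \<zeta> (l # ls'))) * (-1) ^ Suc n * \<iota> (\<eta> (?W (l # ls'))))"
    by (subst sum.swap[of _ "permutations_of_set _" "set ls"]) simp
  finally show ?case
    using ne by (simp add: permutations_of_set_sum[of "set js"] permutations_of_set_sum[of "set ls"])
qed

lemma vwick_chain:
  assumes "distinct js" "distinct ls" "Vector_Spaces.linear scale (*) \<eta>"
  shows "vwick (gammabars \<zeta> X ls @ [(p, Fa \<eta>, 0, 0), (w, Fgamma Y, 0, 0)]) (map u js) =
    (if length js = length ls then
      \<Sum>js'\<in>permutations_of_set (set js). \<Sum>ls'\<in>permutations_of_set (set ls).
       chain_kernel w p (zip (map u js') (map \<zeta> ls')) * (-1) ^ length ls * \<iota> (\<eta> (ad_word (map X ls') Y))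
     else 0)"
proof (cases "length js = length ls")
  case True
  have "vwick (gammabars \<zeta> X ls @ [(p, Fa \<eta>, 0, 0), (w, Fgamma Y, 0, 0)]) (map u js) =
    vwick (gammabars \<zeta> X ls @ [(w, Fgamma Y, 0, 0), (p, Fa \<eta>, 0, 0)]) (map u js)"
    using vwick_move_even[of "[(w, Fgamma Y, 0, 0)]" "gammabars \<zeta> X ls" "[(p, Fa \<eta>, 0, 0)]" "[]"]
    by simp
  then show ?thesis
    using True assms by (simp add: vwick_chain_aux[where n = "length ls"])
next
  case False
  have "(\<Sum>x\<leftarrow>gammabars \<zeta> X ls. antiholo_charge (fst (snd x))) = - int (length ls)"
    by (induction ls) auto
  then show ?thesis
    using False by (subst vwick_antiholo_charge) auto
qed

end

section \<open>Derivatives of the ghost propagator\<close>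

lemma has_derivative_log_norm:
  fixes w z c \<kappa> :: complex
  assumes "w \<noteq> z"
  shows "((\<lambda>x. c * (2 * complex_of_real (ln (cmod (x - z))) + \<kappa>)) has_derivative
    (\<lambda>h. c * (2 * complex_of_real (((w - z) \<bullet> h) / (cmod (w - z))\<^sup>2)))) (at w)"
proof -
  have "((\<lambda>x. cmod (x - z)) has_derivative (\<lambda>h. ((w - z) \<bullet> h) / cmod (w - z))) (at w)"
  proof -
    have 1: "((\<lambda>x. x - z) has_derivative (\<lambda>h. h)) (at w)"
      by (auto intro!: derivative_eq_intros)
    have 2: "(norm has_derivative (\<lambda>h. h \<bullet> sgn (w - z))) (at (w - z))"
      using assms by (intro has_derivative_norm) simp
    show ?thesis
      using has_derivative_compose[OF 1 2]
      by (simp add: sgn_div_norm inner_commute divide_inverse mult.commute)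
  qed
  from has_derivative_ln[OF _ this] assms
  have "((\<lambda>x. ln (cmod (x - z))) has_derivative (\<lambda>h. ((w - z) \<bullet> h) / (cmod (w - z))\<^sup>2)) (at w)"
    by (simp add: power2_eq_square field_simps)
  note this [derivative_intros]
  show ?thesis
    by (rule derivative_eq_intros refl | simp)+
qed

text \<open>Formally \<open>2 ln |w - z|\<close> is the sum of a holomorphic logarithm and its
  conjugate. In the proof the gradient gives the conjugate of \<open>w - z\<close>, or
  \<open>w - z\<close> itself, over the squared modulus.\<close>

lemma wirtinger_log_norm:
  assumes "w \<noteq> z"
  shows "wirtinger (\<lambda>x. c * (2 * complex_of_real (ln (cmod (x - z))) + \<kappa>)) w = c / (w - z)"
    and "wirtinger_bar (\<lambda>x. c * (2 * complex_of_real (ln (cmod (x - z))) + \<kappa>)) w = c / (cnj w - cnj z)"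
proof -
  have 1: "complex_of_real ((cmod (w - z))\<^sup>2) = (w - z) * cnj (w - z)"
    by (rule complex_norm_square)
  have 2: "of_real (Re (w - z)) - \<i> * of_real (Im (w - z)) = cnj (w - z)"
    "of_real (Re (w - z)) + \<i> * of_real (Im (w - z)) = w - z"
    by (simp_all add: complex_eq_iff)
  have 3: "w - z \<noteq> 0" "cnj (w - z) \<noteq> 0"
    using assms by simp_all
  have inn: "(w - z) \<bullet> 1 = Re (w - z)" "(w - z) \<bullet> \<i> = Im (w - z)"
    by (simp_all add: inner_complex_def)
  have gen: "(c * (2 * (a / D)) - \<i> * (c * (2 * (b / D)))) / 2 = c * (a - \<i> * b) / D"
    "(c * (2 * (a / D)) + \<i> * (c * (2 * (b / D)))) / 2 = c * (a + \<i> * b) / D" for a b D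
    by (simp_all add: algebra_simps diff_divide_distrib add_divide_distrib)
  note D = frechet_derivative_at[OF has_derivative_log_norm[OF assms], symmetric]
  show "wirtinger (\<lambda>x. c * (2 * complex_of_real (ln (cmod (x - z))) + \<kappa>)) w = c / (w - z)"
  proof -
    have "wirtinger (\<lambda>x. c * (2 * complex_of_real (ln (cmod (x - z))) + \<kappa>)) w =
      c * (of_real (Re (w - z)) - \<i> * of_real (Im (w - z))) / ((w - z) * cnj (w - z))"
      unfolding wirtinger_def D of_real_divide 1 inn gen ..
    also have "\<dots> = c / (w - z)"
      unfolding 2 by (rule mult_divide_mult_cancel_right[OF 3(2)])
    finally show ?thesis .
  qed
  show "wirtinger_bar (\<lambda>x. c * (2 * complex_of_real (ln (cmod (x - z))) + \<kappa>)) w = c / (cnj w - cnj z)"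
  proof -
    have "wirtinger_bar (\<lambda>x. c * (2 * complex_of_real (ln (cmod (x - z))) + \<kappa>)) w =
      c * (of_real (Re (w - z)) + \<i> * of_real (Im (w - z))) / ((w - z) * cnj (w - z))"
      unfolding wirtinger_bar_def D of_real_divide 1 inn gen ..
    also have "\<dots> = c / cnj (w - z)"
      unfolding 2 mult.commute[of c] by (rule mult_divide_mult_cancel_left[OF 3(1)])
    finally show ?thesis
      by simp
  qed
qed

text \<open>Both sides choose from the same predicate, so equality persists where \<open>F\<close>
  is not differentiable. This is the case of interest: the logarithm on the diagonal.\<close>

lemma frechet_derivative_shift:
  "frechet_derivative (\<lambda>x. F (x - a)) (at a) = frechet_derivative F (at (0 :: 'a :: real_normed_vector))"
proof -
  have "((\<lambda>x. F (x - a)) has_derivative D) (at a) \<longleftrightarrow> (F has_derivative D) (at 0)" for D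
  proof
    assume *: "((\<lambda>x. F (x - a)) has_derivative D) (at a)"
    have "((\<lambda>x. x + a) has_derivative (\<lambda>h. h)) (at (0 :: 'a))"
      by (auto intro!: derivative_eq_intros)
    from has_derivative_compose[OF this, of "\<lambda>x. F (x - a)" D] *
    show "(F has_derivative D) (at 0)" by simp
  next
    assume *: "(F has_derivative D) (at 0)"
    have "((\<lambda>x. x - a) has_derivative (\<lambda>h. h)) (at a)"
      by (auto intro!: derivative_eq_intros)
    from has_derivative_compose[OF this, of F D] *
    show "((\<lambda>x. F (x - a)) has_derivative D) (at a)" by simp
  qed
  then show ?thesis
    by (simp add: frechet_derivative_def)
qed

lemma wirtinger_shift:
  "wirtinger (\<lambda>x. F (x - a)) a = wirtinger F 0" "wirtinger_bar (\<lambda>x. F (x - a)) a = wirtinger_bar F 0"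
  by (simp_all add: wirtinger_def wirtinger_bar_def frechet_derivative_shift)

lemma wirtinger_zero [simp]: "wirtinger (\<lambda>_. 0) = (\<lambda>_. 0)" "wirtinger_bar (\<lambda>_. 0) = (\<lambda>_. 0)"
  by (simp_all add: wirtinger_def wirtinger_bar_def fun_eq_iff)

lemma propagator_b:
  "propagator \<iota> \<kappa> (Fc \<xi>) (Fb x) w = (\<lambda>z. \<iota> (\<xi> x) * (2 * complex_of_real (ln (cmod (w - z))) + \<kappa>))"
  "\<not> odd_field \<phi> \<Longrightarrow> propagator \<iota> \<kappa> \<phi> (Fb x) w = (\<lambda>_. 0)" "propagator \<iota> \<kappa> (Fb y) (Fb x) w = (\<lambda>_. 0)"
  subgoal by auto
  subgoal by (cases \<phi>) auto
  subgoal by auto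
  done

text \<open>The jets that occur in the outer fields and in the interaction.\<close>

definition rel_jet :: "('k, 'g) jet \<Rightarrow> bool" where
  "rel_jet \<phi> \<longleftrightarrow> (case fst \<phi> of Fb x \<Rightarrow> snd \<phi> \<in> {(1, 0), (0, 1)} | _ \<Rightarrow> snd \<phi> = (0, 0))"

lemma rel_jet_cases:
  assumes "rel_jet \<phi>"
  obtains \<xi> where "\<phi> = (Fa \<xi>, 0, 0)" | \<xi> where "\<phi> = (Fabar \<xi>, 0, 0)" | \<xi> where "\<phi> = (Fc \<xi>, 0, 0)"
    | x where "\<phi> = (Fgamma x, 0, 0)" | x where "\<phi> = (Fgammabar x, 0, 0)"
    | x where "\<phi> = (Fb x, 1, 0)" | x where "\<phi> = (Fb x, 0, 1)"
  using assms by (cases \<phi>) (auto simp: rel_jet_def split: field_comp.splits)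

lemma jet_propagator_eq_pcontr:
  assumes "rel_jet \<phi>" "rel_jet \<psi>" "w \<noteq> z"
  shows "jet_propagator \<iota> \<kappa> \<phi> \<psi> w z = pcontr \<iota> (w, \<phi>) (z, \<psi>)"
proof -
  have neg: "wirtinger (\<lambda>x. - (c * (2 * complex_of_real (ln (cmod (z - x))) + \<kappa>))) w = c / (z - w)"
    "wirtinger_bar (\<lambda>x. - (c * (2 * complex_of_real (ln (cmod (z - x))) + \<kappa>))) w = c / (cnj z - cnj w)"
    "wirtinger (\<lambda>x. c * (2 * complex_of_real (ln (cmod (z - x))) + \<kappa>)) w = - (c / (z - w))"
    "wirtinger_bar (\<lambda>x. c * (2 * complex_of_real (ln (cmod (z - x))) + \<kappa>)) w = - (c / (cnj z - cnj w))"
    if "w \<noteq> z" for c w z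
  proof -
    have flip: "x / (a - b) = - x / (b - a)" "- (x / (a - b)) = x / (b - a)" for x a b :: complex
      by (metis minus_diff_eq minus_divide_divide minus_minus)
        (metis minus_diff_eq minus_divide_right minus_minus)
    show "wirtinger (\<lambda>x. - (c * (2 * complex_of_real (ln (cmod (z - x))) + \<kappa>))) w = c / (z - w)"
      unfolding norm_minus_commute[of z] flip(1)[of c z w]
      using wirtinger_log_norm(1)[OF that, of "- c" \<kappa>] by simp
    show "wirtinger_bar (\<lambda>x. - (c * (2 * complex_of_real (ln (cmod (z - x))) + \<kappa>))) w = c / (cnj z - cnj w)"
      unfolding norm_minus_commute[of z] flip(1)[of c "cnj z" "cnj w"]
      using wirtinger_log_norm(2)[OF that, of "- c" \<kappa>] by simp
    show "wirtinger (\<lambda>x. c * (2 * complex_of_real (ln (cmod (z - x))) + \<kappa>)) w = - (c / (z - w))"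
      unfolding norm_minus_commute[of z] flip(2)[of c z w]
      by (rule wirtinger_log_norm(1)[OF that, of "c" \<kappa>])
    show "wirtinger_bar (\<lambda>x. c * (2 * complex_of_real (ln (cmod (z - x))) + \<kappa>)) w = - (c / (cnj z - cnj w))"
      unfolding norm_minus_commute[of z] flip(2)[of c "cnj z" "cnj w"]
      by (rule wirtinger_log_norm(2)[OF that, of "c" \<kappa>])
  qed
  have wz: "z \<noteq> w" using assms by simp
  show ?thesis
    using assms(1)
    by (cases rule: rel_jet_cases; use assms(2) in \<open>cases rule: rel_jet_cases\<close>;
        simp add: jet_propagator_def neg[OF assms(3)] neg[OF wz] propagator_b)
qed

text \<open>On the diagonal a differentiated ghost propagator is an unspecified default. Translation
  invariance shows that it is the same default at every point, which is what measurability
  requires.\<close>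

lemma jet_propagator_diagonal:
  assumes "rel_jet \<phi>" "rel_jet \<psi>"
  shows "jet_propagator \<iota> \<kappa> \<phi> \<psi> w w = jet_propagator \<iota> \<kappa> \<phi> \<psi> 0 0"
proof -
  have sh: "wirtinger (\<lambda>x. c * (2 * complex_of_real (ln (cmod (w - x))) + \<kappa>)) w =
     wirtinger (\<lambda>x. c * (2 * complex_of_real (ln (cmod x)) + \<kappa>)) 0"
    "wirtinger_bar (\<lambda>x. c * (2 * complex_of_real (ln (cmod (w - x))) + \<kappa>)) w =
     wirtinger_bar (\<lambda>x. c * (2 * complex_of_real (ln (cmod x)) + \<kappa>)) 0"
    "wirtinger (\<lambda>x. - (c * (2 * complex_of_real (ln (cmod (w - x))) + \<kappa>))) w =
     wirtinger (\<lambda>x. - (c * (2 * complex_of_real (ln (cmod x)) + \<kappa>))) 0"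
    "wirtinger_bar (\<lambda>x. - (c * (2 * complex_of_real (ln (cmod (w - x))) + \<kappa>))) w =
     wirtinger_bar (\<lambda>x. - (c * (2 * complex_of_real (ln (cmod x)) + \<kappa>))) 0" for c
    using wirtinger_shift[of "\<lambda>x. c * (2 * complex_of_real (ln (cmod x)) + \<kappa>)" w]
      wirtinger_shift[of "\<lambda>x. - (c * (2 * complex_of_real (ln (cmod x)) + \<kappa>))" w]
    by (simp_all add: norm_minus_commute)
  show ?thesis
    using assms(1)
    by (cases rule: rel_jet_cases; use assms(2) in \<open>cases rule: rel_jet_cases\<close>;
        simp add: jet_propagator_def sh propagator_b)
qed

lemma borel_measurable_pcontr:
  assumes "rel_jet \<phi>" "rel_jet \<psi>" and [measurable]: "f \<in> borel_measurable M" "h \<in> borel_measurable M"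
  shows "(\<lambda>u. pcontr \<iota> (f u, \<phi>) (h u, \<psi>)) \<in> borel_measurable M"
proof -
  have [measurable]: "(\<lambda>u. cnj (f u)) \<in> borel_measurable M" "(\<lambda>u. cnj (h u)) \<in> borel_measurable M"
    by (intro borel_measurable_continuous_on[OF _ assms(3)] borel_measurable_continuous_on[OF _ assms(4)]
        continuous_intros)+
  show ?thesis
    using assms(1)
    by (cases rule: rel_jet_cases; use assms(2) in \<open>cases rule: rel_jet_cases\<close>; simp)
qed

lemma borel_measurable_jet_propagator:
  assumes "rel_jet \<phi>" "rel_jet \<psi>" and [measurable]: "f \<in> borel_measurable M" "h \<in> borel_measurable M"
  shows "(\<lambda>u. jet_propagator \<iota> \<kappa> \<phi> \<psi> (f u) (h u)) \<in> borel_measurable M"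
proof -
  have [measurable]: "(\<lambda>u. pcontr \<iota> (f u, \<phi>) (h u, \<psi>)) \<in> borel_measurable M"
    using assms by (rule borel_measurable_pcontr)
  have "(\<lambda>u. jet_propagator \<iota> \<kappa> \<phi> \<psi> (f u) (h u)) =
    (\<lambda>u. if f u = h u then jet_propagator \<iota> \<kappa> \<phi> \<psi> 0 0 else pcontr \<iota> (f u, \<phi>) (h u, \<psi>))"
    using jet_propagator_diagonal[OF assms(1,2)] jet_propagator_eq_pcontr[OF assms(1,2)]
    by (auto simp: fun_eq_iff)
  also have "\<dots> \<in> borel_measurable M"
    by measurable
  finally show ?thesis .
qed

lemma borel_measurable_wick:
  assumes "\<And>k f \<phi>. (k, f, \<phi>) \<in> set es \<Longrightarrow> f \<in> borel_measurable M \<and> rel_jet \<phi>"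
  shows "(\<lambda>u. wick \<iota> \<kappa> (map (\<lambda>(k, f, \<phi>). (k, f u, \<phi>)) es)) \<in> borel_measurable M"
  using assms
proof (induction "length es" arbitrary: es rule: less_induct)
  case less
  show ?case
  proof (cases es)
    case (Cons x xs)
    obtain k f \<phi> where x: "x = (k, f, \<phi>)" by (cases x)
    define E where "E u = map (\<lambda>(k, f, \<phi>). (k, f u, \<phi>)) xs" for u
    \<comment> \<open>The sign depends on the jets alone, so it may be frozen at an arbitrary
      argument and becomes a constant factor.\<close>
    have ks: "koszul_sign (E u) j = koszul_sign (E u') j" if "j < length xs" for u u' j
      using that unfolding koszul_sign_def E_def
      by (auto simp: case_prod_beta intro!: arg_cong[where f = "\<lambda>A. (-1) ^ card A"])
    have "(\<lambda>u. \<Sum>j<length xs. koszul_sign (E undefined) j * contraction \<iota> \<kappa> (k, f u, \<phi>) (E u ! j)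
        * wick \<iota> \<kappa> (map (\<lambda>(k, f, \<phi>). (k, f u, \<phi>)) (take j xs @ drop (Suc j) xs))) \<in> borel_measurable M"
    proof (intro borel_measurable_sum borel_measurable_times borel_measurable_const)
      fix j assume j: "j \<in> {..<length xs}"
      obtain k' f' \<phi>' where y: "xs ! j = (k', f', \<phi>')" by (cases "xs ! j")
      have y': "(k', f', \<phi>') \<in> set xs"
        using j y nth_mem[of j xs] by simp
      have m: "(\<lambda>u. jet_propagator \<iota> \<kappa> \<phi> \<phi>' (f u) (f' u)) \<in> borel_measurable M"
        using less.prems[of k f \<phi>] less.prems[of k' f' \<phi>'] y' Cons x
        by (intro borel_measurable_jet_propagator) auto
      show "(\<lambda>u. contraction \<iota> \<kappa> (k, f u, \<phi>) (E u ! j)) \<in> borel_measurable M"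
        using j y m by (simp add: E_def)
      have "set (take j xs @ drop (Suc j) xs) \<subseteq> set es"
        using Cons by (auto dest: in_set_takeD in_set_dropD)
      then show "(\<lambda>u. wick \<iota> \<kappa> (map (\<lambda>(k, f, \<phi>). (k, f u, \<phi>)) (take j xs @ drop (Suc j) xs))) \<in> borel_measurable M"
        using j Cons by (intro less.hyps less.prems) auto
    qed
    also have "(\<lambda>u. \<Sum>j<length xs. koszul_sign (E undefined) j * contraction \<iota> \<kappa> (k, f u, \<phi>) (E u ! j)
        * wick \<iota> \<kappa> (map (\<lambda>(k, f, \<phi>). (k, f u, \<phi>)) (take j xs @ drop (Suc j) xs))) =
      (\<lambda>u. wick \<iota> \<kappa> (map (\<lambda>(k, f, \<phi>). (k, f u, \<phi>)) es))"
    proof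
      fix u
      have "wick \<iota> \<kappa> (map (\<lambda>(k, f, \<phi>). (k, f u, \<phi>)) es) =
        (\<Sum>j<length xs. koszul_sign (E u) j * contraction \<iota> \<kappa> (k, f u, \<phi>) (E u ! j)
          * wick \<iota> \<kappa> (take j (E u) @ drop (Suc j) (E u)))"
        by (simp add: Cons x E_def)
      also have "\<dots> = (\<Sum>j<length xs. koszul_sign (E undefined) j * contraction \<iota> \<kappa> (k, f u, \<phi>) (E u ! j)
          * wick \<iota> \<kappa> (take j (E u) @ drop (Suc j) (E u)))"
        by (intro sum.cong refl) (subst ks[of _ u undefined], auto)
      finally show "(\<Sum>j<length xs. koszul_sign (E undefined) j * contraction \<iota> \<kappa> (k, f u, \<phi>) (E u ! j)
        * wick \<iota> \<kappa> (map (\<lambda>(k, f, \<phi>). (k, f u, \<phi>)) (take j xs @ drop (Suc j) xs))) =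
        wick \<iota> \<kappa> (map (\<lambda>(k, f, \<phi>). (k, f u, \<phi>)) es)"
        by (simp add: E_def take_map drop_map)
    qed
    finally show ?thesis .
  qed simp
qed

section \<open>Measurability of the integrand and its value off the diagonals\<close>

context bf_theory
begin

lemma borel_measurable_free_correlator_V:
  assumes "\<And>f m. (f, m) \<in> set ms \<Longrightarrow> f \<in> borel_measurable M \<and> (\<forall>\<phi>\<in>set m. rel_jet \<phi>)"
    and "\<And>f. f \<in> set fs \<Longrightarrow> f \<in> borel_measurable M"
  shows "(\<lambda>u. free_correlator_V \<kappa> (map (\<lambda>(f, m). (f u, m)) ms) (map (\<lambda>f. f u) fs)) \<in> borel_measurable M"
  using assms
proof (induction fs arbitrary: ms)
  case Nil
  define es where "es = concat (map (\<lambda>k. map (\<lambda>\<phi>. (k, fst (ms ! k), \<phi>)) (snd (ms ! k))) [0..<length ms])"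
  have "(\<lambda>u. free_correlator_V \<kappa> (map (\<lambda>(f, m). (f u, m)) ms) (map (\<lambda>f. f u) [])) =
     (\<lambda>u. wick \<iota> \<kappa> (map (\<lambda>(k, f, \<phi>). (k, f u, \<phi>)) es))"
    by (auto simp: fun_eq_iff free_correlator_def es_def map_concat case_prod_beta intro!: arg_cong[where f = "\<lambda>x. wick \<iota> \<kappa> (concat x)"])
  also have "\<dots> \<in> borel_measurable M"
  proof (rule borel_measurable_wick)
    fix k f \<phi> assume "(k, f, \<phi>) \<in> set es"
    then have k: "k < length ms" "f = fst (ms ! k)" "\<phi> \<in> set (snd (ms ! k))"
      by (auto simp: es_def)
    then show "f \<in> borel_measurable M \<and> rel_jet \<phi>"
      using Nil.prems(1)[of "fst (ms ! k)" "snd (ms ! k)"] nth_mem[of k ms] by auto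
  qed
  finally show ?case .
next
  case (Cons f fs)
  have "(\<lambda>u. free_correlator_V \<kappa> (map (\<lambda>(f, m). (f u, m)) ms @ [(f u, m)]) (map (\<lambda>f. f u) fs)) \<in> borel_measurable M"
    if "\<forall>\<phi>\<in>set m. rel_jet \<phi>" for m
    using Cons.IH[of "ms @ [(f, m)]"] Cons.prems that by auto
  then show ?case
    by (simp add: interaction_def rel_jet_def)
qed

lemma borel_measurable_integrand:
  assumes "\<And>z \<phi>. (z, \<phi>) \<in> set \<Phi>s \<Longrightarrow> rel_jet \<phi>"
  shows "integrand \<kappa> \<Phi>s N \<in> borel_measurable (\<Pi>\<^sub>M i\<in>{..<N}. lborel)"
proof -
  have "(\<lambda>u. free_correlator_V \<kappa> (map (\<lambda>(f, m). (f u, m)) (map (\<lambda>(z, \<phi>). (\<lambda>_. z, [\<phi>])) \<Phi>s))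
      (map (\<lambda>f. f u) (map (\<lambda>i u. u i) [0..<N]))) \<in> borel_measurable (\<Pi>\<^sub>M i\<in>{..<N}. lborel)"
    by (rule borel_measurable_free_correlator_V) (use assms in auto)
  also have "(\<lambda>u. free_correlator_V \<kappa> (map (\<lambda>(f, m). (f u, m)) (map (\<lambda>(z, \<phi>). (\<lambda>_. z, [\<phi>])) \<Phi>s))
      (map (\<lambda>f. f u) (map (\<lambda>i u. u i) [0..<N]))) = integrand \<kappa> \<Phi>s N"
    by (simp add: fun_eq_iff integrand_def comp_def case_prod_beta')
  finally show ?thesis .
qed

lemma pcontr_same_point [simp]: "pcontr \<iota> (z, \<phi>) (z, \<psi>) = 0"
  by (induction \<iota> "(z, \<phi>)" "(z, \<psi>)" rule: pcontr.induct) auto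

text \<open>If labels and points distinguish the same factors, the contractions suppressed by equal
  labels are those that \<open>pcontr\<close> makes 0 by its division by zero.\<close>

lemma wick_eq_gwick:
  assumes "\<And>x y. x \<in> set xs \<Longrightarrow> y \<in> set xs \<Longrightarrow> fst x = fst y \<longleftrightarrow> fst (snd x) = fst (snd y)"
    and "\<And>x. x \<in> set xs \<Longrightarrow> rel_jet (snd (snd x))"
  shows "wick \<iota> \<kappa> xs = gwick (map snd xs)"
  using assms
proof (induction "length xs" arbitrary: xs rule: less_induct)
  case less
  show ?case
  proof (cases xs)
    case (Cons x ys)
    have "koszul_sign ys j * contraction \<iota> \<kappa> x (ys ! j) * wick \<iota> \<kappa> (take j ys @ drop (Suc j) ys) =
      sg (map snd ys ! j) (take j (map snd ys)) * pcontr \<iota> (snd x) (map snd ys ! j) *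
        gwick (take j (map snd ys) @ drop (Suc j) (map snd ys))" if j: "j < length ys" for j
    proof (intro arg_cong2[where f = "(*)"])
      show "koszul_sign ys j = sg (map snd ys ! j) (take j (map snd ys))"
        using j unfolding koszul_sign_def sg_def nodd_def length_filter_conv_card
        by (auto intro!: arg_cong[where f = "\<lambda>A. (-1) ^ card A"])
      obtain k w \<phi> where x: "x = (k, w, \<phi>)" by (cases x)
      obtain l z \<psi> where y: "ys ! j = (l, z, \<psi>)" by (cases "ys ! j")
      have mem: "(l, z, \<psi>) \<in> set xs" "(k, w, \<phi>) \<in> set xs"
        using j Cons x nth_mem[OF j] y by auto
      show "contraction \<iota> \<kappa> x (ys ! j) = pcontr \<iota> (snd x) (map snd ys ! j)"
        using less.prems(1)[OF mem] less.prems(2)[OF mem(1)] less.prems(2)[OF mem(2)] j x y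
        by (cases "k = l") (simp_all add: jet_propagator_eq_pcontr)
      have "set (take j ys @ drop (Suc j) ys) \<subseteq> set xs"
        using Cons by (auto dest: in_set_takeD in_set_dropD)
      then have "wick \<iota> \<kappa> (take j ys @ drop (Suc j) ys) = gwick (map snd (take j ys @ drop (Suc j) ys))"
        using j Cons by (intro less.hyps less.prems) auto
      then show "wick \<iota> \<kappa> (take j ys @ drop (Suc j) ys) = gwick (take j (map snd ys) @ drop (Suc j) (map snd ys))"
        by (simp add: take_map drop_map)
    qed
    then show ?thesis
      by (simp add: Cons gwick.simps(2))
  qed simp
qed

lemma free_correlator_V_eq_fwick:
  assumes "distinct (map fst ms @ us)" "\<And>z m \<phi>. (z, m) \<in> set ms \<Longrightarrow> \<phi> \<in> set m \<Longrightarrow> rel_jet \<phi>"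
  shows "free_correlator_V \<kappa> ms us = fwick (concat (map (\<lambda>(z, m). map (Pair z) m) ms)) us"
  using assms
proof (induction us arbitrary: ms)
  case Nil
  define xs where "xs = concat (map (\<lambda>k. map (\<lambda>\<phi>. (k, fst (ms ! k), \<phi>)) (snd (ms ! k))) [0..<length ms])"
  have xsD: "fst x < length ms \<and> fst (snd x) = map fst ms ! fst x \<and> snd (snd x) \<in> set (snd (ms ! fst x))"
    if "x \<in> set xs" for x
    using that by (auto simp: xs_def)
  have "wick \<iota> \<kappa> xs = gwick (map snd xs)"
  proof (rule wick_eq_gwick)
    show "fst x = fst y \<longleftrightarrow> fst (snd x) = fst (snd y)" if "x \<in> set xs" "y \<in> set xs" for x y
      using xsD[OF that(1)] xsD[OF that(2)] Nil.prems(1) nth_eq_iff_index_eq[of "map fst ms" "fst x" "fst y"]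
      by simp
    show "rel_jet (snd (snd x))" if "x \<in> set xs" for x
      using xsD[OF that] Nil.prems(2)[of "fst (ms ! fst x)" "snd (ms ! fst x)" "snd (snd x)"] nth_mem[of "fst x" ms]
      by simp
  qed
  also have "map snd xs = concat (map (\<lambda>(z, m). map (Pair z) m) (map (\<lambda>k. ms ! k) [0..<length ms]))"
    unfolding xs_def map_concat map_map by (simp add: comp_def case_prod_beta)
  also have "map (\<lambda>k. ms ! k) [0..<length ms] = ms"
    by (rule map_nth)
  finally show ?case
    by (simp add: free_correlator_def xs_def)
next
  case (Cons u us)
  have "free_correlator_V \<kappa> (ms @ [(u, m)]) us = fwick (concat (map (\<lambda>(z, m). map (Pair z) m) ms) @ map (Pair u) m) us"
    if m: "\<forall>\<phi>\<in>set m. rel_jet \<phi>" for m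
  proof -
    have "free_correlator_V \<kappa> (ms @ [(u, m)]) us = fwick (concat (map (\<lambda>(z, m). map (Pair z) m) (ms @ [(u, m)]))) us"
    proof (rule Cons.IH)
      show "distinct (map fst (ms @ [(u, m)]) @ us)"
        using Cons.prems(1) by auto
      show "rel_jet \<phi>" if "(z, m') \<in> set (ms @ [(u, m)])" "\<phi> \<in> set m'" for z m' \<phi>
        using that m Cons.prems(2)[of z m' \<phi>] by (auto simp del: split_paired_All)
    qed
    then show ?thesis
      by simp
  qed
  then show ?case
    by (simp add: interaction_def rel_jet_def)
qed

lemma integrand_eq_chains:
  assumes "distinct (map \<zeta> ls @ [w1, w2] @ map u [0..<N])" "distinct ls" "Vector_Spaces.linear scale (*) \<xi>"
  shows "integrand \<kappa> (gammabars \<zeta> X ls @ [(w1, Fa \<xi>, 0, 0), (w2, Fgamma Y, 0, 0)]) N u =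
    (if N = length ls then
      \<Sum>js'\<in>permutations_of_set {..<N}. \<Sum>ls'\<in>permutations_of_set (set ls).
       chain_kernel w2 w1 (zip (map u js') (map \<zeta> ls')) * (-1) ^ N * \<iota> (\<xi> (ad_word (map X ls') Y))
     else 0)"
proof -
  let ?\<Phi>s = "gammabars \<zeta> X ls @ [(w1, Fa \<xi>, 0, 0), (w2, Fgamma Y, 0, 0)]"
  have ch: "(\<Sum>x\<leftarrow>?\<Phi>s. holo_charge (fst (snd x))) = 0"
    by (simp add: comp_def)
  have "integrand \<kappa> ?\<Phi>s N u = fwick (concat (map (\<lambda>(z, m). map (Pair z) m) (map (\<lambda>(z, \<phi>). (z, [\<phi>])) ?\<Phi>s))) (map u [0..<N])"
    unfolding integrand_def
    by (rule free_correlator_V_eq_fwick) (use assms in \<open>auto simp: comp_def rel_jet_def\<close>)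
  also have "concat (map (\<lambda>(z, m). map (Pair z) m) (map (\<lambda>(z, \<phi>). (z, [\<phi>])) ?\<Phi>s)) = ?\<Phi>s"
    by (simp add: comp_def concat_map_singleton)
  finally show ?thesis
    using vwick_chain[OF distinct_upt assms(2,3), of \<zeta> X w1 w2 Y u 0 N] ch
    by (simp add: fwick_eq_vwick atLeast0LessThan)
qed

end

section \<open>Polar coordinates\<close>

lemma SUP_indicator_mult:
  "(SUP n. (c :: ennreal) * indicator (B n) x) = c * indicator (\<Union>n. B n) x"
proof (cases "\<exists>n. x \<in> B n")
  case True
  then obtain n where n: "x \<in> B n" ..
  have "(SUP n. c * indicator (B n) x) = c"
    by (intro antisym SUP_least SUP_upper2[of n]) (use n in \<open>auto split: split_indicator\<close>)
  then show ?thesis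
    using n by (simp add: indicator_def) metis
qed (auto simp: indicator_def)

lemma incseq_mult_indicator:
  assumes "incseq B"
  shows "incseq (\<lambda>n x. (c x :: ennreal) * indicator (B n) x)"
  unfolding incseq_def le_fun_def
proof (intro allI impI)
  fix m n x assume "m \<le> (n :: nat)"
  then have "B m \<subseteq> B n"
    using assms by (rule incseqD[rotated])
  then show "c x * indicator (B m) x \<le> c x * indicator (B n) x"
    by (auto simp: indicator_def)
qed

text \<open>The measure \<open>dt / (1 + t^2)\<close> is carried to Lebesgue measure on an interval.
  This is checked on sets, by substitution on the intervals from -n to n and monotone convergence,
  and then holds for all \<open>g\<close>.\<close>

lemma nn_integral_arctan:
  fixes g :: "real \<Rightarrow> ennreal"
  assumes [measurable]: "g \<in> borel_measurable borel"
  shows "(\<integral>\<^sup>+t. g (arctan t) * ennreal (1 / (1 + t\<^sup>2)) \<partial>lborel) =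
    (\<integral>\<^sup>+x. g x * indicator {- (pi / 2)<..<pi / 2} x \<partial>lborel)"
proof -
  have [measurable]: "arctan \<in> borel_measurable borel"
    by (intro borel_measurable_continuous_onI continuous_intros)
  let ?M = "distr (density lborel (\<lambda>t. ennreal (1 / (1 + t\<^sup>2)))) borel arctan"
  let ?N = "density lborel (indicator {- (pi / 2)<..<pi / 2})"
  have "?M = ?N"
  proof (rule measure_eqI)
    fix A :: "real set" assume "A \<in> sets ?M"
    then have [measurable]: "A \<in> sets borel" by simp
    let ?B = "\<lambda>n::nat. {arctan (- real n)..arctan (real n)}"
    have inc: "incseq (\<lambda>n::nat. {- real n..real n})" "incseq ?B"
      by (auto simp: incseq_def intro: order.trans arctan_monotone')
    have sub: "(\<integral>\<^sup>+x. indicator A x * indicator (?B n) x \<partial>lborel) =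
       (\<integral>\<^sup>+t. indicator A (arctan t) * ennreal (1 / (1 + t\<^sup>2)) * indicator {- real n..real n} t \<partial>lborel)" for n
    proof -
      have ci: "continuous_on {- real n..real n} (\<lambda>t. 1 / (1 + t\<^sup>2))"
        by (intro continuous_intros) (auto simp: add_nonneg_eq_0_iff)
      have "(\<integral>\<^sup>+x. ennreal (indicator A x * indicator (?B n) x) \<partial>lborel) =
        (\<integral>\<^sup>+t. ennreal (indicator A (arctan t) * (1 / (1 + t\<^sup>2)) * indicator {- real n..real n} t) \<partial>lborel)"
        by (rule nn_integral_substitution[OF _ _ ci])
          (auto simp: set_borel_measurable_def intro!: derivative_eq_intros simp: inverse_eq_divide)
      moreover have "(\<integral>\<^sup>+x. indicator A x * indicator (?B n) x \<partial>lborel) = (\<integral>\<^sup>+x. ennreal (indicator A x * indicator (?B n) x) \<partial>lborel)"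
        by (intro nn_integral_cong) (auto simp: indicator_def)
      moreover have "(\<integral>\<^sup>+t. ennreal (indicator A (arctan t) * (1 / (1 + t\<^sup>2)) * indicator {- real n..real n} t) \<partial>lborel) =
        (\<integral>\<^sup>+t. indicator A (arctan t) * ennreal (1 / (1 + t\<^sup>2)) * indicator {- real n..real n} t \<partial>lborel)"
        by (intro nn_integral_cong) (auto simp: indicator_def)
      ultimately show ?thesis
        by simp
    qed
    have cover: "(\<Union>n. ?B n) = {- (pi / 2)<..<pi / 2}"
    proof safe
      fix x n assume "x \<in> ?B n"
      then have "arctan (- real n) \<le> x" "x \<le> arctan (real n)" by auto
      then show "x \<in> {- (pi / 2)<..<pi / 2}"
        using arctan_bounded[of "- real n"] arctan_bounded[of "real n"] by auto
    next
      fix x :: real assume x: "x \<in> {- (pi / 2)<..<pi / 2}"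
      obtain n :: nat where n: "\<bar>tan x\<bar> \<le> real n"
        using real_arch_simple by blast
      have "arctan (- real n) \<le> arctan (tan x)" "arctan (tan x) \<le> arctan (real n)"
        using n by (auto intro!: arctan_monotone')
      then show "x \<in> (\<Union>n. ?B n)"
        using x by (auto simp: arctan_tan)
    qed
    have cover2: "(\<Union>n::nat. {- real n..real n}) = UNIV"
    proof safe
      fix x :: real
      obtain n :: nat where n: "\<bar>x\<bar> \<le> real n"
        using real_arch_simple by blast
      then show "x \<in> (\<Union>n::nat. {- real n..real n})"
        by (auto intro!: exI[of _ n])
    qed simp
    have "emeasure ?N A = (\<integral>\<^sup>+x. indicator A x * indicator (\<Union>n. ?B n) x \<partial>lborel)"
      unfolding cover by (subst emeasure_density) (auto simp: mult.commute)
    also have "\<dots> = (SUP n. \<integral>\<^sup>+x. indicator A x * indicator (?B n) x \<partial>lborel)"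
      unfolding SUP_indicator_mult[symmetric]
      by (rule nn_integral_monotone_convergence_SUP[OF incseq_mult_indicator[OF inc(2)]]) measurable
    also have "\<dots> = (SUP n. \<integral>\<^sup>+t. indicator A (arctan t) * ennreal (1 / (1 + t\<^sup>2)) * indicator {- real n..real n} t \<partial>lborel)"
      unfolding sub ..
    also have "\<dots> = (\<integral>\<^sup>+t. indicator A (arctan t) * ennreal (1 / (1 + t\<^sup>2)) * indicator (\<Union>n::nat. {- real n..real n}) t \<partial>lborel)"
      unfolding SUP_indicator_mult[symmetric]
      by (rule nn_integral_monotone_convergence_SUP[OF incseq_mult_indicator[OF inc(1)], symmetric]) measurable
    also have "\<dots> = (\<integral>\<^sup>+t. indicator A (arctan t) \<partial>density lborel (\<lambda>t. ennreal (1 / (1 + t\<^sup>2))))"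
      unfolding cover2 by (subst nn_integral_density) (auto simp: mult.commute)
    also have "\<dots> = (\<integral>\<^sup>+x. indicator A x \<partial>?M)"
      by (subst nn_integral_distr) auto
    also have "\<dots> = emeasure ?M A"
      by simp
    finally show "emeasure ?M A = emeasure ?N A" ..
  qed simp
  then have "(\<integral>\<^sup>+x. g x \<partial>?M) = (\<integral>\<^sup>+x. g x \<partial>?N)"
    by simp
  then show ?thesis
    by (simp add: nn_integral_distr nn_integral_density mult.commute)
qed

lemma lborel_complex:
  "(lborel :: complex measure) = distr (lborel \<Otimes>\<^sub>M lborel) borel (\<lambda>(x, y). Complex x y)"
proof (rule lborel_eqI)
  have [measurable]: "(\<lambda>(x, y). Complex x y) \<in> borel_measurable (borel \<Otimes>\<^sub>M borel)"
    unfolding borel_prod case_prod_beta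
    by (intro borel_measurable_continuous_onI continuous_intros)
  fix l u :: complex
  assume le: "\<And>b. b \<in> Basis \<Longrightarrow> l \<bullet> b \<le> u \<bullet> b"
  then have le': "Re l \<le> Re u" "Im l \<le> Im u"
    using le[of 1] le[of \<i>] by (auto simp: Basis_complex_def inner_complex_def)
  have "emeasure (distr (lborel \<Otimes>\<^sub>M lborel) borel (\<lambda>(x, y). Complex x y)) (box l u) =
    emeasure (lborel \<Otimes>\<^sub>M lborel) ({Re l<..<Re u} \<times> {Im l<..<Im u})"
    by (subst emeasure_distr)
      (auto simp: Basis_complex_def box_def inner_complex_def space_pair_measure intro!: arg_cong2[where f = emeasure])
  also have "\<dots> = ennreal (Re u - Re l) * ennreal (Im u - Im l)"
    using le' by (subst lborel.emeasure_pair_measure_Times) auto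
  also have "\<dots> = (\<Prod>b\<in>Basis. (u - l) \<bullet> b)"
    using le' by (simp add: Basis_complex_def inner_complex_def ennreal_mult[symmetric])
  finally show "emeasure (distr (lborel \<Otimes>\<^sub>M lborel) borel (\<lambda>(x, y). Complex x y)) (box l u) =
     (\<Prod>b\<in>Basis. (u - l) \<bullet> b)" .
qed simp

lemma measurable_Complex [measurable]:
  "(\<lambda>(x, y). Complex x y) \<in> borel_measurable (borel \<Otimes>\<^sub>M borel)"
  unfolding borel_prod case_prod_beta
  by (intro borel_measurable_continuous_onI continuous_intros)

lemma measurable_cis [measurable]: "cis \<in> borel_measurable borel"
  by (intro borel_measurable_continuous_onI continuous_intros)

lemma measurable_cnj [measurable]: "cnj \<in> borel_measurable borel"
  by (intro borel_measurable_continuous_onI continuous_intros)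

lemma nn_integral_complex:
  assumes [measurable]: "f \<in> borel_measurable borel"
  shows "(\<integral>\<^sup>+z. f z \<partial>lborel) = (\<integral>\<^sup>+y. \<integral>\<^sup>+x. f (Complex x y) \<partial>lborel \<partial>lborel)"
proof -
  have "(\<integral>\<^sup>+z. f z \<partial>lborel) = (\<integral>\<^sup>+w. f (case w of (x, y) \<Rightarrow> Complex x y) \<partial>(lborel \<Otimes>\<^sub>M lborel))"
    by (subst lborel_complex, subst nn_integral_distr) auto
  also have "\<dots> = (\<integral>\<^sup>+y. \<integral>\<^sup>+x. f (Complex x y) \<partial>lborel \<partial>lborel)"
    by (subst lborel_pair.nn_integral_snd[symmetric]) auto
  finally show ?thesis .
qed

text \<open>Polar coordinates from one-dimensional substitutions: x = y t introduces the cotangent t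
  of the angle, after an exchange y becomes r over \<open>sqrt (1 + t^2)\<close>, and after another
  exchange t is turned into the angle by arctan.\<close>

lemma nn_integral_upper_half_plane:
  fixes f :: "complex \<Rightarrow> ennreal"
  assumes [measurable]: "f \<in> borel_measurable borel"
  shows "(\<integral>\<^sup>+y. indicator {0<..} y * (\<integral>\<^sup>+x. f (Complex x y) \<partial>lborel) \<partial>lborel) =
    (\<integral>\<^sup>+r. indicator {0<..} r * ennreal r * (\<integral>\<^sup>+t. f (r * cis t) * indicator {0<..<pi} t \<partial>lborel) \<partial>lborel)"
proof -
  have [measurable]: "arctan \<in> borel_measurable borel"
    by (intro borel_measurable_continuous_onI continuous_intros)
  have sq: "0 < 1 + t\<^sup>2" "sqrt (1 + t\<^sup>2) > 0" for t :: real
    by (simp_all add: add_pos_nonneg)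
  have "(\<integral>\<^sup>+y. indicator {0<..} y * (\<integral>\<^sup>+x. f (Complex x y) \<partial>lborel) \<partial>lborel) =
    (\<integral>\<^sup>+y. indicator {0<..} y * (ennreal y * (\<integral>\<^sup>+t. f (Complex (y * t) y) \<partial>lborel)) \<partial>lborel)"
  proof (intro nn_integral_cong)
    fix y :: real
    show "indicator {0<..} y * (\<integral>\<^sup>+x. f (Complex x y) \<partial>lborel) =
      indicator {0<..} y * (ennreal y * (\<integral>\<^sup>+t. f (Complex (y * t) y) \<partial>lborel))"
    proof (cases "y > 0")
      case True
      then show ?thesis
        using nn_integral_real_affine[of "\<lambda>x. f (Complex x y)" y 0] by simp
    qed simp
  qed
  also have "\<dots> = (\<integral>\<^sup>+y. \<integral>\<^sup>+t. indicator {0<..} y * (ennreal y * f (Complex (y * t) y)) \<partial>lborel \<partial>lborel)"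
    by (simp add: nn_integral_cmult)
  also have "\<dots> = (\<integral>\<^sup>+t. \<integral>\<^sup>+y. indicator {0<..} y * (ennreal y * f (Complex (y * t) y)) \<partial>lborel \<partial>lborel)"
    by (rule lborel_pair.Fubini') simp
  also have "\<dots> = (\<integral>\<^sup>+t. \<integral>\<^sup>+r. indicator {0<..} r * (ennreal r * f (r * cis (pi / 2 - arctan t))) * ennreal (1 / (1 + t\<^sup>2)) \<partial>lborel \<partial>lborel)"
  proof (rule nn_integral_cong)
    fix t :: real
    \<comment> \<open>The sine of the angle \<open>pi / 2 - arctan t\<close>, hence the ratio of y
      to r along the ray.\<close>
    let ?c = "1 / sqrt (1 + t\<^sup>2)"
    have c: "?c > 0"
      using sq[of t] by simp
    have cc: "ennreal ?c * ennreal (?c * r) = ennreal r * ennreal (1 / (1 + t\<^sup>2))" if "r > 0" for r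
    proof -
      have "?c * (?c * r) = r * (1 / (1 + t\<^sup>2))"
        using sq[of t] by simp
      then show ?thesis
        using c that by (simp add: ennreal_mult[symmetric])
    qed
    have pt: "Complex (?c * r * t) (?c * r) = r * cis (pi / 2 - arctan t)" for r
      by (simp add: complex_eq_iff cos_diff sin_diff cos_arctan sin_arctan)
    have "(\<integral>\<^sup>+y. indicator {0<..} y * (ennreal y * f (Complex (y * t) y)) \<partial>lborel) =
      ennreal ?c * (\<integral>\<^sup>+r. indicator {0<..} (?c * r) * (ennreal (?c * r) * f (Complex (?c * r * t) (?c * r))) \<partial>lborel)"
      using nn_integral_real_affine[of "\<lambda>y. indicator {0<..} y * (ennreal y * f (Complex (y * t) y))" ?c 0] c
      by (simp del: divide_pos_pos)
    also have "\<dots> = (\<integral>\<^sup>+r. ennreal ?c * (indicator {0<..} (?c * r) * (ennreal (?c * r) * f (Complex (?c * r * t) (?c * r)))) \<partial>lborel)"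
      by (rule nn_integral_cmult[symmetric]) measurable
    also have "\<dots> = (\<integral>\<^sup>+r. indicator {0<..} r * (ennreal r * f (r * cis (pi / 2 - arctan t))) * ennreal (1 / (1 + t\<^sup>2)) \<partial>lborel)"
    proof (intro nn_integral_cong)
      fix r :: real
      show "ennreal ?c * (indicator {0<..} (?c * r) * (ennreal (?c * r) * f (Complex (?c * r * t) (?c * r)))) =
         indicator {0<..} r * (ennreal r * f (r * cis (pi / 2 - arctan t))) * ennreal (1 / (1 + t\<^sup>2))"
      proof (cases "r > 0")
        case True
        then have 1: "indicator {0<..} (?c * r) = (1 :: ennreal)" "indicator {0<..} r = (1 :: ennreal)"
          using mult_pos_pos[OF c True] by simp_all
        show ?thesis
          unfolding 1 pt mult_1_left mult.assoc[symmetric] cc[OF True] by (simp only: mult_ac)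
      next
        case False
        have "\<not> 0 < ?c * r"
          using c False by (auto simp only: not_less intro!: mult_nonneg_nonpos)
        then have "indicator {0<..} (?c * r) = (0 :: ennreal)"
          by (simp only: indicator_def greaterThan_iff of_bool_eq)
        then show ?thesis
          using False by simp
      qed
    qed
    finally show "(\<integral>\<^sup>+y. indicator {0<..} y * (ennreal y * f (Complex (y * t) y)) \<partial>lborel) =
      (\<integral>\<^sup>+r. indicator {0<..} r * (ennreal r * f (r * cis (pi / 2 - arctan t))) * ennreal (1 / (1 + t\<^sup>2)) \<partial>lborel)" .
  qed
  also have "\<dots> = (\<integral>\<^sup>+r. \<integral>\<^sup>+t. indicator {0<..} r * (ennreal r * f (r * cis (pi / 2 - arctan t))) * ennreal (1 / (1 + t\<^sup>2)) \<partial>lborel \<partial>lborel)"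
    by (rule lborel_pair.Fubini') simp
  also have "\<dots> = (\<integral>\<^sup>+r. indicator {0<..} r * ennreal r * (\<integral>\<^sup>+t. f (r * cis t) * indicator {0<..<pi} t \<partial>lborel) \<partial>lborel)"
  proof (intro nn_integral_cong)
    fix r :: real
    have "(\<integral>\<^sup>+t. indicator {0<..} r * (ennreal r * f (r * cis (pi / 2 - arctan t))) * ennreal (1 / (1 + t\<^sup>2)) \<partial>lborel) =
      indicator {0<..} r * ennreal r * (\<integral>\<^sup>+t. f (r * cis (pi / 2 - arctan t)) * ennreal (1 / (1 + t\<^sup>2)) \<partial>lborel)"
      by (subst nn_integral_cmult[symmetric]) (auto simp: mult_ac)
    also have "(\<integral>\<^sup>+t. f (r * cis (pi / 2 - arctan t)) * ennreal (1 / (1 + t\<^sup>2)) \<partial>lborel) =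
      (\<integral>\<^sup>+x. f (r * cis (pi / 2 - x)) * indicator {- (pi / 2)<..<pi / 2} x \<partial>lborel)"
      by (rule nn_integral_arctan) measurable
    also have "\<dots> = (\<integral>\<^sup>+x. f (r * cis x) * indicator {- (pi / 2)<..<pi / 2} (pi / 2 - x) \<partial>lborel)"
      using nn_integral_real_affine[of "\<lambda>x. f (r * cis x) * indicator {- (pi / 2)<..<pi / 2} (pi / 2 - x)" "-1" "pi / 2"]
      by simp
    also have "\<dots> = (\<integral>\<^sup>+x. f (r * cis x) * indicator {0<..<pi} x \<partial>lborel)"
      by (intro nn_integral_cong) (auto simp: indicator_def)
    finally show "(\<integral>\<^sup>+t. indicator {0<..} r * (ennreal r * f (r * cis (pi / 2 - arctan t))) * ennreal (1 / (1 + t\<^sup>2)) \<partial>lborel) =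
      indicator {0<..} r * ennreal r * (\<integral>\<^sup>+t. f (r * cis t) * indicator {0<..<pi} t \<partial>lborel)" .
  qed
  finally show ?thesis .
qed

text \<open>The lower half plane is the upper one under negation, which adds pi to the angle. The
  real axis and the angles 0, pi and 2 pi are null.\<close>

lemma nn_integral_polar:
  fixes f :: "complex \<Rightarrow> ennreal"
  assumes [measurable]: "f \<in> borel_measurable borel"
  shows "(\<integral>\<^sup>+z. f z \<partial>lborel) =
    (\<integral>\<^sup>+r. \<integral>\<^sup>+t. ennreal (indicator {0<..} r * r) * indicator {0..2 * pi} t * f (r * cis t) \<partial>lborel \<partial>lborel)"
proof -
  let ?h = "\<lambda>y. \<integral>\<^sup>+x. f (Complex x y) \<partial>lborel"
  have "(\<integral>\<^sup>+z. f z \<partial>lborel) = (\<integral>\<^sup>+y. ?h y \<partial>lborel)"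
    by (rule nn_integral_complex) measurable
  also have "\<dots> = (\<integral>\<^sup>+y. indicator {0<..} y * ?h y + indicator {0<..} (- y) * ?h y \<partial>lborel)"
    by (intro nn_integral_cong_AE AE_I[of _ _ "{0}"]) (auto simp: indicator_def)
  also have "\<dots> = (\<integral>\<^sup>+y. indicator {0<..} y * ?h y \<partial>lborel) + (\<integral>\<^sup>+y. indicator {0<..} (- y) * ?h y \<partial>lborel)"
    by (rule nn_integral_add) measurable
  also have "(\<integral>\<^sup>+y. indicator {0<..} (- y) * ?h y \<partial>lborel) = (\<integral>\<^sup>+y. indicator {0<..} y * ?h (- y) \<partial>lborel)"
    using nn_integral_real_affine[of "\<lambda>y. indicator {0<..} (- y) * ?h y" "-1" 0] by simp
  also have "\<dots> = (\<integral>\<^sup>+y. indicator {0<..} y * (\<integral>\<^sup>+x. f (- Complex x y) \<partial>lborel) \<partial>lborel)"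
  proof (rule nn_integral_cong, rule arg_cong2[where f = "(*)", OF refl])
    fix y :: real
    have "Complex (- x) (- y) = - Complex x y" for x
      by (simp add: complex_eq_iff)
    then show "?h (- y) = (\<integral>\<^sup>+x. f (- Complex x y) \<partial>lborel)"
      using nn_integral_real_affine[of "\<lambda>x. f (Complex x (- y))" "-1" 0] by simp
  qed
  also have "(\<integral>\<^sup>+y. indicator {0<..} y * ?h y \<partial>lborel) =
     (\<integral>\<^sup>+r. indicator {0<..} r * ennreal r * (\<integral>\<^sup>+t. f (r * cis t) * indicator {0<..<pi} t \<partial>lborel) \<partial>lborel)"
    by (rule nn_integral_upper_half_plane) measurable
  also have "(\<integral>\<^sup>+y. indicator {0<..} y * (\<integral>\<^sup>+x. f (- Complex x y) \<partial>lborel) \<partial>lborel) =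
     (\<integral>\<^sup>+r. indicator {0<..} r * ennreal r * (\<integral>\<^sup>+t. f (- (r * cis t)) * indicator {0<..<pi} t \<partial>lborel) \<partial>lborel)"
    by (rule nn_integral_upper_half_plane[where f = "\<lambda>z. f (- z)"]) measurable
  also have "(\<integral>\<^sup>+r. indicator {0<..} r * ennreal r * (\<integral>\<^sup>+t. f (r * cis t) * indicator {0<..<pi} t \<partial>lborel) \<partial>lborel) +
     (\<integral>\<^sup>+r. indicator {0<..} r * ennreal r * (\<integral>\<^sup>+t. f (- (r * cis t)) * indicator {0<..<pi} t \<partial>lborel) \<partial>lborel) =
    (\<integral>\<^sup>+r. indicator {0<..} r * ennreal r * (\<integral>\<^sup>+t. f (r * cis t) * indicator {0<..<pi} t \<partial>lborel) +
      indicator {0<..} r * ennreal r * (\<integral>\<^sup>+t. f (- (r * cis t)) * indicator {0<..<pi} t \<partial>lborel) \<partial>lborel)"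
    by (rule nn_integral_add[symmetric]) measurable
  also have "\<dots> = (\<integral>\<^sup>+r. \<integral>\<^sup>+t. ennreal (indicator {0<..} r * r) * indicator {0..2 * pi} t * f (r * cis t) \<partial>lborel \<partial>lborel)"
  proof (intro nn_integral_cong)
    fix r :: real
    have "(\<integral>\<^sup>+t. f (- (r * cis t)) * indicator {0<..<pi} t \<partial>lborel) = (\<integral>\<^sup>+t. f (r * cis t) * indicator {0<..<pi} (t - pi) \<partial>lborel)"
      using nn_integral_real_affine[of "\<lambda>t. f (r * cis t) * indicator {0<..<pi} (t - pi)" "1" pi]
      by (simp add: cis_mult[symmetric])
    then have "(\<integral>\<^sup>+t. f (r * cis t) * indicator {0<..<pi} t \<partial>lborel) + (\<integral>\<^sup>+t. f (- (r * cis t)) * indicator {0<..<pi} t \<partial>lborel) =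
      (\<integral>\<^sup>+t. f (r * cis t) * indicator {0<..<pi} t + f (r * cis t) * indicator {0<..<pi} (t - pi) \<partial>lborel)"
      by (simp add: nn_integral_add)
    also have "\<dots> = (\<integral>\<^sup>+t. indicator {0..2 * pi} t * f (r * cis t) \<partial>lborel)"
    proof (intro nn_integral_cong_AE AE_I')
      have "finite {0, pi, 2 * pi}" by simp
      then show "{0, pi, 2 * pi} \<in> null_sets lborel"
        by (rule finite_imp_null_set_lborel)
    qed (auto simp: indicator_def)
    finally have *: "(\<integral>\<^sup>+t. f (r * cis t) * indicator {0<..<pi} t \<partial>lborel) + (\<integral>\<^sup>+t. f (- (r * cis t)) * indicator {0<..<pi} t \<partial>lborel) =
       (\<integral>\<^sup>+t. indicator {0..2 * pi} t * f (r * cis t) \<partial>lborel)" .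
    have "(\<integral>\<^sup>+t. ennreal (indicator {0<..} r * r) * indicator {0..2 * pi} t * f (r * cis t) \<partial>lborel) =
      indicator {0<..} r * ennreal r * (\<integral>\<^sup>+t. indicator {0..2 * pi} t * f (r * cis t) \<partial>lborel)"
      by (subst nn_integral_cmult[symmetric]) (auto simp: mult.assoc indicator_def)
    then show "indicator {0<..} r * ennreal r * (\<integral>\<^sup>+t. f (r * cis t) * indicator {0<..<pi} t \<partial>lborel) +
      indicator {0<..} r * ennreal r * (\<integral>\<^sup>+t. f (- (r * cis t)) * indicator {0<..<pi} t \<partial>lborel) =
      (\<integral>\<^sup>+t. ennreal (indicator {0<..} r * r) * indicator {0..2 * pi} t * f (r * cis t) \<partial>lborel)"
      unfolding *[symmetric] by (simp add: distrib_left)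
  qed
  finally show ?thesis .
qed

text \<open>Applied to indicators, \<open>nn_integral_polar\<close> identifies \<open>lborel\<close>
  with the image of the measure r dr dt; complex integrands and their integrability then follow by
  transport of measures.\<close>

lemma integral_polar:
  fixes f :: "complex \<Rightarrow> complex"
  assumes f: "integrable lborel f"
  shows "integral\<^sup>L lborel f =
    (\<integral>r. \<integral>t. (indicator {0<..} r * r * indicator {0..2 * pi} t) *\<^sub>R f (r * cis t) \<partial>lborel \<partial>lborel)"
proof -
  let ?w = "\<lambda>(r, t). indicator {0<..} r * r * indicator {0..2 * pi} t :: real"
  let ?p = "\<lambda>(r, t). complex_of_real r * cis t"
  let ?D = "density (lborel \<Otimes>\<^sub>M lborel) (\<lambda>x. ennreal (?w x))"
  have [measurable]: "f \<in> borel_measurable borel"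
    using f by auto
  have [measurable]: "?w \<in> borel_measurable (borel \<Otimes>\<^sub>M borel)" "?p \<in> borel_measurable (borel \<Otimes>\<^sub>M borel)"
    by measurable
  have w0: "0 \<le> ?w x" for x
    by (auto simp: indicator_def split: prod.splits)
  have eq: "lborel = distr ?D borel ?p"
  proof (rule measure_eqI)
    fix A :: "complex set" assume "A \<in> sets lborel"
    then have [measurable]: "A \<in> sets borel" by simp
    have "emeasure lborel A = (\<integral>\<^sup>+z. indicator A z \<partial>lborel)"
      by simp
    also have "\<dots> = (\<integral>\<^sup>+r. \<integral>\<^sup>+t. ennreal (?w (r, t)) * indicator A (?p (r, t)) \<partial>lborel \<partial>lborel)"
      by (subst nn_integral_polar) (auto intro!: nn_integral_cong simp: indicator_def)
    also have "\<dots> = (\<integral>\<^sup>+x. ennreal (?w x) * indicator A (?p x) \<partial>(lborel \<Otimes>\<^sub>M lborel))"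
      by (subst lborel.nn_integral_fst[symmetric]) (auto simp: case_prod_beta)
    also have "\<dots> = (\<integral>\<^sup>+x. indicator A (?p x) \<partial>?D)"
      by (subst nn_integral_density) auto
    also have "\<dots> = (\<integral>\<^sup>+z. indicator A z \<partial>distr ?D borel ?p)"
      by (subst nn_integral_distr) auto
    also have "\<dots> = emeasure (distr ?D borel ?p) A"
      by simp
    finally show "emeasure lborel A = emeasure (distr ?D borel ?p) A" .
  qed simp
  have int: "integrable (lborel \<Otimes>\<^sub>M lborel) (\<lambda>x. ?w x *\<^sub>R f (?p x))"
    using f unfolding eq
    by (subst (asm) integrable_distr_eq, simp, simp, subst (asm) integrable_density) (use w0 in auto)
  have "integral\<^sup>L lborel f = integral\<^sup>L (distr ?D borel ?p) f"
    by (subst eq) simp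
  also have "\<dots> = (\<integral>x. ?w x *\<^sub>R f (?p x) \<partial>(lborel \<Otimes>\<^sub>M lborel))"
    by (subst integral_distr, simp, simp, subst integral_density) (use w0 in auto)
  also have "\<dots> = (\<integral>r. \<integral>t. ?w (r, t) *\<^sub>R f (?p (r, t)) \<partial>lborel \<partial>lborel)"
    using int by (subst lborel_pair.integral_fst'[symmetric]) auto
  finally show ?thesis
    by simp
qed

section \<open>Radial integrals of powers\<close>

lemma nn_integral_radial:
  fixes \<phi> :: "real \<Rightarrow> ennreal"
  assumes [measurable]: "\<phi> \<in> borel_measurable borel"
  shows "(\<integral>\<^sup>+z. \<phi> (cmod z) \<partial>lborel) = (\<integral>\<^sup>+r. ennreal (2 * pi * r) * \<phi> r * indicator {0<..} r \<partial>lborel)"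
proof -
  have "(\<integral>\<^sup>+t. ennreal (indicator {0<..} r * r) * indicator {0..2 * pi} t * \<phi> (cmod (r * cis t)) \<partial>lborel) =
    ennreal (2 * pi * r) * \<phi> r * indicator {0<..} r" for r :: real
  proof (cases "r > 0")
    case True
    have "(\<integral>\<^sup>+t. ennreal r * indicator {0..2 * pi} t * \<phi> r \<partial>lborel) =
      (\<integral>\<^sup>+t. (ennreal r * \<phi> r) * indicator {0..2 * pi} t \<partial>lborel)"
      by (simp add: mult_ac)
    also have "\<dots> = (ennreal r * \<phi> r) * ennreal (2 * pi)"
      by (subst nn_integral_cmult_indicator) simp_all
    finally show ?thesis
      using True by (simp add: norm_mult ennreal_mult mult_ac)
  qed simp
  then show ?thesis
    by (subst nn_integral_polar) simp_all
qed

lemma nn_integral_cmod_powr_cball: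
  assumes "\<alpha> < 2" "R \<ge> 0"
  shows "(\<integral>\<^sup>+z. ennreal (cmod z powr (- \<alpha>)) * indicator {..R} (cmod z) \<partial>lborel) =
    ennreal (2 * pi * (R powr (2 - \<alpha>) / (2 - \<alpha>)))"
proof -
  have "(\<integral>\<^sup>+z. ennreal (cmod z powr (- \<alpha>)) * indicator {..R} (cmod z) \<partial>lborel) =
    (\<integral>\<^sup>+r. ennreal (2 * pi * r) * (ennreal (r powr (- \<alpha>)) * indicator {..R} r) * indicator {0<..} r \<partial>lborel)"
    by (rule nn_integral_radial) measurable
  also have "\<dots> = (\<integral>\<^sup>+r. ennreal (2 * pi * r powr (1 - \<alpha>)) * indicator {0..R} r \<partial>lborel)"
  proof (rule nn_integral_cong)
    fix r :: real
    show "ennreal (2 * pi * r) * (ennreal (r powr (- \<alpha>)) * indicator {..R} r) * indicator {0<..} r =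
      ennreal (2 * pi * r powr (1 - \<alpha>)) * indicator {0..R} r"
    proof (cases "r > 0")
      case True
      then have "r powr (1 - \<alpha>) = r * r powr (- \<alpha>)"
        by (simp add: powr_diff powr_minus_divide)
      then show ?thesis
        using True by (simp add: indicator_def ennreal_mult[symmetric])
    qed (auto simp: indicator_def)
  qed
  also have "\<dots> = ennreal (2 * pi * (R powr (2 - \<alpha>) / (2 - \<alpha>)))"
    using has_integral_mult_right[OF has_integral_powr_from_0[of "1 - \<alpha>" R], of "2 * pi"] assms
    by (intro nn_integral_has_integral_lebesgue') simp_all
  finally show ?thesis .
qed

lemma nn_integral_cmod_powr_outside:
  assumes "\<beta> > 2" "R > 0"
  shows "(\<integral>\<^sup>+z. ennreal (cmod z powr (- \<beta>)) * indicator {R..} (cmod z) \<partial>lborel) =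
    ennreal (2 * pi * (R powr (2 - \<beta>) / (\<beta> - 2)))"
proof -
  have "(\<integral>\<^sup>+z. ennreal (cmod z powr (- \<beta>)) * indicator {R..} (cmod z) \<partial>lborel) =
    (\<integral>\<^sup>+r. ennreal (2 * pi * r) * (ennreal (r powr (- \<beta>)) * indicator {R..} r) * indicator {0<..} r \<partial>lborel)"
    by (rule nn_integral_radial) measurable
  also have "\<dots> = (\<integral>\<^sup>+r. ennreal (2 * pi * r powr (1 - \<beta>)) * indicator {R..} r \<partial>lborel)"
  proof (rule nn_integral_cong)
    fix r :: real
    show "ennreal (2 * pi * r) * (ennreal (r powr (- \<beta>)) * indicator {R..} r) * indicator {0<..} r =
      ennreal (2 * pi * r powr (1 - \<beta>)) * indicator {R..} r"
    proof (cases "r \<ge> R")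
      case True
      then have "r powr (1 - \<beta>) = r * r powr (- \<beta>)" "r > 0"
        using assms by (simp_all add: powr_diff powr_minus_divide)
      then show ?thesis
        using True by (simp add: indicator_def ennreal_mult[symmetric])
    qed (auto simp: indicator_def)
  qed
  also have "\<dots> = ennreal (2 * pi * (- (R powr (2 - \<beta>)) / (2 - \<beta>)))"
    using has_integral_mult_right[OF has_integral_powr_to_inf[of "1 - \<beta>" R], of "2 * pi"] assms
    by (intro nn_integral_has_integral_lebesgue') simp_all
  also have "- (R powr (2 - \<beta>)) / (2 - \<beta>) = R powr (2 - \<beta>) / (\<beta> - 2)"
    by (metis minus_diff_eq minus_divide_divide minus_minus)
  finally show ?thesis .
qed

lemma nn_integral_shift:
  fixes f :: "complex \<Rightarrow> ennreal"
  assumes [measurable]: "f \<in> borel_measurable borel"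
  shows "(\<integral>\<^sup>+u. f (u - q) \<partial>lborel) = (\<integral>\<^sup>+u. f u \<partial>lborel)"
  by (subst lborel_distr_plus[symmetric, of "- q"], subst nn_integral_distr) simp_all

section \<open>Convolutions of powers\<close>

text \<open>With h half the distance of p and q, the three summands come from the disc of radius h
  about q, the disc of radius h about p, and the rest of the plane; \<open>2 powr s\<close> converts
  \<open>h powr (- s)\<close> to the full distance.\<close>

definition conv_const :: "real \<Rightarrow> real" where
  "conv_const s = 2 * pi * 2 powr s * (1 / (1 - s) + 1 + 3 / s)"

lemma conv_const_nonneg: "0 < s \<Longrightarrow> s < 1 \<Longrightarrow> conv_const s \<ge> 0"
  by (simp add: conv_const_def)

lemma AE_lborel_finite: "finite (A :: 'a :: euclidean_space set) \<Longrightarrow> AE u in lborel. u \<notin> A"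
  by (rule AE_not_in) (rule finite_imp_null_set_lborel)

text \<open>The singularity at \<open>q\<close> is integrable because s < 1, and the decay of order
  2 + s at infinity suffices because s > 0. In each of the three regions one of the two factors is
  replaced by its value at the scale h or compared with the other.\<close>

lemma nn_integral_conv_powr:
  fixes p q :: complex
  assumes s: "0 < s" "s < 1" and pq: "p \<noteq> q"
  shows "(\<integral>\<^sup>+u. ennreal (cmod (u - q) powr (- 1 - s) / cmod (p - u)) \<partial>lborel) \<le>
     ennreal (conv_const s * cmod (p - q) powr (- s))"
proof -
  define h where "h = cmod (p - q) / 2"
  have h: "h > 0" using pq by (simp add: h_def)
  let ?A = "\<lambda>u. ennreal (1 / h) * (ennreal (cmod (u - q) powr (- (1 + s))) * indicator {..h} (cmod (u - q)))"
  let ?B = "\<lambda>u. ennreal (h powr (- 1 - s)) * (ennreal (cmod (u - p) powr (- 1)) * indicator {..h} (cmod (u - p)))"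
  let ?C = "\<lambda>u. ennreal 3 * (ennreal (cmod (u - q) powr (- (2 + s))) * indicator {h..} (cmod (u - q)))"
  have "(\<integral>\<^sup>+u. ennreal (cmod (u - q) powr (- 1 - s) / cmod (p - u)) \<partial>lborel) \<le>
    (\<integral>\<^sup>+u. ?A u + ?B u + ?C u \<partial>lborel)"
  proof (rule nn_integral_mono_AE)
    have "AE u in lborel. u \<notin> {p, q}"
      by (rule AE_lborel_finite) simp
    then show "AE u in lborel. ennreal (cmod (u - q) powr (- 1 - s) / cmod (p - u)) \<le> ?A u + ?B u + ?C u"
    proof eventually_elim
      fix u assume u: "u \<notin> {p, q}"
      define a b where "a = cmod (u - q)" and "b = cmod (u - p)"
      have ab: "a > 0" "b > 0" using u by (auto simp: a_def b_def)
      have tri: "2 * h \<le> a + b" "a \<le> b + 2 * h"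
        unfolding a_def b_def h_def by norm+
      consider "a \<le> h" | "a > h" "b \<le> h" | "a > h" "b > h" by linarith
      then have "ennreal (a powr (- 1 - s) / b) \<le>
        ennreal (1 / h) * (ennreal (a powr (- (1 + s))) * indicator {..h} a) +
        ennreal (h powr (- 1 - s)) * (ennreal (b powr (- 1)) * indicator {..h} b) +
        ennreal 3 * (ennreal (a powr (- (2 + s))) * indicator {h..} a)"
      proof cases
        case 1
        have "a powr (- 1 - s) / b \<le> a powr (- 1 - s) / h"
          using 1 tri h ab by (intro divide_left_mono) auto
        then have "ennreal (a powr (- 1 - s) / b) \<le> ennreal (1 / h) * (ennreal (a powr (- (1 + s))) * indicator {..h} a)"
          using 1 h by (simp add: ennreal_mult[symmetric] ennreal_leI)
        then show ?thesis
          by (rule order.trans) simp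
      next
        case 2
        have "a powr (- 1 - s) / b \<le> h powr (- 1 - s) / b"
          using 2 h ab s by (intro divide_right_mono powr_mono2') auto
        then have "ennreal (a powr (- 1 - s) / b) \<le> ennreal (h powr (- 1 - s)) * (ennreal (b powr (- 1)) * indicator {..h} b)"
          using 2 h ab by (simp add: ennreal_mult[symmetric] ennreal_leI powr_minus_divide)
        then show ?thesis
          by (rule order.trans) simp
      next
        case 3
        have "a * a powr (-2 - s) = a powr (- 1 - s)"
          using ab powr_add[of a 1 "-2 - s"] by simp
        \<comment> \<open>Away from both points the distances are comparable: a is at most b + 2 h,
          and h < b, which gives the constant 3.\<close>
        moreover have "a * a powr (-2 - s) \<le> 3 * b * a powr (-2 - s)"
          using 3 tri by (intro mult_right_mono) auto
        ultimately have "a powr (- 1 - s) / b \<le> 3 * a powr (- (2 + s))"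
        proof -
          assume *: "a * a powr (-2 - s) = a powr (- 1 - s)" "a * a powr (-2 - s) \<le> 3 * b * a powr (-2 - s)"
          have e: "- (2 + s) = -2 - s" by simp
          have "a powr (- 1 - s) \<le> 3 * a powr (-2 - s) * b"
            using * by (simp only: mult_ac)
          then show ?thesis
            unfolding e pos_divide_le_eq[OF ab(2)] .
        qed
        then have "ennreal (a powr (- 1 - s) / b) \<le> ennreal 3 * (ennreal (a powr (- (2 + s))) * indicator {h..} a)"
          using 3 by (simp add: ennreal_mult[symmetric] ennreal_leI del: ennreal_numeral)
        then show ?thesis
          by (rule order.trans) simp
      qed
      then show "ennreal (cmod (u - q) powr (- 1 - s) / cmod (p - u)) \<le> ?A u + ?B u + ?C u"
        unfolding a_def b_def by (simp add: norm_minus_commute)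
    qed
  qed
  also have "\<dots> = (\<integral>\<^sup>+u. ?A u \<partial>lborel) + (\<integral>\<^sup>+u. ?B u \<partial>lborel) + (\<integral>\<^sup>+u. ?C u \<partial>lborel)"
    by (subst nn_integral_add, measurable, subst nn_integral_add) measurable
  also have "(\<integral>\<^sup>+u. ?A u \<partial>lborel) = ennreal (1 / h) * ennreal (2 * pi * (h powr (1 - s) / (1 - s)))"
    using nn_integral_shift[of "\<lambda>u. ennreal (cmod u powr (- (1 + s))) * indicator {..h} (cmod u)" q]
      nn_integral_cmod_powr_cball[of "1 + s" h] s h
    by (subst nn_integral_cmult) simp_all
  also have "\<dots> = ennreal (2 * pi * h powr (- s) * (1 / (1 - s)))"
    using s h by (simp add: ennreal_mult[symmetric] powr_diff powr_minus_divide)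
  also have "(\<integral>\<^sup>+u. ?B u \<partial>lborel) = ennreal (h powr (- 1 - s)) * ennreal (2 * pi * h)"
    using nn_integral_shift[of "\<lambda>u. ennreal (cmod u powr (- 1)) * indicator {..h} (cmod u)" p]
      nn_integral_cmod_powr_cball[of 1 h] s h
    by (subst nn_integral_cmult) simp_all
  also have "\<dots> = ennreal (2 * pi * h powr (- s))"
    using h powr_add[of h 1 "- 1 - s"] by (simp add: ennreal_mult[symmetric] mult_ac)
  also have "(\<integral>\<^sup>+u. ?C u \<partial>lborel) = ennreal 3 * ennreal (2 * pi * (h powr (- s) / s))"
    using nn_integral_shift[of "\<lambda>u. ennreal (cmod u powr (- (2 + s))) * indicator {h..} (cmod u)" q]
      nn_integral_cmod_powr_outside[of "2 + s" h] s h
    by (subst nn_integral_cmult) simp_all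
  also have "\<dots> = ennreal (2 * pi * h powr (- s) * (3 / s))"
    using s h by (simp add: ennreal_mult[symmetric] del: ennreal_numeral)
  also have "ennreal (2 * pi * h powr (- s) * (1 / (1 - s))) + ennreal (2 * pi * h powr (- s)) + ennreal (2 * pi * h powr (- s) * (3 / s)) =
    ennreal (conv_const s * cmod (p - q) powr (- s))"
  proof -
    have "h powr (- s) = 2 powr s * cmod (p - q) powr (- s)"
      using pq unfolding h_def by (simp add: powr_divide powr_minus_divide)
    then have "conv_const s * cmod (p - q) powr (- s) =
      2 * pi * h powr (- s) * (1 / (1 - s)) + 2 * pi * h powr (- s) + 2 * pi * h powr (- s) * (3 / s)"
      by (simp add: conv_const_def algebra_simps)
    then show ?thesis
      using s by (simp add: ennreal_plus[symmetric] del: ennreal_plus)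
  qed
  finally show ?thesis .
qed

text \<open>The larger of the two distances is at least d / 2. It absorbs the excess of the total
  exponent over \<open>\<gamma>\<close> and leaves a single power of the smaller one. So a product
  of two poles becomes a sum of weaker poles.\<close>

lemma powr_interpolation:
  fixes a b d \<alpha> \<beta> \<gamma> :: real
  assumes "a > 0" "b > 0" "0 < d" "d \<le> a + b" "\<alpha> \<le> \<gamma>" "\<beta> \<le> \<gamma>" "\<gamma> \<le> \<alpha> + \<beta>"
  shows "a powr (- \<alpha>) * b powr (- \<beta>) \<le> (d / 2) powr (\<gamma> - \<alpha> - \<beta>) * (a powr (- \<gamma>) + b powr (- \<gamma>))"
proof -
  have *: "a powr (- \<alpha>) * b powr (- \<beta>) \<le> (d / 2) powr (\<gamma> - \<alpha> - \<beta>) * a powr (- \<gamma>)"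
    if "a > 0" "a \<le> b" "d \<le> a + b" "\<alpha> \<le> \<gamma>" "\<beta> \<le> \<gamma>" "\<gamma> \<le> \<alpha> + \<beta>" for a b \<alpha> \<beta> :: real
  proof -
    have "a powr (- \<alpha>) * b powr (- \<beta>) = a powr (- \<gamma>) * (a powr (\<gamma> - \<alpha>) * b powr (- \<beta>))"
      using that by (simp add: powr_add[symmetric] mult.assoc[symmetric])
    also have "\<dots> \<le> a powr (- \<gamma>) * (b powr (\<gamma> - \<alpha>) * b powr (- \<beta>))"
      using that by (intro mult_left_mono mult_right_mono powr_mono2) auto
    also have "b powr (\<gamma> - \<alpha>) * b powr (- \<beta>) = b powr (\<gamma> - \<alpha> - \<beta>)"
      by (simp add: powr_add[symmetric])
    also have "a powr (- \<gamma>) * b powr (\<gamma> - \<alpha> - \<beta>) \<le> a powr (- \<gamma>) * (d / 2) powr (\<gamma> - \<alpha> - \<beta>)"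
      using that assms(3) by (intro mult_left_mono powr_mono2') auto
    finally show ?thesis by (simp add: mult.commute)
  qed
  have "(d / 2) powr (\<gamma> - \<alpha> - \<beta>) \<ge> 0" "a powr (- \<gamma>) \<ge> 0" "b powr (- \<gamma>) \<ge> 0"
    by simp_all
  then have nn: "(d / 2) powr (\<gamma> - \<alpha> - \<beta>) * a powr (- \<gamma>) \<ge> 0" "(d / 2) powr (\<gamma> - \<alpha> - \<beta>) * b powr (- \<gamma>) \<ge> 0"
    by simp_all
  show ?thesis
  proof (cases "a \<le> b")
    case True
    then have "a powr (- \<alpha>) * b powr (- \<beta>) \<le> (d / 2) powr (\<gamma> - \<alpha> - \<beta>) * a powr (- \<gamma>)"
      using assms by (intro *) auto
    then show ?thesis
      unfolding distrib_left using nn by linarith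
  next
    case False
    then have "b powr (- \<beta>) * a powr (- \<alpha>) \<le> (d / 2) powr (\<gamma> - \<beta> - \<alpha>) * b powr (- \<gamma>)"
      using assms by (intro *) auto
    moreover have "\<gamma> - \<beta> - \<alpha> = \<gamma> - \<alpha> - \<beta>"
      by simp
    ultimately show ?thesis
      unfolding distrib_left using nn by (simp only: mult.commute[of "b powr _"])
  qed
qed

section \<open>The logarithmic integral\<close>

lemma circle_integral:
  assumes r: "r > 0" "cmod a \<noteq> r"
  shows "((\<lambda>t. r * cis t / (r * cis t - a)) has_integral (if cmod a < r then 2 * pi else 0)) {0..2 * pi}"
proof -
  have "((\<lambda>u. 1 / (u - a)) has_contour_integral (if cmod a < r then 2 * pi * \<i> else 0)) (circlepath 0 r)"
  proof (cases "cmod a < r")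
    case True
    then show ?thesis
      using Cauchy_integral_circlepath_simple[of "\<lambda>_. 1" 0 r a] by simp
  next
    case False
    have "((\<lambda>u. 1 / (u - a)) has_contour_integral 0) (circlepath 0 r)"
    proof (rule Cauchy_theorem_disc_simple[of _ 0 "cmod a"])
      show "(\<lambda>u. 1 / (u - a)) holomorphic_on ball 0 (cmod a)"
        by (intro holomorphic_intros) auto
      show "path_image (circlepath 0 r) \<subseteq> ball 0 (cmod a)"
        using False r by auto
    qed auto
    then show ?thesis
      using False by simp
  qed
  then have "((\<lambda>t. 1 / (0 + r * cis t - a) * r * \<i> * cis t) has_integral (if cmod a < r then 2 * pi * \<i> else 0)) {0..2 * pi}"
    unfolding circlepath_def by (subst (asm) has_contour_integral_part_circlepath_iff) simp_all
  \<comment> \<open>Along the circle du is \<open>\<i>\<close> u dt, so the contour integral is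
    \<open>\<i>\<close> times the integral over the angle.\<close>
  from has_integral_mult_right[OF this, of "- \<i>"] show ?thesis
    by (simp add: mult_ac split: if_splits)
qed

lemma integral_circle:
  assumes r: "r > 0" "cmod a \<noteq> r"
  shows "(\<integral>t. indicator {0..2 * pi} t *\<^sub>R (r * cis t / (r * cis t - a)) \<partial>lborel) = (if cmod a < r then 2 * pi else 0)"
    and "integrable lborel (\<lambda>t. indicator {0..2 * pi} t *\<^sub>R (r * cis t / (r * cis t - a)))"
proof -
  have ne: "r * cis t - a \<noteq> 0" for t
  proof
    assume "r * cis t - a = 0"
    then have "a = r * cis t" by simp
    then show False using r by (simp add: norm_mult)
  qed
  have int: "set_integrable lborel {0..2 * pi} (\<lambda>t. r * cis t / (r * cis t - a))"
    by (intro borel_integrable_atLeastAtMost' continuous_intros) (use ne in auto)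
  then show "integrable lborel (\<lambda>t. indicator {0..2 * pi} t *\<^sub>R (r * cis t / (r * cis t - a)))"
    by (simp add: set_integrable_def)
  show "(\<integral>t. indicator {0..2 * pi} t *\<^sub>R (r * cis t / (r * cis t - a)) \<partial>lborel) = (if cmod a < r then 2 * pi else 0)"
    using set_borel_integral_eq_integral(2)[OF int] integral_unique[OF circle_integral[OF r]]
    by (simp add: set_lebesgue_integral_def)
qed

text \<open>The difference of the indicators is, up to sign, the indicator of the interval between a
  and b in either order. The antiderivative vanishes at a.\<close>

lemma integral_log_power:
  assumes "0 < a" "0 < b"
  shows "(\<integral>r. (indicator {a<..} r - indicator {b<..} r) * (ln (a / r) ^ k / r) \<partial>lborel) =
    - (ln (a / b) ^ Suc k / real (Suc k))"
proof -
  define F where "F = (\<lambda>r. - (ln (a / r) ^ Suc k / real (Suc k)))"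
  have F: "(\<integral>r. ln (a / r) ^ k / r * indicator {x..y} r \<partial>lborel) = F y - F x" if "0 < x" "x \<le> y" for x y
  proof (rule integral_FTC_Icc_real[OF that(2)])
    fix r assume r: "x \<le> r" "r \<le> y"
    show "DERIV F r :> ln (a / r) ^ k / r"
    proof -
      have D: "DERIV (\<lambda>r. ln (a / r)) r :> - 1 / r"
        using r that assms by (auto intro!: derivative_eq_intros simp: field_simps)
      have gen: "- ((1 + real k) * (- 1 / r * X) / real (Suc k)) = X / r" for X
      proof -
        have "1 + real k \<noteq> 0"
          by linarith
        then have "(1 + real k) * Y / (1 + real k) = Y" for Y
          by (rule nonzero_mult_div_cancel_left)
        then show ?thesis
          by (simp only: of_nat_Suc) simp
      qed
      show ?thesis
        using DERIV_minus[OF DERIV_cdivide[OF DERIV_power_Suc[OF D, of k], of "real (Suc k)"]]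
        unfolding gen F_def .
    qed
    show "isCont (\<lambda>r. ln (a / r) ^ k / r) r"
      using r that assms by (intro continuous_intros) auto
  qed
  have Fa: "F a = 0"
    using assms by (simp add: F_def)
  show ?thesis
  proof (cases "a \<le> b")
    case True
    have "(\<integral>r. (indicator {a<..} r - indicator {b<..} r) * (ln (a / r) ^ k / r) \<partial>lborel) =
      (\<integral>r. ln (a / r) ^ k / r * indicator {a..b} r \<partial>lborel)"
      by (intro integral_cong_AE eventually_mono[OF AE_lborel_finite[of "{a, b}"]])
        (use True in \<open>auto simp: indicator_def\<close>)
    then show ?thesis
      using F[OF assms(1) True] Fa by (simp add: F_def)
  next
    case False
    have "(\<integral>r. (indicator {a<..} r - indicator {b<..} r) * (ln (a / r) ^ k / r) \<partial>lborel) =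
      (\<integral>r. - (ln (a / r) ^ k / r * indicator {b..a} r) \<partial>lborel)"
      by (intro integral_cong_AE eventually_mono[OF AE_lborel_finite[of "{a, b}"]])
        (use False in \<open>auto simp: indicator_def\<close>)
    then show ?thesis
      using F[OF assms(2), of a] False Fa by (simp add: F_def)
  qed
qed

text \<open>The logarithm is radial and leaves the angular integral. Partial fractions split the
  rest into two Cauchy integrals whose difference survives only for radii between \<open>|v|\<close>
  and \<open>|w|\<close>; there the radial integral raises the power of the logarithm.\<close>

lemma integral_log_step:
  fixes v w :: complex and k :: nat
  defines "f \<equiv> \<lambda>u. of_real (ln (cmod w / cmod u) ^ k) / ((v - u) * (u - w) * cnj u)"
  assumes "v \<noteq> 0" "w \<noteq> 0" "v \<noteq> w" and int: "integrable lborel f"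
  shows "integral\<^sup>L lborel f = - (2 * pi / real (Suc k) * ln (cmod w / cmod v) ^ Suc k) / (v - w)"
proof -
  let ?c = "\<lambda>r a. if cmod a < r then 2 * pi else 0 :: real"
  have inner: "(\<integral>t. (indicator {0<..} r * r * indicator {0..2 * pi} t) *\<^sub>R f (r * cis t) \<partial>lborel) =
    2 * pi / (v - w) * of_real ((indicator {cmod w<..} r - indicator {cmod v<..} r) * (ln (cmod w / r) ^ k / r))"
    if r: "r \<notin> {cmod v, cmod w}" for r
  proof (cases "r > 0")
    case True
    have r': "cmod v \<noteq> r" "cmod w \<noteq> r" using r by auto
    let ?l = "of_real (ln (cmod w / r) ^ k / r) / (v - w)"
    have pt: "r *\<^sub>R f (r * cis t) = ?l * (r * cis t / (r * cis t - w) - r * cis t / (r * cis t - v))" for t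
    proof -
      define u where "u = r * cis t"
      have nu: "cmod u = r" using True by (simp add: u_def norm_mult)
      have ne: "u \<noteq> v" "u \<noteq> w" "u \<noteq> 0" using nu r' True by auto
      \<comment> \<open>On the circle of radius r the antiholomorphic pole turns into the
        holomorphic factor u, up to powers of r.\<close>
      have "u * cnj u = of_real r * of_real r"
        using complex_norm_square[of u] nu by (simp add: power2_eq_square)
      then have cu: "of_real r / cnj u = u / of_real r"
        using ne True by (simp add: field_simps)
      have pf: "1 / ((v - u) * (u - w)) = (1 / (u - w) - 1 / (u - v)) / (v - w)"
        using ne assms by (simp add: divide_simps) (simp add: algebra_simps)
      have "r *\<^sub>R f u = of_real (ln (cmod w / r) ^ k) * (1 / ((v - u) * (u - w))) * (of_real r / cnj u)"
        by (simp add: f_def nu scaleR_conv_of_real)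
      also have "\<dots> = ?l * (u / (u - w) - u / (u - v))"
        unfolding pf cu by (simp add: right_diff_distrib diff_divide_distrib mult_ac)
      finally show ?thesis
        unfolding u_def .
    qed
    have "(\<integral>t. (indicator {0<..} r * r * indicator {0..2 * pi} t) *\<^sub>R f (r * cis t) \<partial>lborel) =
      (\<integral>t. ?l * (indicator {0..2 * pi} t *\<^sub>R (r * cis t / (r * cis t - w)) - indicator {0..2 * pi} t *\<^sub>R (r * cis t / (r * cis t - v))) \<partial>lborel)"
    proof (rule Bochner_Integration.integral_cong[OF refl])
      fix t
      have "(indicator {0<..} r * r * indicator {0..2 * pi} t) *\<^sub>R f (r * cis t) = indicator {0..2 * pi} t *\<^sub>R (r *\<^sub>R f (r * cis t))"
        using True by simp
      also have "\<dots> = ?l * (indicator {0..2 * pi} t *\<^sub>R (r * cis t / (r * cis t - w)) - indicator {0..2 * pi} t *\<^sub>R (r * cis t / (r * cis t - v)))"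
        unfolding pt unfolding scaleR_conv_of_real right_diff_distrib by (simp only: mult_ac)
      finally show "(indicator {0<..} r * r * indicator {0..2 * pi} t) *\<^sub>R f (r * cis t) =
        ?l * (indicator {0..2 * pi} t *\<^sub>R (r * cis t / (r * cis t - w)) - indicator {0..2 * pi} t *\<^sub>R (r * cis t / (r * cis t - v)))" .
    qed
    also have "\<dots> = ?l * (of_real (?c r w) - of_real (?c r v))"
      by (simp only: integral_mult_right_zero integral_circle(1)[OF True r'(1)] integral_circle(1)[OF True r'(2)]
          Bochner_Integration.integral_diff[OF integral_circle(2)[OF True r'(2)] integral_circle(2)[OF True r'(1)]])
    also have "\<dots> = 2 * pi / (v - w) * of_real ((indicator {cmod w<..} r - indicator {cmod v<..} r) * (ln (cmod w / r) ^ k / r))"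
      by (auto simp: indicator_def mult_ac)
    finally show ?thesis .
  next
    case False
    have "\<not> cmod v < r" "\<not> cmod w < r"
      using False norm_ge_zero[of v] norm_ge_zero[of w] by linarith+
    then show ?thesis
      using False by simp
  qed
  have "integral\<^sup>L lborel f = (\<integral>r. \<integral>t. (indicator {0<..} r * r * indicator {0..2 * pi} t) *\<^sub>R f (r * cis t) \<partial>lborel \<partial>lborel)"
    by (rule integral_polar[OF int])
  also have "\<dots> = (\<integral>r. 2 * pi / (v - w) * of_real ((indicator {cmod w<..} r - indicator {cmod v<..} r) * (ln (cmod w / r) ^ k / r)) \<partial>lborel)"
  proof (rule integral_cong_AE)
    have [measurable]: "f \<in> borel_measurable borel"
      using int by auto
    show "(\<lambda>r. \<integral>t. (indicator {0<..} r * r * indicator {0..2 * pi} t) *\<^sub>R f (r * cis t) \<partial>lborel) \<in> borel_measurable lborel"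
      by measurable
    show "AE r in lborel. (\<integral>t. (indicator {0<..} r * r * indicator {0..2 * pi} t) *\<^sub>R f (r * cis t) \<partial>lborel) =
      2 * pi / (v - w) * of_real ((indicator {cmod w<..} r - indicator {cmod v<..} r) * (ln (cmod w / r) ^ k / r))"
      by (rule eventually_mono[OF AE_lborel_finite[of "{cmod v, cmod w}"]]) (use inner in auto)
  qed measurable
  also have "\<dots> = 2 * pi / (v - w) * of_real (\<integral>r. (indicator {cmod w<..} r - indicator {cmod v<..} r) * (ln (cmod w / r) ^ k / r) \<partial>lborel)"
    by (simp only: integral_mult_right_zero integral_complex_of_real)
  also have "\<dots> = - (2 * pi / real (Suc k) * ln (cmod w / cmod v) ^ Suc k) / (v - w)"
    using assms by (subst integral_log_power) (simp_all del: power_Suc)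
  finally show ?thesis .
qed

section \<open>Chain integrals\<close>

fun chain_integral :: "complex \<Rightarrow> complex \<Rightarrow> complex list \<Rightarrow> complex" where
  "chain_integral w p [] = 1 / (p - w)"
| "chain_integral w p (\<zeta> # \<zeta>s) =
     (\<integral>u. 1 / ((p - u) * (cnj u - cnj \<zeta>)) * chain_integral w u \<zeta>s \<partial>lborel)"

text \<open>The iterated integral of absolute values. Being valued in \<open>ennreal\<close>, it
  makes sense before convergence is known.\<close>

fun chain_norm :: "complex \<Rightarrow> complex \<Rightarrow> complex list \<Rightarrow> ennreal" where
  "chain_norm w p [] = ennreal (1 / cmod (p - w))"
| "chain_norm w p (\<zeta> # \<zeta>s) =
     (\<integral>\<^sup>+u. ennreal (1 / cmod (p - u)) * (ennreal (1 / cmod (u - \<zeta>)) * chain_norm w u \<zeta>s) \<partial>lborel)"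

lemma measurable_chain_integral [measurable]: "(\<lambda>p. chain_integral w p \<zeta>s) \<in> borel_measurable borel"
  by (induction \<zeta>s) simp_all

lemma measurable_chain_norm [measurable]: "(\<lambda>p. chain_norm w p \<zeta>s) \<in> borel_measurable borel"
  by (induction \<zeta>s) simp_all

lemma norm_kernel:
  "cmod (1 / ((p - u) * (cnj u - cnj \<zeta>)) * c) = 1 / cmod (p - u) * (1 / cmod (u - \<zeta>) * cmod c)"
proof -
  have "cmod (cnj u - cnj \<zeta>) = cmod (u - \<zeta>)"
    by (metis complex_cnj_diff complex_mod_cnj)
  then show ?thesis
    by (simp add: norm_mult norm_divide)
qed

lemma norm_kernel_le:
  assumes "ennreal (cmod c) \<le> N"
  shows "ennreal (cmod (1 / ((p - u) * (cnj u - cnj \<zeta>)) * c)) \<le>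
    ennreal (1 / cmod (p - u)) * (ennreal (1 / cmod (u - \<zeta>)) * N)"
proof -
  have "ennreal (cmod (1 / ((p - u) * (cnj u - cnj \<zeta>)) * c)) =
    ennreal (1 / cmod (p - u)) * (ennreal (1 / cmod (u - \<zeta>)) * ennreal (cmod c))"
    unfolding norm_kernel by (subst ennreal_mult, simp, simp, subst ennreal_mult) simp_all
  also have "\<dots> \<le> ennreal (1 / cmod (p - u)) * (ennreal (1 / cmod (u - \<zeta>)) * N)"
    by (intro mult_left_mono assms) simp_all
  finally show ?thesis .
qed

text \<open>A function that is not integrable has integral 0, so the bound is unconditional, and so
  is \<open>chain_integral_le_norm\<close>.\<close>

lemma norm_integral_le_nn:
  fixes f :: "complex \<Rightarrow> complex"
  shows "ennreal (cmod (integral\<^sup>L M f)) \<le> (\<integral>\<^sup>+u. ennreal (cmod (f u)) \<partial>M)"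
  by (cases "integrable M f") (simp_all add: integral_norm_bound_ennreal not_integrable_integral_eq)

lemma chain_integral_le_norm: "ennreal (cmod (chain_integral w p \<zeta>s)) \<le> chain_norm w p \<zeta>s"
proof (induction \<zeta>s arbitrary: p)
  case Nil
  then show ?case by (simp add: norm_divide)
next
  case (Cons \<zeta> \<zeta>s)
  have "ennreal (cmod (chain_integral w p (\<zeta> # \<zeta>s))) \<le>
    (\<integral>\<^sup>+u. ennreal (cmod (1 / ((p - u) * (cnj u - cnj \<zeta>)) * chain_integral w u \<zeta>s)) \<partial>lborel)"
    unfolding chain_integral.simps by (rule norm_integral_le_nn)
  also have "\<dots> \<le> chain_norm w p (\<zeta> # \<zeta>s)"
    unfolding chain_norm.simps by (intro nn_integral_mono norm_kernel_le Cons)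
  finally show ?case .
qed

lemma integrable_chain:
  assumes "chain_norm w p (\<zeta> # \<zeta>s) < \<infinity>"
  shows "integrable lborel (\<lambda>u. 1 / ((p - u) * (cnj u - cnj \<zeta>)) * chain_integral w u \<zeta>s)"
proof (rule integrableI_bounded)
  have "(\<integral>\<^sup>+u. ennreal (cmod (1 / ((p - u) * (cnj u - cnj \<zeta>)) * chain_integral w u \<zeta>s)) \<partial>lborel)
    \<le> chain_norm w p (\<zeta> # \<zeta>s)"
    unfolding chain_norm.simps by (intro nn_integral_mono norm_kernel_le chain_integral_le_norm)
  then show "(\<integral>\<^sup>+u. ennreal (cmod (1 / ((p - u) * (cnj u - cnj \<zeta>)) * chain_integral w u \<zeta>s)) \<partial>lborel) < \<infinity>"
    using assms by (rule order.strict_trans1)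
qed measurable

section \<open>Uniform convergence of chain integrals\<close>

text \<open>The class of majorants: up to constants it is stable under one more integration, which
  takes exponent 1 + s to s, and under multiplication by a pole in \<open>Q\<close>, which adds
  exponents.\<close>

definition powr_sum :: "real \<Rightarrow> complex set \<Rightarrow> complex \<Rightarrow> real" where
  "powr_sum s Q p = (\<Sum>q\<in>Q. cmod (p - q) powr (- s))"

lemma powr_sum_nonneg [simp]: "powr_sum s Q p \<ge> 0"
  by (simp add: powr_sum_def sum_nonneg)

lemma powr_sum_ge: "finite Q \<Longrightarrow> q \<in> Q \<Longrightarrow> cmod (p - q) powr (- s) \<le> powr_sum s Q p"
  unfolding powr_sum_def by (rule member_le_sum) auto

lemma nn_integral_powr_sum:
  assumes s: "0 < s" "s < 1" and Q: "finite Q" "p \<notin> Q" and c: "c \<ge> 0"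
    and G: "\<And>u. u \<notin> Q \<Longrightarrow> G u \<le> ennreal (c * powr_sum (1 + s) Q u)"
  shows "(\<integral>\<^sup>+u. ennreal (1 / cmod (p - u)) * G u \<partial>lborel) \<le> ennreal (c * conv_const s * powr_sum s Q p)"
proof -
  have "(\<integral>\<^sup>+u. ennreal (1 / cmod (p - u)) * G u \<partial>lborel) \<le>
    (\<integral>\<^sup>+u. ennreal c * (\<Sum>q\<in>Q. ennreal (cmod (u - q) powr (- 1 - s) / cmod (p - u))) \<partial>lborel)"
  proof (rule nn_integral_mono_AE)
    show "AE u in lborel. ennreal (1 / cmod (p - u)) * G u \<le>
      ennreal c * (\<Sum>q\<in>Q. ennreal (cmod (u - q) powr (- 1 - s) / cmod (p - u)))"
      using AE_lborel_finite[OF Q(1)]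
    proof eventually_elim
      case (elim u)
      have "ennreal (1 / cmod (p - u)) * G u \<le> ennreal (1 / cmod (p - u)) * ennreal (c * powr_sum (1 + s) Q u)"
        by (intro mult_left_mono G elim) simp
      also have "\<dots> = ennreal (c * (\<Sum>q\<in>Q. cmod (u - q) powr (- 1 - s) / cmod (p - u)))"
        using c by (subst ennreal_mult[symmetric])
          (simp_all add: powr_sum_def sum_nonneg sum_divide_distrib[symmetric] algebra_simps)
      also have "\<dots> = ennreal c * (\<Sum>q\<in>Q. ennreal (cmod (u - q) powr (- 1 - s) / cmod (p - u)))"
        using c by (subst ennreal_mult) (simp_all add: sum_nonneg)
      finally show ?case .
    qed
  qed
  also have "\<dots> = ennreal c * (\<Sum>q\<in>Q. \<integral>\<^sup>+u. ennreal (cmod (u - q) powr (- 1 - s) / cmod (p - u)) \<partial>lborel)"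
    by (subst nn_integral_cmult, measurable, subst nn_integral_sum) measurable
  also have "\<dots> \<le> ennreal c * (\<Sum>q\<in>Q. ennreal (conv_const s * cmod (p - q) powr (- s)))"
    by (intro mult_left_mono sum_mono nn_integral_conv_powr s) (use Q in auto)
  also have "\<dots> = ennreal (c * conv_const s * powr_sum s Q p)"
    using conv_const_nonneg[OF s] c
    by (simp add: powr_sum_def ennreal_mult[symmetric] sum_nonneg sum_distrib_left mult.assoc)
  finally show ?thesis .
qed

text \<open>Interpolation with \<open>\<gamma>\<close> equal to \<open>\<alpha> + \<beta>\<close>:
  the power of d has exponent 0, so poles of \<open>Q\<close> may coincide or come arbitrarily close
  at no cost.\<close>

lemma powr_mult_powr_sum_le:
  assumes Q: "finite Q" "card Q \<le> M" "\<zeta> \<in> Q" "u \<notin> Q" and ab: "0 \<le> \<alpha>" "0 \<le> \<beta>"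
  shows "cmod (u - \<zeta>) powr (- \<alpha>) * powr_sum \<beta> Q u \<le> (real M + 1) * powr_sum (\<alpha> + \<beta>) Q u"
proof -
  have "cmod (u - \<zeta>) powr (- \<alpha>) * powr_sum \<beta> Q u = (\<Sum>q\<in>Q. cmod (u - \<zeta>) powr (- \<alpha>) * cmod (u - q) powr (- \<beta>))"
    by (simp add: powr_sum_def sum_distrib_left)
  also have "\<dots> \<le> (\<Sum>q\<in>Q. powr_sum (\<alpha> + \<beta>) Q u + cmod (u - q) powr (- (\<alpha> + \<beta>)))"
  proof (rule sum_mono)
    fix q assume q: "q \<in> Q"
    have pos: "cmod (u - \<zeta>) > 0" "cmod (u - q) > 0"
      using Q q by auto
    have "cmod (u - \<zeta>) powr (- \<alpha>) * cmod (u - q) powr (- \<beta>) \<le>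
      cmod (u - \<zeta>) powr (- (\<alpha> + \<beta>)) + cmod (u - q) powr (- (\<alpha> + \<beta>))"
      using powr_interpolation[OF pos, of "cmod (u - \<zeta>) + cmod (u - q)" \<alpha> "\<alpha> + \<beta>" \<beta>] pos ab
      by (simp add: add_pos_pos)
    also have "cmod (u - \<zeta>) powr (- (\<alpha> + \<beta>)) \<le> powr_sum (\<alpha> + \<beta>) Q u"
      by (rule powr_sum_ge) (use Q in auto)
    finally show "cmod (u - \<zeta>) powr (- \<alpha>) * cmod (u - q) powr (- \<beta>) \<le> powr_sum (\<alpha> + \<beta>) Q u + cmod (u - q) powr (- (\<alpha> + \<beta>))"
      by simp
  qed
  also have "\<dots> = (real (card Q) + 1) * powr_sum (\<alpha> + \<beta>) Q u"
    unfolding sum.distrib by (simp add: powr_sum_def algebra_simps)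
  also have "\<dots> \<le> (real M + 1) * powr_sum (\<alpha> + \<beta>) Q u"
    using Q by (intro mult_right_mono) auto
  finally show ?thesis .
qed

text \<open>What the constants may depend on: the number of poles and their distance from
  \<open>w\<close>. Nothing is asked about the distances among the poles \<open>\<zeta>s\<close>,
  which are going to collapse.\<close>

definition admissible :: "nat \<Rightarrow> real \<Rightarrow> complex \<Rightarrow> complex set \<Rightarrow> complex list \<Rightarrow> bool" where
  "admissible M d w Q \<zeta>s \<longleftrightarrow> finite Q \<and> card Q \<le> M \<and> w \<in> Q \<and> set \<zeta>s \<subseteq> Q \<and> (\<forall>\<zeta>\<in>set \<zeta>s. d \<le> cmod (\<zeta> - w))"

text \<open>
  Exponent \<open>1\<close> bounds one more integration; exponent \<open>5/4\<close> arises when the pole at \<open>\<zeta>\<close> is moved.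
\<close>
lemma chain_norm_mult_bound:
  assumes d: "d > 0" and al: "\<alpha> = 1 \<or> \<alpha> = 5/4"
  shows "\<exists>c\<ge>0. \<forall>Q \<zeta> \<zeta>s u. length \<zeta>s = k \<longrightarrow> admissible M d w Q (\<zeta> # \<zeta>s) \<longrightarrow> u \<notin> Q \<longrightarrow>
     ennreal (cmod (u - \<zeta>) powr (- \<alpha>)) * chain_norm w u \<zeta>s \<le> ennreal (c * powr_sum (\<alpha> + 1/4) Q u)"
  using al
proof (induction k arbitrary: \<alpha>)
  case 0
  \<comment> \<open>The total exponent \<open>\<alpha> + 1\<close> is lowered to
    \<open>\<alpha> + 1/4\<close> by means of the distance d from \<open>\<zeta>\<close> to
    \<open>w\<close>; the factor 2 counts the two resulting powers.\<close>
  let ?c = "2 * (d / 2) powr (- 3/4)"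
  show ?case
  proof (intro exI[of _ ?c] conjI allI impI)
    fix Q \<zeta> \<zeta>s u
    assume l: "length \<zeta>s = 0" and ad: "admissible M d w Q (\<zeta> # \<zeta>s)" and u: "u \<notin> Q"
    have pos: "cmod (u - \<zeta>) > 0" "cmod (u - w) > 0"
      using ad u by (auto simp: admissible_def)
    have "d \<le> cmod (\<zeta> - w)"
      using ad by (simp add: admissible_def)
    also have "\<dots> \<le> cmod (u - \<zeta>) + cmod (u - w)"
      by norm
    finally have "cmod (u - \<zeta>) powr (- \<alpha>) * cmod (u - w) powr (- 1) \<le>
      (d / 2) powr (- 3/4) * (cmod (u - \<zeta>) powr (- (\<alpha> + 1/4)) + cmod (u - w) powr (- (\<alpha> + 1/4)))"
      using powr_interpolation[OF pos d, of \<alpha> "\<alpha> + 1/4" 1] 0 by auto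
    also have "\<dots> \<le> (d / 2) powr (- 3/4) * (powr_sum (\<alpha> + 1/4) Q u + powr_sum (\<alpha> + 1/4) Q u)"
      using ad by (intro mult_left_mono add_mono powr_sum_ge) (auto simp: admissible_def)
    finally have "cmod (u - \<zeta>) powr (- \<alpha>) * (1 / cmod (u - w)) \<le> ?c * powr_sum (\<alpha> + 1/4) Q u"
      using pos by (simp add: powr_minus_divide)
    then show "ennreal (cmod (u - \<zeta>) powr (- \<alpha>)) * chain_norm w u \<zeta>s \<le> ennreal (?c * powr_sum (\<alpha> + 1/4) Q u)"
      using l by (simp add: ennreal_mult[symmetric] ennreal_leI)
  qed simp
next
  case (Suc k)
  \<comment> \<open>Only the outermost pole carries the exponent \<open>\<alpha>\<close>; the next
    pole is a genuine factor of the kernel, hence the hypothesis at exponent 1.\<close>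
  obtain c where c: "c \<ge> 0" and IH: "\<And>Q \<zeta> \<zeta>s u. length \<zeta>s = k \<Longrightarrow> admissible M d w Q (\<zeta> # \<zeta>s) \<Longrightarrow> u \<notin> Q \<Longrightarrow>
     ennreal (cmod (u - \<zeta>) powr (- 1)) * chain_norm w u \<zeta>s \<le> ennreal (c * powr_sum (1 + 1/4) Q u)"
    using Suc.IH[of 1] by blast
  let ?c = "c * conv_const (1/4) * (real M + 1)"
  have K: "conv_const (1/4) \<ge> 0"
    by (rule conv_const_nonneg) auto
  show ?case
  proof (intro exI[of _ ?c] conjI allI impI)
    fix Q \<zeta> \<zeta>s u
    assume l: "length \<zeta>s = Suc k" and ad: "admissible M d w Q (\<zeta> # \<zeta>s)" and u: "u \<notin> Q"
    obtain \<zeta>' \<zeta>s' where \<zeta>s: "\<zeta>s = \<zeta>' # \<zeta>s'" "length \<zeta>s' = k"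
      using l by (cases \<zeta>s) auto
    have Q: "finite Q" "card Q \<le> M" "\<zeta> \<in> Q"
      using ad by (auto simp: admissible_def)
    have "chain_norm w u \<zeta>s \<le> ennreal (c * conv_const (1/4) * powr_sum (1/4) Q u)"
      unfolding \<zeta>s chain_norm.simps
    proof (rule nn_integral_powr_sum)
      fix v assume v: "v \<notin> Q"
      then have "v \<noteq> \<zeta>'"
        using ad \<zeta>s by (auto simp: admissible_def)
      then show "ennreal (1 / cmod (v - \<zeta>')) * chain_norm w v \<zeta>s' \<le> ennreal (c * powr_sum (1 + 1/4) Q v)"
        using IH[of \<zeta>s' Q \<zeta>' v] ad \<zeta>s v by (simp add: admissible_def powr_minus_divide)
    qed (use Q u c in auto)
    then have "ennreal (cmod (u - \<zeta>) powr (- \<alpha>)) * chain_norm w u \<zeta>s \<le>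
      ennreal (cmod (u - \<zeta>) powr (- \<alpha>)) * ennreal (c * conv_const (1/4) * powr_sum (1/4) Q u)"
      by (intro mult_left_mono) auto
    also have "\<dots> = ennreal (c * conv_const (1/4) * (cmod (u - \<zeta>) powr (- \<alpha>) * powr_sum (1/4) Q u))"
      using c K by (simp add: ennreal_mult[symmetric] mult_ac)
    also have "\<dots> \<le> ennreal (c * conv_const (1/4) * ((real M + 1) * powr_sum (\<alpha> + 1/4) Q u))"
      using c K Suc.prems
      by (intro ennreal_leI mult_left_mono powr_mult_powr_sum_le Q u) auto
    finally show "ennreal (cmod (u - \<zeta>) powr (- \<alpha>)) * chain_norm w u \<zeta>s \<le> ennreal (?c * powr_sum (\<alpha> + 1/4) Q u)"
      by (simp add: mult_ac)
  qed (use c K in simp)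
qed

lemma chain_norm_finite:
  assumes "d > 0" "admissible M d w Q \<zeta>s" "p \<notin> Q"
  shows "chain_norm w p \<zeta>s < \<infinity>"
proof (cases \<zeta>s)
  case (Cons \<zeta> \<zeta>s')
  obtain c where c: "c \<ge> 0" and le: "\<And>Q \<zeta> \<zeta>s u. length \<zeta>s = length \<zeta>s' \<Longrightarrow> admissible M d w Q (\<zeta> # \<zeta>s) \<Longrightarrow> u \<notin> Q \<Longrightarrow>
     ennreal (cmod (u - \<zeta>) powr (- 1)) * chain_norm w u \<zeta>s \<le> ennreal (c * powr_sum (1 + 1/4) Q u)"
    using chain_norm_mult_bound[OF assms(1), of 1 "length \<zeta>s'" M w] by blast
  have "chain_norm w p \<zeta>s \<le> ennreal (c * conv_const (1/4) * powr_sum (1/4) Q p)"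
    unfolding Cons chain_norm.simps
  proof (rule nn_integral_powr_sum)
    fix v assume v: "v \<notin> Q"
    then have "v \<noteq> \<zeta>"
      using assms Cons by (auto simp: admissible_def)
    then show "ennreal (1 / cmod (v - \<zeta>)) * chain_norm w v \<zeta>s' \<le> ennreal (c * powr_sum (1 + 1/4) Q v)"
      using le[of \<zeta>s' Q \<zeta> v] assms Cons v by (simp add: powr_minus_divide)
  qed (use assms c in \<open>auto simp: admissible_def\<close>)
  then show ?thesis
    by (rule order.strict_trans1) simp
qed simp

section \<open>Collapsing the poles\<close>

text \<open>The difference is \<open>|\<zeta> - z|\<close> times two simple poles. Lowering their
  total exponent from 2 to 5/4 costs the power - 3/4 of \<open>|\<zeta> - z|\<close>, so a power of
  1/4 remains.\<close>

lemma pole_difference: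
  assumes "u \<noteq> \<zeta>" "u \<noteq> z" "cmod (\<zeta> - z) \<le> \<epsilon>" "\<epsilon> > 0"
  shows "cmod (1 / (cnj u - cnj \<zeta>) - 1 / (cnj u - cnj z)) \<le>
    2 * \<epsilon> powr (1/4) * (cmod (u - \<zeta>) powr (- (5/4)) + cmod (u - z) powr (- (5/4)))"
proof (cases "\<zeta> = z")
  case False
  have ne: "cnj u - cnj \<zeta> \<noteq> 0" "cnj u - cnj z \<noteq> 0"
    using assms by auto
  have pos: "cmod (u - \<zeta>) > 0" "cmod (u - z) > 0" "cmod (\<zeta> - z) > 0"
    using assms False by auto
  have "1 / (cnj u - cnj \<zeta>) - 1 / (cnj u - cnj z) = cnj (\<zeta> - z) / (cnj (u - \<zeta>) * cnj (u - z))"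
    using ne by (simp add: field_simps)
  then have "cmod (1 / (cnj u - cnj \<zeta>) - 1 / (cnj u - cnj z)) =
    cmod (\<zeta> - z) * (cmod (u - \<zeta>) powr (- 1) * cmod (u - z) powr (- 1))"
    using pos by (simp only: norm_divide norm_mult complex_mod_cnj) (simp add: powr_minus_divide)
  also have "\<dots> \<le> cmod (\<zeta> - z) * ((cmod (\<zeta> - z) / 2) powr (- (3/4)) *
     (cmod (u - \<zeta>) powr (- (5/4)) + cmod (u - z) powr (- (5/4))))"
  proof (intro mult_left_mono)
    have "cmod (\<zeta> - z) \<le> cmod (u - \<zeta>) + cmod (u - z)"
      by norm
    then show "cmod (u - \<zeta>) powr (- 1) * cmod (u - z) powr (- 1) \<le> (cmod (\<zeta> - z) / 2) powr (- (3/4)) *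
     (cmod (u - \<zeta>) powr (- (5/4)) + cmod (u - z) powr (- (5/4)))"
      using powr_interpolation[OF pos, of 1 "5/4" 1] by simp
  qed simp
  also have "\<dots> \<le> 2 * \<epsilon> powr (1/4) * (cmod (u - \<zeta>) powr (- (5/4)) + cmod (u - z) powr (- (5/4)))"
  proof -
    have "cmod (\<zeta> - z) * (cmod (\<zeta> - z) / 2) powr (- (3/4)) = 2 * ((cmod (\<zeta> - z) / 2) powr 1 * (cmod (\<zeta> - z) / 2) powr (- (3/4)))"
      using pos by simp
    also have "\<dots> = 2 * (cmod (\<zeta> - z) / 2) powr (1/4)"
      by (simp only: powr_add[symmetric]) simp
    also have "\<dots> \<le> 2 * \<epsilon> powr (1/4)"
    proof (intro mult_left_mono powr_mono2)
      show "cmod (\<zeta> - z) / 2 \<le> \<epsilon>"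
        using assms by linarith
    qed auto
    finally show ?thesis
      unfolding mult.assoc[symmetric] by (intro mult_right_mono) auto
  qed
  finally show ?thesis .
qed simp

text \<open>Telescoping: either the tail of the chain changes, which is the induction hypothesis
  times a pole, or the first pole moves, which is \<open>pole_difference\<close> times the tail.
  Both have exponent 3/2, and the integration returns 1/2.\<close>

lemma chain_integral_difference:
  assumes d: "d > 0"
  shows "\<exists>c\<ge>0. \<forall>Q \<zeta>s p \<epsilon>. length \<zeta>s = k \<longrightarrow> admissible M d w Q (z # \<zeta>s) \<longrightarrow> p \<notin> Q \<longrightarrow> \<epsilon> > 0 \<longrightarrow>
     (\<forall>\<zeta>\<in>set \<zeta>s. cmod (\<zeta> - z) \<le> \<epsilon>) \<longrightarrow>
     cmod (chain_integral w p \<zeta>s - chain_integral w p (replicate k z)) \<le> c * \<epsilon> powr (1/4) * powr_sum (1/2) Q p"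
proof (induction k)
  case 0
  show ?case
    by (intro exI[of _ 0]) auto
next
  case (Suc k)
  obtain c where c: "c \<ge> 0" and IH: "\<And>Q \<zeta>s p \<epsilon>. length \<zeta>s = k \<Longrightarrow> admissible M d w Q (z # \<zeta>s) \<Longrightarrow> p \<notin> Q \<Longrightarrow> \<epsilon> > 0 \<Longrightarrow>
     (\<forall>\<zeta>\<in>set \<zeta>s. cmod (\<zeta> - z) \<le> \<epsilon>) \<Longrightarrow>
     cmod (chain_integral w p \<zeta>s - chain_integral w p (replicate k z)) \<le> c * \<epsilon> powr (1/4) * powr_sum (1/2) Q p"
    using Suc.IH by blast
  obtain c' where c': "c' \<ge> 0" and N: "\<And>Q \<zeta> \<zeta>s u. length \<zeta>s = k \<Longrightarrow> admissible M d w Q (\<zeta> # \<zeta>s) \<Longrightarrow> u \<notin> Q \<Longrightarrow>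
     ennreal (cmod (u - \<zeta>) powr (- (5/4))) * chain_norm w u \<zeta>s \<le> ennreal (c' * powr_sum (5/4 + 1/4) Q u)"
    using chain_norm_mult_bound[OF d, of "5/4" k M w] by blast
  \<comment> \<open>The first part is the change of the tail; in the second, a factor 2 is that of
    \<open>pole_difference\<close> and another counts its two powers.\<close>
  let ?b = "c * (real M + 1) + 4 * c'"
  have K: "conv_const (1/2) \<ge> 0"
    by (rule conv_const_nonneg) auto
  show ?case
  proof (intro exI[of _ "?b * conv_const (1/2)"] conjI allI impI)
    fix Q \<zeta>s0 p \<epsilon>
    assume l: "length \<zeta>s0 = Suc k" and ad: "admissible M d w Q (z # \<zeta>s0)" and p: "p \<notin> Q" and \<epsilon>: "\<epsilon> > 0"
      and close0: "\<forall>\<zeta>\<in>set \<zeta>s0. cmod (\<zeta> - z) \<le> \<epsilon>"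
    obtain \<zeta> \<zeta>s where \<zeta>s: "\<zeta>s0 = \<zeta> # \<zeta>s" "length \<zeta>s = k"
      using l by (cases \<zeta>s0) auto
    let ?zs = "replicate k z"
    have Q: "finite Q" "card Q \<le> M" "\<zeta> \<in> Q" "z \<in> Q"
      using ad \<zeta>s by (auto simp: admissible_def)
    have ad1: "admissible M d w Q (\<zeta> # \<zeta>s)" "admissible M d w Q (z # \<zeta>s)"
      "admissible M d w Q (z # ?zs)" "admissible M d w Q (\<zeta> # ?zs)"
      using ad \<zeta>s by (auto simp: admissible_def)
    let ?f = "\<lambda>\<zeta> \<zeta>s u. 1 / ((p - u) * (cnj u - cnj \<zeta>)) * chain_integral w u \<zeta>s"
    have int: "integrable lborel (?f \<zeta> \<zeta>s)" "integrable lborel (?f z ?zs)"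
      by (rule integrable_chain, rule chain_norm_finite[OF d ad1(1) p])
        (rule integrable_chain, rule chain_norm_finite[OF d ad1(3) p])
    let ?G = "\<lambda>u. ennreal (cmod (u - \<zeta>) powr (- 1) * cmod (chain_integral w u \<zeta>s - chain_integral w u ?zs)
       + cmod (1 / (cnj u - cnj \<zeta>) - 1 / (cnj u - cnj z)) * cmod (chain_integral w u ?zs))"
    have "ennreal (cmod (chain_integral w p \<zeta>s0 - chain_integral w p (replicate (Suc k) z))) =
      ennreal (cmod (\<integral>u. ?f \<zeta> \<zeta>s u - ?f z ?zs u \<partial>lborel))"
      unfolding \<zeta>s(1) replicate_Suc chain_integral.simps by (subst Bochner_Integration.integral_diff[OF int]) simp
    also have "\<dots> \<le> (\<integral>\<^sup>+u. ennreal (cmod (?f \<zeta> \<zeta>s u - ?f z ?zs u)) \<partial>lborel)"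
      by (rule norm_integral_le_nn)
    also have "\<dots> \<le> (\<integral>\<^sup>+u. ennreal (1 / cmod (p - u)) * ?G u \<partial>lborel)"
    proof (rule nn_integral_mono_AE, rule eventually_mono[OF AE_lborel_finite[OF Q(1)]])
      fix u assume u: "u \<notin> Q"
      have "?f \<zeta> \<zeta>s u - ?f z ?zs u = 1 / (p - u) * (1 / (cnj u - cnj \<zeta>) * (chain_integral w u \<zeta>s - chain_integral w u ?zs)
         + (1 / (cnj u - cnj \<zeta>) - 1 / (cnj u - cnj z)) * chain_integral w u ?zs)"
        by (simp add: algebra_simps diff_divide_distrib)
      also have "cmod \<dots> \<le> 1 / cmod (p - u) * (cmod (1 / (cnj u - cnj \<zeta>) * (chain_integral w u \<zeta>s - chain_integral w u ?zs))
         + cmod ((1 / (cnj u - cnj \<zeta>) - 1 / (cnj u - cnj z)) * chain_integral w u ?zs))"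
        unfolding norm_mult[of "1 / (p - u)"] norm_divide[of 1 "p - u"] norm_one
        by (intro mult_left_mono norm_triangle_ineq) simp
      also have "cmod (1 / (cnj u - cnj \<zeta>) * (chain_integral w u \<zeta>s - chain_integral w u ?zs)) =
        cmod (u - \<zeta>) powr (- 1) * cmod (chain_integral w u \<zeta>s - chain_integral w u ?zs)"
        using u Q unfolding complex_cnj_diff[symmetric] norm_mult norm_divide complex_mod_cnj
        by (auto simp: powr_minus_divide)
      finally show "ennreal (cmod (?f \<zeta> \<zeta>s u - ?f z ?zs u)) \<le> ennreal (1 / cmod (p - u)) * ?G u"
        by (subst ennreal_mult[symmetric]) (auto simp: norm_mult intro!: ennreal_leI)
    qed
    also have "\<dots> \<le> ennreal (?b * \<epsilon> powr (1/4) * conv_const (1/2) * powr_sum (1/2) Q p)"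
    proof (rule nn_integral_powr_sum)
      fix u assume u: "u \<notin> Q"
      then have ne: "u \<noteq> \<zeta>" "u \<noteq> z" using Q by auto
      have "cmod (u - \<zeta>) powr (- 1) * cmod (chain_integral w u \<zeta>s - chain_integral w u ?zs) \<le>
        cmod (u - \<zeta>) powr (- 1) * (c * \<epsilon> powr (1/4) * powr_sum (1/2) Q u)"
        by (intro mult_left_mono IH) (use \<zeta>s ad1 u \<epsilon> close0 in auto)
      also have "\<dots> = c * \<epsilon> powr (1/4) * (cmod (u - \<zeta>) powr (- 1) * powr_sum (1/2) Q u)"
        by simp
      also have "\<dots> \<le> c * \<epsilon> powr (1/4) * ((real M + 1) * powr_sum (1 + 1/2) Q u)"
        using c by (intro mult_left_mono powr_mult_powr_sum_le Q u) auto
      finally have 1: "cmod (u - \<zeta>) powr (- 1) * cmod (chain_integral w u \<zeta>s - chain_integral w u ?zs) \<le>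
        c * (real M + 1) * \<epsilon> powr (1/4) * powr_sum (1 + 1/2) Q u"
        by (simp only: mult_ac)
      have N': "cmod (u - q) powr (- (5/4)) * cmod (chain_integral w u ?zs) \<le> c' * powr_sum (1 + 1/2) Q u"
        if "admissible M d w Q (q # ?zs)" for q
      proof -
        have "ennreal (cmod (u - q) powr (- (5/4)) * cmod (chain_integral w u ?zs)) \<le>
          ennreal (cmod (u - q) powr (- (5/4))) * chain_norm w u ?zs"
          by (subst ennreal_mult) (auto intro!: mult_left_mono chain_integral_le_norm)
        also have "\<dots> \<le> ennreal (c' * powr_sum (5/4 + 1/4) Q u)"
          by (rule N) (use that u in auto)
        also have "5/4 + 1/4 = 1 + (1/2 :: real)"
          by simp
        finally show ?thesis
          using c' by (subst (asm) ennreal_le_iff) auto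
      qed
      have "cmod (1 / (cnj u - cnj \<zeta>) - 1 / (cnj u - cnj z)) * cmod (chain_integral w u ?zs) \<le>
        2 * \<epsilon> powr (1/4) * (cmod (u - \<zeta>) powr (- (5/4)) + cmod (u - z) powr (- (5/4))) * cmod (chain_integral w u ?zs)"
        by (intro mult_right_mono pole_difference) (use ne \<epsilon> close0 \<zeta>s in auto)
      also have "\<dots> = 2 * \<epsilon> powr (1/4) * (cmod (u - \<zeta>) powr (- (5/4)) * cmod (chain_integral w u ?zs)
        + cmod (u - z) powr (- (5/4)) * cmod (chain_integral w u ?zs))"
        by (simp only: distrib_right mult.assoc)
      also have "\<dots> \<le> 2 * \<epsilon> powr (1/4) * (c' * powr_sum (1 + 1/2) Q u + c' * powr_sum (1 + 1/2) Q u)"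
        by (intro mult_left_mono add_mono N' ad1) simp
      finally have 2: "cmod (1 / (cnj u - cnj \<zeta>) - 1 / (cnj u - cnj z)) * cmod (chain_integral w u ?zs) \<le>
         4 * c' * \<epsilon> powr (1/4) * powr_sum (1 + 1/2) Q u"
        by (simp add: mult_ac)
      show "?G u \<le> ennreal (?b * \<epsilon> powr (1/4) * powr_sum (1 + 1/2) Q u)"
        using add_mono[OF 1 2] by (intro ennreal_leI) (simp only: distrib_right)
    qed (use Q p c c' in auto)
    finally show "cmod (chain_integral w p \<zeta>s0 - chain_integral w p (replicate (Suc k) z)) \<le>
      ?b * conv_const (1/2) * \<epsilon> powr (1/4) * powr_sum (1/2) Q p"
      using c c' K by (subst (asm) ennreal_le_iff) (auto simp: mult_ac)
  qed (use c c' K in simp)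
qed

section \<open>The collapsed chain\<close>

lemma integral_shift:
  fixes f :: "complex \<Rightarrow> complex"
  assumes "f \<in> borel_measurable borel"
  shows "(\<integral>u. f u \<partial>lborel) = (\<integral>u. f (u + q) \<partial>lborel)"
    and "integrable lborel f \<Longrightarrow> integrable lborel (\<lambda>u. f (u + q))"
proof -
  have "integral\<^sup>L lborel f = integral\<^sup>L (distr lborel borel ((+) q)) f"
    by (simp add: lborel_distr_plus)
  also have "\<dots> = (\<integral>u. f (u + q) \<partial>lborel)"
    using assms by (subst integral_distr) (auto simp: add.commute)
  finally show "(\<integral>u. f u \<partial>lborel) = (\<integral>u. f (u + q) \<partial>lborel)" .
  assume "integrable lborel f"
  then have "integrable (distr lborel borel ((+) q)) f"
    by (simp add: lborel_distr_plus)
  then show "integrable lborel (\<lambda>u. f (u + q))"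
    using assms by (subst (asm) integrable_distr_eq) (auto simp: add.commute)
qed

text \<open>With \<open>z\<close> moved to the origin, the formula for the shorter chain turns the
  integrand into that of \<open>integral_log_step\<close>. Each integration contributes - 2 pi over
  the new power of the logarithm, which builds up the factorial.\<close>

lemma chain_integral_collapsed:
  fixes z w p :: complex
  assumes "z \<noteq> w" "p \<noteq> z" "p \<noteq> w"
  shows "chain_integral w p (replicate k z) =
    (- 2 * pi) ^ k / fact k * of_real (ln (cmod (z - w) / cmod (z - p)) ^ k) / (p - w)"
  using assms(2,3)
proof (induction k arbitrary: p)
  case (Suc k)
  let ?f = "\<lambda>u. 1 / ((p - u) * (cnj u - cnj z)) * chain_integral w u (replicate k z)"
  let ?C = "(- 2 * pi) ^ k / fact k :: complex"
  let ?g = "\<lambda>u. of_real (ln (cmod (w - z) / cmod u) ^ k) / ((p - z - u) * (u - (w - z)) * cnj u)"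
  have ad: "admissible 2 (cmod (z - w)) w {w, z} (replicate (Suc k) z)"
    by (auto simp: admissible_def card_insert_if)
  have "chain_norm w p (replicate (Suc k) z) < \<infinity>"
    by (rule chain_norm_finite[OF _ ad]) (use assms(1) Suc.prems in auto)
  then have int: "integrable lborel ?f"
    unfolding replicate_Suc by (rule integrable_chain)
  have AE: "AE u in lborel. ?f (u + z) = ?C * ?g u"
  proof (rule eventually_mono[OF AE_lborel_finite[of "{0, w - z}"]])
    fix u assume u: "u \<notin> {0, w - z}"
    then have ne: "u + z \<noteq> z" "u + z \<noteq> w"
      by (auto simp: algebra_simps)
    show "?f (u + z) = ?C * ?g u"
      unfolding Suc.IH[OF ne]
      by (simp add: norm_minus_commute[of z w] algebra_simps)
  qed simp
  have [measurable]: "?g \<in> borel_measurable borel"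
    by measurable
  have "integrable lborel (\<lambda>u. ?f (u + z))"
    using int by (intro integral_shift(2)) auto
  then have "integrable lborel (\<lambda>u. ?C * ?g u)"
    by (subst (asm) integrable_cong_AE[OF _ _ AE]) simp_all
  then have "integrable lborel (\<lambda>u. inverse ?C * (?C * ?g u))"
    by (rule integrable_mult_right)
  moreover have "inverse ?C * (?C * x) = x" for x
    unfolding mult.assoc[symmetric] by (subst left_inverse) simp_all
  ultimately have intg: "integrable lborel ?g"
    by (simp only:)
  have "chain_integral w p (replicate (Suc k) z) = (\<integral>u. ?f (u + z) \<partial>lborel)"
    unfolding replicate_Suc chain_integral.simps by (rule integral_shift(1)) measurable
  also have "\<dots> = (\<integral>u. ?C * ?g u \<partial>lborel)"
    by (rule integral_cong_AE[OF _ _ AE]) simp_all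
  also have "\<dots> = ?C * (\<integral>u. ?g u \<partial>lborel)"
    by (rule integral_mult_right_zero)
  also have "(\<integral>u. ?g u \<partial>lborel) = - (2 * pi / real (Suc k) * ln (cmod (w - z) / cmod (p - z)) ^ Suc k) / (p - z - (w - z))"
    by (rule integral_log_step[OF _ _ _ intg]) (use assms Suc.prems in auto)
  also have "?C * \<dots> = (- 2 * pi) ^ Suc k / fact (Suc k) * of_real (ln (cmod (z - w) / cmod (z - p)) ^ Suc k) / (p - w)"
    by (simp add: norm_minus_commute[of w z] norm_minus_commute[of p z] field_simps)
  finally show ?case .
qed simp

section \<open>Integration over the positions of the vertices\<close>

lemma measurable_chain_kernel:
  assumes "f \<in> borel_measurable M" "\<And>j. j \<in> set js \<Longrightarrow> (\<lambda>x. g x j) \<in> borel_measurable M"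
  shows "(\<lambda>x. chain_kernel w (f x) (zip (map (g x) js) \<zeta>s)) \<in> borel_measurable M"
  using assms
proof (induction js arbitrary: f \<zeta>s)
  case (Cons j js)
  note [measurable] = Cons.prems(1)
  have [measurable]: "(\<lambda>x. g x j) \<in> borel_measurable M"
    using Cons.prems by simp
  have [measurable]: "(\<lambda>x. chain_kernel w (g x j) (zip (map (g x) js) \<zeta>s')) \<in> borel_measurable M" for \<zeta>s'
    using Cons.prems by (intro Cons.IH) auto
  show ?case
    by (cases \<zeta>s) simp_all
qed simp

interpretation vertices: product_sigma_finite "\<lambda>_ :: nat. lborel :: complex measure"
  by standard

lemma map_fun_upd_other: "j \<notin> set js \<Longrightarrow> map (x(j := y)) js = map x js"
  by (induction js) auto

lemma nn_integral_chain_kernel: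
  fixes js :: "nat list"
  assumes "distinct js" "length js = length \<zeta>s"
  shows "(\<integral>\<^sup>+u. ennreal (cmod (chain_kernel w p (zip (map u js) \<zeta>s))) \<partial>(\<Pi>\<^sub>M i\<in>set js. lborel)) = chain_norm w p \<zeta>s"
  using assms
proof (induction js arbitrary: p \<zeta>s)
  case Nil
  then show ?case
    by (simp add: PiM_empty nn_integral_count_space_finite norm_divide)
next
  case (Cons j js)
  then obtain \<zeta> \<zeta>s' where \<zeta>s: "\<zeta>s = \<zeta> # \<zeta>s'" "length js = length \<zeta>s'"
    by (cases \<zeta>s) auto
  have [measurable]: "(\<lambda>u. chain_kernel w p (zip (map u (j # js)) \<zeta>s)) \<in> borel_measurable (\<Pi>\<^sub>M i\<in>insert j (set js). lborel)"
    by (rule measurable_chain_kernel) auto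
  have [measurable]: "(\<lambda>u. chain_kernel w y (zip (map u js) \<zeta>s')) \<in> borel_measurable (\<Pi>\<^sub>M i\<in>set js. lborel)" for y
    by (rule measurable_chain_kernel) auto
  have "(\<integral>\<^sup>+u. ennreal (cmod (chain_kernel w p (zip (map u (j # js)) \<zeta>s))) \<partial>(\<Pi>\<^sub>M i\<in>insert j (set js). lborel)) =
    (\<integral>\<^sup>+y. \<integral>\<^sup>+x. ennreal (cmod (chain_kernel w p (zip (map (x(j := y)) (j # js)) \<zeta>s))) \<partial>(\<Pi>\<^sub>M i\<in>set js. lborel) \<partial>lborel)"
    by (rule vertices.product_nn_integral_insert_rev) (use Cons.prems in simp, use Cons.prems in simp, measurable)
  also have "\<dots> = (\<integral>\<^sup>+y. \<integral>\<^sup>+x. ennreal (1 / cmod (p - y) * (1 / cmod (y - \<zeta>))) *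
       ennreal (cmod (chain_kernel w y (zip (map x js) \<zeta>s'))) \<partial>(\<Pi>\<^sub>M i\<in>set js. lborel) \<partial>lborel)"
    using Cons.prems unfolding \<zeta>s list.map(2) zip_Cons_Cons chain_kernel.simps norm_kernel
    by (intro nn_integral_cong, subst ennreal_mult[symmetric])
      (simp_all add: map_fun_upd_other mult.assoc del: fun_upd_apply, simp_all)
  also have "\<dots> = (\<integral>\<^sup>+y. ennreal (1 / cmod (p - y) * (1 / cmod (y - \<zeta>))) * chain_norm w y \<zeta>s' \<partial>lborel)"
    using Cons.IH[OF _ \<zeta>s(2)] Cons.prems by (subst nn_integral_cmult) simp_all
  also have "\<dots> = chain_norm w p \<zeta>s"
    unfolding \<zeta>s chain_norm.simps
    by (intro nn_integral_cong, subst ennreal_mult) (simp_all add: mult.assoc)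
  finally show ?case
    by simp
qed

lemma integrable_chain_kernel:
  fixes js :: "nat list"
  assumes "distinct js" "length js = length \<zeta>s" "chain_norm w p \<zeta>s < \<infinity>"
  shows "integrable (\<Pi>\<^sub>M i\<in>set js. lborel) (\<lambda>u. chain_kernel w p (zip (map u js) \<zeta>s))"
proof (rule integrableI_bounded)
  show "(\<lambda>u. chain_kernel w p (zip (map u js) \<zeta>s)) \<in> borel_measurable (\<Pi>\<^sub>M i\<in>set js. lborel)"
    by (rule measurable_chain_kernel) auto
  show "(\<integral>\<^sup>+u. ennreal (cmod (chain_kernel w p (zip (map u js) \<zeta>s))) \<partial>(\<Pi>\<^sub>M i\<in>set js. lborel)) < \<infinity>"
    using assms by (simp only: nn_integral_chain_kernel)
qed

text \<open>Fubini, peeling off the vertex nearest to \<open>p\<close>. The inner integrals may fail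
  to converge at exceptional positions of that vertex, so the induction hypothesis is used only
  almost everywhere.\<close>

lemma integral_chain_kernel:
  fixes js :: "nat list"
  assumes "distinct js" "length js = length \<zeta>s" "chain_norm w p \<zeta>s < \<infinity>"
  shows "(\<integral>u. chain_kernel w p (zip (map u js) \<zeta>s) \<partial>(\<Pi>\<^sub>M i\<in>set js. lborel)) = chain_integral w p \<zeta>s"
  using assms
proof (induction js arbitrary: p \<zeta>s)
  case Nil
  then show ?case
    by (simp add: PiM_empty lebesgue_integral_count_space_finite)
next
  case (Cons j js)
  then obtain \<zeta> \<zeta>s' where \<zeta>s: "\<zeta>s = \<zeta> # \<zeta>s'" "length js = length \<zeta>s'"
    by (cases \<zeta>s) auto
  let ?J = "\<Pi>\<^sub>M i\<in>set js. (lborel :: complex measure)"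
  let ?I = "\<lambda>y. \<integral>x. chain_kernel w y (zip (map x js) \<zeta>s') \<partial>?J"
  interpret J: sigma_finite_measure ?J
    by (rule vertices.sigma_finite) simp
  have [measurable]: "(\<lambda>(y, x). chain_kernel w y (zip (map x js) \<zeta>s')) \<in> borel_measurable (lborel \<Otimes>\<^sub>M ?J)"
    unfolding case_prod_beta by (rule measurable_chain_kernel) measurable
  have [measurable]: "?I \<in> borel_measurable borel"
    using J.borel_measurable_lebesgue_integral[of "\<lambda>y x. chain_kernel w y (zip (map x js) \<zeta>s')" lborel] by simp
  have "chain_norm w p (\<zeta> # \<zeta>s') < \<infinity>"
    using Cons.prems \<zeta>s by simp
  \<comment> \<open>A finite integral has an almost everywhere finite integrand. Off
    \<open>p\<close> and \<open>\<zeta>\<close> the prefactor is not 0, so finiteness passes to the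
    inner norm.\<close>
  then have "AE y in lborel. ennreal (1 / cmod (p - y)) * (ennreal (1 / cmod (y - \<zeta>)) * chain_norm w y \<zeta>s') \<noteq> \<infinity>"
    unfolding chain_norm.simps by (intro nn_integral_PInf_AE) auto
  then have fin: "AE y in lborel. chain_norm w y \<zeta>s' < \<infinity>"
    using AE_lborel_finite[of "{p, \<zeta>}", OF finite.insertI[OF finite.insertI[OF finite.emptyI]]]
  proof eventually_elim
    case (elim y)
    show ?case
    proof (rule ccontr)
      assume "\<not> chain_norm w y \<zeta>s' < \<infinity>"
      then have "chain_norm w y \<zeta>s' = \<infinity>"
        by (metis infinity_ennreal_def less_top)
      then show False
        using elim by (auto simp: ennreal_mult_eq_top_iff)
    qed
  qed
  have "(\<integral>u. chain_kernel w p (zip (map u (j # js)) \<zeta>s) \<partial>(\<Pi>\<^sub>M i\<in>{j} \<union> set js. lborel)) =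
    (\<integral>x. \<integral>y. chain_kernel w p (zip (map (merge {j} (set js) (x, y)) (j # js)) \<zeta>s) \<partial>?J \<partial>(\<Pi>\<^sub>M i\<in>{j}. lborel))"
    using integrable_chain_kernel[OF Cons.prems] Cons.prems(1)
    by (intro vertices.product_integral_fold) simp_all
  also have "\<dots> = (\<integral>x. 1 / ((p - x j) * (cnj (x j) - cnj \<zeta>)) * ?I (x j) \<partial>(\<Pi>\<^sub>M i\<in>{j}. lborel))"
  proof (rule Bochner_Integration.integral_cong[OF refl])
    fix x :: "nat \<Rightarrow> complex"
    have rest: "map (merge {j} (set js) (x, y)) js = map y js" for y
      using Cons.prems(1) by (auto simp: merge_def)
    have first: "merge {j} (set js) (x, y) j = x j" for y
      by (simp add: merge_def)
    show "(\<integral>y. chain_kernel w p (zip (map (merge {j} (set js) (x, y)) (j # js)) \<zeta>s) \<partial>?J) =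
      1 / ((p - x j) * (cnj (x j) - cnj \<zeta>)) * ?I (x j)"
      unfolding \<zeta>s list.map(2) zip_Cons_Cons chain_kernel.simps first rest
      by (rule integral_mult_right_zero)
  qed
  also have "\<dots> = (\<integral>y. 1 / ((p - y) * (cnj y - cnj \<zeta>)) * ?I y \<partial>lborel)"
    by (rule vertices.product_integral_singleton) measurable
  also have "\<dots> = (\<integral>y. 1 / ((p - y) * (cnj y - cnj \<zeta>)) * chain_integral w y \<zeta>s' \<partial>lborel)"
  proof (rule integral_cong_AE)
    show "AE y in lborel. 1 / ((p - y) * (cnj y - cnj \<zeta>)) * ?I y =
      1 / ((p - y) * (cnj y - cnj \<zeta>)) * chain_integral w y \<zeta>s'"
      using fin
    proof eventually_elim
      case (elim y)
      show ?case
        using Cons.IH[OF _ \<zeta>s(2) elim] Cons.prems(1) by simp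
    qed
  qed measurable
  finally show ?case
    by (simp add: \<zeta>s)
qed

text \<open>For fixed other coordinates the exceptional set is a single point of the plane. A
  constant \<open>f\<close> handles outer fields, another coordinate handles a second
  vertex.\<close>

lemma AE_vertex_neq:
  fixes I :: "nat set"
  assumes "finite I" "i \<notin> I" and [measurable]: "f \<in> borel_measurable (\<Pi>\<^sub>M i\<in>insert i I. lborel)"
    and f: "\<And>x y. f (x(i := y)) = f x"
  shows "AE u in (\<Pi>\<^sub>M i\<in>insert i I. (lborel :: complex measure)). u i \<noteq> f u"
proof -
  let ?P = "\<Pi>\<^sub>M i\<in>insert i I. (lborel :: complex measure)"
  let ?h = "\<lambda>u. if u i = f u then 1 else 0 :: ennreal"
  have [measurable]: "?h \<in> borel_measurable ?P"
    by measurable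
  have "(\<integral>\<^sup>+u. ?h u \<partial>?P) = (\<integral>\<^sup>+x. \<integral>\<^sup>+y. ?h (x(i := y)) \<partial>lborel \<partial>(\<Pi>\<^sub>M i\<in>I. lborel))"
    by (intro vertices.product_nn_integral_insert assms) measurable
  also have "\<dots> = (\<integral>\<^sup>+x. \<integral>\<^sup>+y. indicator {f x} y \<partial>lborel \<partial>(\<Pi>\<^sub>M i\<in>I. lborel))"
    by (intro nn_integral_cong) (simp add: f indicator_def)
  also have "\<dots> = 0"
    by simp
  finally have "AE u in ?P. ?h u = 0"
    by (subst (asm) nn_integral_0_iff_AE) simp_all
  then show ?thesis
    by eventually_elim (auto split: if_splits)
qed

lemma AE_distinct_vertices:
  assumes "distinct cs"
  shows "AE u in (\<Pi>\<^sub>M i\<in>{..<N}. (lborel :: complex measure)). distinct (cs @ map u [0..<N])"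
proof -
  have ins: "{..<N} = insert i ({..<N} - {i})" if "i < N" for i
    using that by auto
  have "AE u in (\<Pi>\<^sub>M i\<in>{..<N}. (lborel :: complex measure)). u i \<noteq> c" if "i < N" for i c
    by (subst ins[OF that]) (rule AE_vertex_neq, auto)
  then have 1: "AE u in (\<Pi>\<^sub>M i\<in>{..<N}. (lborel :: complex measure)). \<forall>i\<in>{..<N}. \<forall>c\<in>set cs. u i \<noteq> c"
    by (intro AE_finite_allI) auto
  have "AE u in (\<Pi>\<^sub>M i\<in>{..<N}. (lborel :: complex measure)). u i \<noteq> u j" if "i < N" "j \<in> {..<N} - {i}" for i j
  proof -
    have "AE u in (\<Pi>\<^sub>M i\<in>insert i ({..<N} - {i}). (lborel :: complex measure)). u i \<noteq> u j"
      by (rule AE_vertex_neq) (use that in auto)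
    then show ?thesis
      unfolding ins[OF that(1), symmetric] .
  qed
  then have 2: "AE u in (\<Pi>\<^sub>M i\<in>{..<N}. (lborel :: complex measure)). \<forall>i\<in>{..<N}. \<forall>j\<in>{..<N} - {i}. u i \<noteq> u j"
    by (intro AE_finite_allI) auto
  show ?thesis
    using 1 2
  proof eventually_elim
    case (elim u)
    then have "inj_on u {..<N}"
      by (auto simp: inj_on_def)
    moreover have "{..<N} = {0..<N}"
      by auto
    ultimately show ?case
      using elim(1) assms by (auto simp: distinct_map)
  qed
qed

section \<open>The correlator\<close>

context bf_theory
begin

text \<open>The value at split points. The factorial in the perturbation term has been spent on the
  orderings of the vertices along the chain, which all give the same integral.\<close>

definition gammabar_correlator ::
  "complex \<Rightarrow> (nat \<Rightarrow> complex) \<Rightarrow> (nat \<Rightarrow> 'g) \<Rightarrow> nat list \<Rightarrow> complex \<Rightarrow> complex \<Rightarrow> ('g \<Rightarrow> 'k) \<Rightarrow> 'g \<Rightarrow> complex" where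
  "gammabar_correlator g \<zeta> X ls w1 w2 \<xi> Y =
     (g / (2 * complex_of_real pi)) ^ length ls * (\<Sum>ls'\<in>permutations_of_set (set ls).
        chain_integral w2 w1 (map \<zeta> ls') * ((-1) ^ length ls * \<iota> (\<xi> (ad_word (map X ls') Y))))"

lemma has_correlator_gammabars:
  assumes dist: "distinct (map \<zeta> ls @ [w1, w2])" "distinct ls" and lin: "Vector_Spaces.linear scale (*) \<xi>"
  shows "has_correlator \<kappa> g (gammabars \<zeta> X ls @ [(w1, Fa \<xi>, 0, 0), (w2, Fgamma Y, 0, 0)])
    (gammabar_correlator g \<zeta> X ls w1 w2 \<xi> Y)"
proof -
  let ?\<Phi>s = "gammabars \<zeta> X ls @ [(w1, Fa \<xi>, 0, 0), (w2, Fgamma Y, 0, 0)]"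
  let ?n = "length ls"
  let ?P = "\<lambda>N. \<Pi>\<^sub>M i\<in>{..<N}. (lborel :: complex measure)"
  let ?c = "\<lambda>ls'. (-1) ^ ?n * \<iota> (\<xi> (ad_word (map X ls') Y))"
  let ?F = "\<lambda>u. \<Sum>js'\<in>permutations_of_set {..<?n}. \<Sum>ls'\<in>permutations_of_set (set ls).
       chain_kernel w2 w1 (zip (map u js') (map \<zeta> ls')) * ?c ls'"
  have meas: "integrand \<kappa> ?\<Phi>s N \<in> borel_measurable (?P N)" for N
    by (rule borel_measurable_integrand) (auto simp: rel_jet_def)
  have AE: "AE u in ?P N. integrand \<kappa> ?\<Phi>s N u = (if N = ?n then ?F u else 0)" for N
    using AE_distinct_vertices[OF dist(1)]
  proof eventually_elim
    case (elim u)
    then show ?case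
      using integrand_eq_chains[of \<zeta> ls w1 w2 u N \<xi> \<kappa> X Y] dist(2) lin by (simp add: mult.assoc)
  qed
  have fin: "chain_norm w2 w1 (map \<zeta> ls') < \<infinity>" if "ls' \<in> permutations_of_set (set ls)" for ls'
  proof -
    \<comment> \<open>The entry 1 keeps the set nonempty when there is no gammabar.\<close>
    define d where "d = Min (insert 1 ((\<lambda>l. cmod (\<zeta> l - w2)) ` set ls))"
    have set: "set ls' = set ls"
      using that by (rule permutations_of_setD)
    have d: "d > 0"
      using dist(1) by (auto simp: d_def)
    have "admissible (card (insert w2 (\<zeta> ` set ls))) d w2 (insert w2 (\<zeta> ` set ls)) (map \<zeta> ls')"
      by (auto simp: admissible_def set d_def)
    then show ?thesis
      by (rule chain_norm_finite[OF d]) (use dist(1) in auto)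
  qed
  have int1: "integrable (?P ?n) (\<lambda>u. chain_kernel w2 w1 (zip (map u js') (map \<zeta> ls')))"
    and int2: "(\<integral>u. chain_kernel w2 w1 (zip (map u js') (map \<zeta> ls')) \<partial>?P ?n) = chain_integral w2 w1 (map \<zeta> ls')"
    if "js' \<in> permutations_of_set {..<?n}" "ls' \<in> permutations_of_set (set ls)" for js' ls'
  proof -
    have js: "set js' = {..<?n}" "distinct js'" "length js' = length (map \<zeta> ls')"
      using that length_finite_permutations_of_set[OF that(1)] length_finite_permutations_of_set[OF that(2)] dist(2)
      by (auto dest: permutations_of_setD simp: distinct_card)
    show "integrable (?P ?n) (\<lambda>u. chain_kernel w2 w1 (zip (map u js') (map \<zeta> ls')))"
      using integrable_chain_kernel[OF js(2,3) fin[OF that(2)]] unfolding js(1) .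
    show "(\<integral>u. chain_kernel w2 w1 (zip (map u js') (map \<zeta> ls')) \<partial>?P ?n) = chain_integral w2 w1 (map \<zeta> ls')"
      using integral_chain_kernel[OF js(2,3) fin[OF that(2)]] unfolding js(1) .
  qed
  have intF: "integrable (?P ?n) ?F"
    by (intro Bochner_Integration.integrable_sum integrable_mult_left int1)
  have F: "(\<integral>u. ?F u \<partial>?P ?n) = fact ?n * (\<Sum>ls'\<in>permutations_of_set (set ls). chain_integral w2 w1 (map \<zeta> ls') * ?c ls')"
  proof -
    have "(\<integral>u. ?F u \<partial>?P ?n) = (\<Sum>js'\<in>permutations_of_set {..<?n}. \<Sum>ls'\<in>permutations_of_set (set ls).
       (\<integral>u. chain_kernel w2 w1 (zip (map u js') (map \<zeta> ls')) * ?c ls' \<partial>?P ?n))"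
      by (subst Bochner_Integration.integral_sum;
          (intro Bochner_Integration.integrable_sum integrable_mult_left int1; assumption)?)
        (intro sum.cong refl Bochner_Integration.integral_sum integrable_mult_left int1)
    also have "\<dots> = (\<Sum>js'\<in>permutations_of_set {..<?n}. \<Sum>ls'\<in>permutations_of_set (set ls). chain_integral w2 w1 (map \<zeta> ls') * ?c ls')"
      by (intro sum.cong refl) (simp only: integral_mult_left_zero int2)
    finally show ?thesis
      by simp
  qed
  have meas': "(\<lambda>u. if N = ?n then ?F u else 0) \<in> borel_measurable (?P N)" for N
    using intF by (cases "N = ?n") auto
  have int: "integrable (?P N) (integrand \<kappa> ?\<Phi>s N)" for N
    by (subst integrable_cong_AE[OF meas meas' AE], cases "N = ?n") (use intF in simp_all)
  have "(\<integral>u. integrand \<kappa> ?\<Phi>s N u \<partial>?P N) = (if N = ?n then \<integral>u. ?F u \<partial>?P ?n else 0)" for N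
    by (subst integral_cong_AE[OF meas meas' AE]) auto
  then have pt: "perturbation_term \<kappa> g ?\<Phi>s N = (if N = ?n then gammabar_correlator g \<zeta> X ls w1 w2 \<xi> Y else 0)" for N
    unfolding perturbation_term_def F gammabar_correlator_def by simp
  have "perturbation_term \<kappa> g ?\<Phi>s = (\<lambda>N. if N = ?n then gammabar_correlator g \<zeta> X ls w1 w2 \<xi> Y else 0)"
    using pt by blast
  then have "perturbation_term \<kappa> g ?\<Phi>s sums gammabar_correlator g \<zeta> X ls w1 w2 \<xi> Y"
    using sums_single[of ?n "\<lambda>_. gammabar_correlator g \<zeta> X ls w1 w2 \<xi> Y"] by simp
  then show ?thesis
    unfolding has_correlator_def using int by blast
qed

section \<open>Removing the point splitting\<close>

lemma eventually_collapseI: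
  assumes "\<delta> > 0" "\<And>zs. length zs = n \<Longrightarrow> distinct zs \<Longrightarrow> (\<And>\<zeta>. \<zeta> \<in> set zs \<Longrightarrow> dist \<zeta> z < \<delta>) \<Longrightarrow> P zs"
  shows "eventually P (collapse n z)"
  unfolding collapse_def
  by (rule eventually_INF1[of \<delta>]) (use assms in \<open>auto simp: eventually_principal\<close>)

text \<open>The set \<open>Q\<close> of poles moves with \<open>zs\<close>, but its size, its
  distance from \<open>w1\<close> and the distance of the gammabar points from \<open>w2\<close>
  stay controlled, so one constant serves a whole neighbourhood.\<close>

lemma tendsto_chain_integral_collapse:
  assumes ne: "z \<noteq> w1" "z \<noteq> w2" "w1 \<noteq> w2" and ks: "set ks \<subseteq> {..<n}"
  shows "((\<lambda>zs. chain_integral w2 w1 (map ((!) zs) ks)) \<longlongrightarrow> chain_integral w2 w1 (replicate (length ks) z)) (collapse n z)"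
proof (rule tendstoI)
  fix e :: real assume e: "e > 0"
  \<comment> \<open>Points closer than d to \<open>z\<close> remain at least d away from
    \<open>w2\<close>.\<close>
  define d where "d = cmod (z - w2) / 2"
  \<comment> \<open>A lower bound for the distance of \<open>w1\<close> from every pole; halving
    leaves room for poles near \<open>z\<close>.\<close>
  define m where "m = min (cmod (w1 - w2)) (cmod (w1 - z) / 2)"
  have d: "d > 0" and m: "m > 0"
    using ne by (simp_all add: d_def m_def)
  obtain c where c: "c \<ge> 0" and le: "\<And>Q \<zeta>s p \<epsilon>. length \<zeta>s = length ks \<Longrightarrow> admissible (n + 2) d w2 Q (z # \<zeta>s) \<Longrightarrow> p \<notin> Q \<Longrightarrow> \<epsilon> > 0 \<Longrightarrow>
     (\<forall>\<zeta>\<in>set \<zeta>s. cmod (\<zeta> - z) \<le> \<epsilon>) \<Longrightarrow>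
     cmod (chain_integral w2 p \<zeta>s - chain_integral w2 p (replicate (length ks) z)) \<le> c * \<epsilon> powr (1/4) * powr_sum (1/2) Q p"
    using chain_integral_difference[OF d, of "length ks" "n + 2" w2 z] by blast
  define B where "B = real (n + 2) * m powr (- (1/2))"
  have B: "B \<ge> 0"
    by (simp add: B_def)
  \<comment> \<open>Chosen such that \<open>c * \<eta> * B < e\<close>; the summand 1 covers the
    case that \<open>c * B\<close> is 0.\<close>
  define \<eta> where "\<eta> = e / (2 * (c * B + 1))"
  have cB: "c * B + 1 > 0"
    using c B by (simp add: add_nonneg_pos)
  then have \<eta>: "\<eta> > 0"
    using e by (simp add: \<eta>_def)
  \<comment> \<open>The fourth power compensates the exponent 1/4 of the error.\<close>
  define \<delta> where "\<delta> = min (\<eta> ^ 4) (min d (cmod (w1 - z) / 2))"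
  have \<delta>: "\<delta> > 0"
    using \<eta> d ne by (simp add: \<delta>_def)
  show "\<forall>\<^sub>F zs in collapse n z. dist (chain_integral w2 w1 (map ((!) zs) ks)) (chain_integral w2 w1 (replicate (length ks) z)) < e"
  proof (rule eventually_collapseI[OF \<delta>])
    fix zs :: "complex list"
    assume zs: "length zs = n" "distinct zs" and close: "\<And>\<zeta>. \<zeta> \<in> set zs \<Longrightarrow> dist \<zeta> z < \<delta>"
    define Q where "Q = insert w2 (insert z (set zs))"
    have sub: "set (map ((!) zs) ks) \<subseteq> set zs"
      using ks zs by auto
    have far: "m \<le> cmod (w1 - q)" if q: "q \<in> Q" for q
    proof -
      consider "q = w2" | "q = z" | "q \<in> set zs"
        using q unfolding Q_def by blast
      then show ?thesis
      proof cases
        case 3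
        have "cmod (w1 - z) \<le> cmod (w1 - q) + dist q z"
          unfolding dist_norm by norm
        moreover have "dist q z < cmod (w1 - z) / 2" "m \<le> cmod (w1 - z) / 2"
          using close[OF 3] by (simp_all add: m_def \<delta>_def)
        ultimately show ?thesis
          by linarith
      next
        case 2
        have "m \<le> cmod (w1 - z) / 2"
          by (simp add: m_def)
        then show ?thesis
          unfolding 2 using norm_ge_zero[of "w1 - z"] by linarith
      qed (auto simp: m_def)
    qed
    have card: "card Q \<le> n + 2"
      using card_insert_le_m1 card_length[of zs] zs unfolding Q_def
      by (simp add: card_insert_if)
    have ad: "admissible (n + 2) d w2 Q (z # map ((!) zs) ks)"
      unfolding admissible_def
    proof (intro conjI ballI card)
      fix \<zeta> assume "\<zeta> \<in> set (z # map ((!) zs) ks)"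
      then consider "\<zeta> = z" | "\<zeta> \<in> set zs"
        using sub by auto
      then show "d \<le> cmod (\<zeta> - w2)"
      proof cases
        case 2
        have "cmod (z - w2) \<le> cmod (\<zeta> - w2) + dist \<zeta> z"
          unfolding dist_norm by norm
        then show ?thesis
          using close[OF 2] by (simp add: d_def \<delta>_def)
      qed (simp add: d_def)
    qed (use sub in \<open>auto simp: Q_def\<close>)
    have "w1 \<notin> Q"
      using far[of w1] m by auto
    have "powr_sum (1/2) Q w1 \<le> (\<Sum>q\<in>Q. m powr (- (1/2)))"
      unfolding powr_sum_def by (intro sum_mono powr_mono2') (use far m in auto)
    also have "\<dots> \<le> B"
      using card by (simp add: B_def mult_right_mono del: of_nat_add)
    finally have HB: "powr_sum (1/2) Q w1 \<le> B" .
    have "dist (chain_integral w2 w1 (map ((!) zs) ks)) (chain_integral w2 w1 (replicate (length ks) z)) \<le>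
      c * \<delta> powr (1/4) * powr_sum (1/2) Q w1"
      unfolding dist_norm
      by (rule le) (use ad \<open>w1 \<notin> Q\<close> \<delta> sub close in \<open>auto simp: dist_norm intro!: less_imp_le\<close>)
    also have "\<dots> \<le> c * \<eta> * B"
    proof (intro mult_mono)
      have "\<delta> powr (1/4) \<le> (\<eta> ^ 4) powr (1/4)"
        using \<delta> by (intro powr_mono2) (auto simp: \<delta>_def)
      also have "\<dots> = \<eta>"
      proof -
        have "\<eta> ^ 4 = \<eta> powr 4"
          using \<eta> by simp
        then show ?thesis
          using \<eta> by (simp only: powr_powr) simp
      qed
      finally show "\<delta> powr (1/4) \<le> \<eta>" .
    qed (use c \<eta> HB in auto)
    also have "\<dots> = (c * B) / (c * B + 1) * (e / 2)"
      by (simp add: \<eta>_def mult_ac)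
    also have "\<dots> \<le> 1 * (e / 2)"
      using e cB by (intro mult_right_mono) (simp_all add: divide_le_eq)
    also have "\<dots> < e"
      using e by simp
    finally show "dist (chain_integral w2 w1 (map ((!) zs) ks)) (chain_integral w2 w1 (replicate (length ks) z)) < e" .
  qed
qed

end

text \<open>A permutation of the interval is determined by its list of values there, since it is the
  identity elsewhere. Every ordering arises because both sides have n! elements.\<close>

lemma sum_permutations_of_interval:
  "(\<Sum>ls\<in>permutations_of_set {1..n}. f ls) = (\<Sum>\<sigma> | \<sigma> permutes {1..n}. f (map \<sigma> [1..<Suc n]))"
proof -
  have set: "set [1..<Suc n] = {1..n}"
    by auto
  have inj: "inj_on (\<lambda>\<sigma>. map \<sigma> [1..<Suc n]) {\<sigma>. \<sigma> permutes {1..n}}"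
  proof (rule inj_onI)
    fix \<sigma> \<tau> assume perm: "\<sigma> \<in> {\<sigma>. \<sigma> permutes {1..n}}" "\<tau> \<in> {\<sigma>. \<sigma> permutes {1..n}}"
      and eq: "map \<sigma> [1..<Suc n] = map \<tau> [1..<Suc n]"
    show "\<sigma> = \<tau>"
    proof
      fix i
      show "\<sigma> i = \<tau> i"
      proof (cases "i \<in> {1..n}")
        case True
        then show ?thesis
          using eq unfolding map_eq_conv set by blast
      next
        case False
        then show ?thesis
          using perm by (simp add: permutes_not_in)
      qed
    qed
  qed
  have "(\<lambda>\<sigma>. map \<sigma> [1..<Suc n]) ` {\<sigma>. \<sigma> permutes {1..n}} = permutations_of_set {1..n}"
  proof (rule card_subset_eq)
    show "(\<lambda>\<sigma>. map \<sigma> [1..<Suc n]) ` {\<sigma>. \<sigma> permutes {1..n}} \<subseteq> permutations_of_set {1..n}"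
    proof safe
      fix \<sigma> assume \<sigma>: "\<sigma> permutes {1..n}"
      show "map \<sigma> [1..<Suc n] \<in> permutations_of_set {1..n}"
      proof (rule permutations_of_setI)
        show "set (map \<sigma> [1..<Suc n]) = {1..n}"
          unfolding set_map set using \<sigma> by (rule permutes_image)
        show "distinct (map \<sigma> [1..<Suc n])"
          unfolding distinct_map using permutes_inj_on[OF \<sigma>] by simp
      qed
    qed
    show "card ((\<lambda>\<sigma>. map \<sigma> [1..<Suc n]) ` {\<sigma>. \<sigma> permutes {1..n}}) = card (permutations_of_set {1..n})"
      unfolding card_image[OF inj] by (simp add: card_permutations)
  qed simp
  then show ?thesis
    using sum.reindex[OF inj, of f] by simp
qed

theorem lemma4p6:
  fixes scale :: "'k::field \<Rightarrow> 'g::ab_group_add \<Rightarrow> 'g"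
    and \<B> :: "'g set"
    and bracket :: "'g \<Rightarrow> 'g \<Rightarrow> 'g"
    and \<iota> :: "'k \<Rightarrow> complex"
    and \<kappa> g z w1 w2 :: complex
    and n :: nat
    and X :: "nat \<Rightarrow> 'g"
    and \<xi> :: "'g \<Rightarrow> 'k"
    and Y :: 'g
  assumes "bf_theory scale \<B> bracket \<iota>"
    and "lie_algebra.strongly_unimodular scale \<B> bracket"
    and "z \<noteq> w1" and "z \<noteq> w2" and "w1 \<noteq> w2"
    and "Vector_Spaces.linear scale (*) \<xi>"
  shows "bf_theory.has_gammabar_composite_correlator scale \<B> bracket \<iota> \<kappa> g
           z (map X [1..<Suc n]) [(w1, (Fa \<xi>, 0, 0)), (w2, (Fgamma Y, 0, 0))]
           (g ^ n / fact n
             * \<iota> (\<xi> (\<Sum>\<sigma> | \<sigma> permutes {1..n}. lie_algebra.ad_word bracket (map (X \<circ> \<sigma>) [1..<Suc n]) Y))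
             * (1 / (w1 - w2))
             * complex_of_real (ln (cmod ((z - w2) / (z - w1))) ^ n))"
proof -
  interpret bf_theory scale \<B> bracket \<iota>
    by fact
  interpret \<xi>: Vector_Spaces.linear scale "(*)" \<xi>
    by fact
  let ?ls = "[1..<Suc n]"
  \<comment> \<open>The fields are numbered from 1, the entries of \<open>zs\<close> from 0.\<close>
  let ?\<zeta> = "\<lambda>zs l. zs ! (l - 1) :: complex"
  let ?\<Phi>s = "[(w1, (Fa \<xi>, 0, 0)), (w2, (Fgamma Y, 0, 0))]"
  let ?G = "\<lambda>zs. gammabar_correlator g (?\<zeta> zs) X ?ls w1 w2 \<xi> Y"
  let ?L = "complex_of_real (ln (cmod (z - w2) / cmod (z - w1)) ^ n)"
  have set_ls: "set ?ls = {1..n}"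
    by auto
  have ev: "\<forall>\<^sub>F zs in collapse n z. has_correlator \<kappa> g (map2 (\<lambda>\<zeta> X. (\<zeta>, (Fgammabar X, 0, 0))) zs (map X ?ls) @ ?\<Phi>s) (?G zs)"
  proof (rule eventually_collapseI)
    \<comment> \<open>Points closer to \<open>z\<close> than \<open>w1\<close> and \<open>w2\<close>
      are differ from both.\<close>
    show "min (dist w1 z) (dist w2 z) > 0"
      using assms by auto
    fix zs :: "complex list"
    assume zs: "length zs = n" "distinct zs" and close: "\<And>\<zeta>. \<zeta> \<in> set zs \<Longrightarrow> dist \<zeta> z < min (dist w1 z) (dist w2 z)"
    have map: "map (?\<zeta> zs) ?ls = zs"
      using zs by (intro nth_equalityI) (auto simp del: upt_Suc)
    have "map2 (\<lambda>\<zeta> X. (\<zeta>, (Fgammabar X, 0, 0))) zs (map X ?ls) = gammabars (?\<zeta> zs) X ?ls"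
      using zs by (intro nth_equalityI) (auto simp del: upt_Suc)
    moreover have "distinct (map (?\<zeta> zs) ?ls @ [w1, w2])"
      unfolding map using zs(2) close[of w1] close[of w2] assms by auto
    ultimately show "has_correlator \<kappa> g (map2 (\<lambda>\<zeta> X. (\<zeta>, (Fgammabar X, 0, 0))) zs (map X ?ls) @ ?\<Phi>s) (?G zs)"
      using has_correlator_gammabars[of "?\<zeta> zs" ?ls w1 w2 \<xi> \<kappa> g X Y] assms(6) by simp
  qed
  have lim: "(?G \<longlongrightarrow> (g ^ n / fact n
             * \<iota> (\<xi> (\<Sum>\<sigma> | \<sigma> permutes {1..n}. ad_word (map (X \<circ> \<sigma>) ?ls) Y))
             * (1 / (w1 - w2))
             * complex_of_real (ln (cmod ((z - w2) / (z - w1))) ^ n))) (collapse n z)"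
  proof -
    let ?c = "\<lambda>ls'. (-1) ^ n * \<iota> (\<xi> (ad_word (map X ls') Y))"
    have "((\<lambda>zs. chain_integral w2 w1 (map (?\<zeta> zs) ls')) \<longlongrightarrow> (- 2 * pi) ^ n / fact n * ?L / (w1 - w2)) (collapse n z)"
      if "ls' \<in> permutations_of_set (set ?ls)" for ls'
    proof -
      have ls': "set ls' = {1..n}" "length ls' = n"
        using permutations_of_setD[OF that] length_finite_permutations_of_set[OF that] unfolding set_ls by auto
      have "((\<lambda>zs. chain_integral w2 w1 (map ((!) zs) (map (\<lambda>l. l - 1) ls'))) \<longlongrightarrow>
        chain_integral w2 w1 (replicate (length (map (\<lambda>l. l - 1) ls')) z)) (collapse n z)"
        by (rule tendsto_chain_integral_collapse) (use assms ls' in auto)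
      moreover have "chain_integral w2 w1 (replicate n z) = (- 2 * pi) ^ n / fact n * ?L / (w1 - w2)"
        using chain_integral_collapsed[of z w2 w1 n] assms by auto
      ultimately show ?thesis
        by (simp add: comp_def ls')
    qed
    then have "(?G \<longlongrightarrow> (g / (2 * complex_of_real pi)) ^ length ?ls * (\<Sum>ls'\<in>permutations_of_set (set ?ls).
        (- 2 * pi) ^ n / fact n * ?L / (w1 - w2) * ?c ls')) (collapse n z)"
      unfolding gammabar_correlator_def length_upt diff_Suc_1
      by (intro tendsto_mult tendsto_sum tendsto_const)
    also have "(\<Sum>ls'\<in>permutations_of_set (set ?ls). (- 2 * pi) ^ n / fact n * ?L / (w1 - w2) * ?c ls') =
      (- 2 * pi) ^ n / fact n * ?L / (w1 - w2) * ((-1) ^ n * (\<Sum>ls'\<in>permutations_of_set {1..n}. \<iota> (\<xi> (ad_word (map X ls') Y))))"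
      by (simp only: set_ls sum_distrib_left)
    also have "(\<Sum>ls'\<in>permutations_of_set {1..n}. \<iota> (\<xi> (ad_word (map X ls') Y))) =
      \<iota> (\<xi> (\<Sum>\<sigma> | \<sigma> permutes {1..n}. ad_word (map (X \<circ> \<sigma>) ?ls) Y))"
      unfolding sum_permutations_of_interval by (simp add: \<xi>.sum embed_sum comp_def del: upt_Suc)
    also have "(g / (2 * complex_of_real pi)) ^ length ?ls * ((- 2 * pi) ^ n / fact n * ?L / (w1 - w2) * ((-1) ^ n * S)) =
      g ^ n / fact n * S * (1 / (w1 - w2)) * complex_of_real (ln (cmod ((z - w2) / (z - w1))) ^ n)" for S
    proof -
      \<comment> \<open>Three n-th powers combine: the coupling, the integrations, and the signs
        from the brackets.\<close>
      have "(g / (2 * complex_of_real pi)) ^ n * ((- 2 * complex_of_real pi) ^ n * (-1) ^ n) = g ^ n"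
        unfolding power_mult_distrib[symmetric] by simp
      then have "(g / (2 * complex_of_real pi)) ^ n * (((- 2 * complex_of_real pi) ^ n * (-1) ^ n) * R) = g ^ n * R" for R
        by (simp only: mult.assoc[symmetric])
      from this[of "?L * S / (fact n * (w1 - w2))"] show ?thesis
        by (simp add: norm_divide mult_ac del: upt_Suc)
    qed
    finally show ?thesis .
  qed
  show ?thesis
    unfolding has_gammabar_composite_correlator_def length_map length_upt diff_Suc_1
    by (rule exI[of _ ?G], rule conjI[OF ev lim])
qed

end
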